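(* Let $\Omega$ be an arbitrary index set. Suppose $M$ is a quadratic module of $A_{\Omega}$ and there exists a countable subset $I$ of $\Omega$ such that the quadratic module $M\cap A_{\Omega \setminus I}$ of $A_{\Omega \setminus I}$ is archimedean. Suppose $L : A_{\Omega} \rightarrow \mathbb{R}$ is linear, $L(M) \subseteq [0,\infty)$, and for each $j \in I$ there exists a sequence $\{q_{jk}\}_{k=1}^{\infty}$ in $A_{\Omega}\otimes_{\mathbb{R}} \mathbb{C}$ with $$\lim_{k\rightarrow\infty}L\big(|1-(1+x_j^2)q_{jk}\overline{q_{jk}}|^2\big)=0.$$ Then there exists a unique Radon measure $\nu$ on $\mathbb{R}^{\Omega}$ such that $L = L_{\nu}$, i.e. $L(f)=\int\hat f\,d\nu$ for all $f\in A_\Omega$. Moreover, $\nu$ is supported by $X_M$.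
   Context: For $J\subseteq\Omega$, $A_J=\mathbb{R}[x_i\mid i\in J]$ (so $A_\emptyset=\mathbb{R}$). For $f\in A_\Omega$, $\hat f:\mathbb{R}^\Omega\to\mathbb{R}$ is the evaluation function. $A_\Omega\otimes_{\mathbb{R}}\mathbb{C}=\mathbb{C}[x_i\mid i\in\Omega]$, $\overline q$ is obtained from $q$ by conjugating coefficients, and $|p|^2=p\overline p\in A_\Omega$. A quadratic module of a commutative ring $D$ is a subset $M$ with $1\in M$, $M+M\subseteq M$ and $a^2M\subseteq M$ for all $a\in D$; it is archimedean if for each $a\in D$ there is an integer $k$ with $k+a\in M$ and $k-a\in M$. $X_M=\{\alpha\in\mathbb{R}^\Omega\mid\hat g(\alpha)\ge0\ \forall g\in M\}$. $\mathbb{R}^\Omega$ has the product topology. A Radon measure is a positive measure on the Borel $\sigma$-algebra that is locally finite (every point has a neighbourhood of finite measure) and inner regular (each Borel set can be approximated from within by compact sets). In writing $L=L_\nu$ it is understood that every $\hat f$, $f\in A_\Omega$, is $\nu$-integrable. A measure $\nu$ on $(X,\Sigma)$ is supported by $Y\subseteq X$ if $\nu(E)=0$ for every $E\in\Sigma$ with $E\cap Y=\emptyset$. *)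

theory Defs
  imports "HOL-Analysis.Analysis" "HOL-Library.Poly_Mapping"
begin

section \<open>Polynomials in an arbitrary family of variables\<close>

text \<open>A monomial is a finitely supported exponent function on the variables, and a polynomial a
  finitely supported coefficient function on the monomials. The ring structure is the convolution
  product of \<^theory>\<open>HOL-Library.Poly_Mapping\<close>.\<close>

type_synonym ('i, 'a) mpoly = "('i \<Rightarrow>\<^sub>0 nat) \<Rightarrow>\<^sub>0 'a"

definition Var :: "'i \<Rightarrow> ('i, 'a::zero_neq_one) mpoly" where
  "Var i = Poly_Mapping.single (Poly_Mapping.single i 1) 1"

definition Const :: "'a \<Rightarrow> ('i, 'a::zero) mpoly" where
  "Const c = Poly_Mapping.single 0 c"

definition vars :: "('i, 'a::zero) mpoly \<Rightarrow> 'i set" where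
  "vars p = (\<Union>m\<in>Poly_Mapping.keys p. Poly_Mapping.keys m)"

definition poly_ring :: "'i set \<Rightarrow> ('i, 'a::zero) mpoly set" where
  "poly_ring J = {p. vars p \<subseteq> J}"

definition poly_eval :: "('i, real) mpoly \<Rightarrow> ('i \<Rightarrow> real) \<Rightarrow> real" where
  "poly_eval f \<alpha> = (\<Sum>m\<in>Poly_Mapping.keys f. Poly_Mapping.lookup f m *
     (\<Prod>i\<in>Poly_Mapping.keys m. \<alpha> i ^ Poly_Mapping.lookup m i))"

definition cnj_poly :: "('i, complex) mpoly \<Rightarrow> ('i, complex) mpoly" where
  "cnj_poly p = Poly_Mapping.map cnj p"

text \<open>The product of \<open>p\<close> with its conjugate has real coefficients, see \<open>complexify_norm_sq\<close>
  below; \<open>norm_sq p\<close> is this product as an element of the real polynomial ring.\<close>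

definition norm_sq :: "('i, complex) mpoly \<Rightarrow> ('i, real) mpoly" where
  "norm_sq p = Poly_Mapping.map Re (p * cnj_poly p)"

lemma lookup_cnj_poly: "Poly_Mapping.lookup (cnj_poly p) m = cnj (Poly_Mapping.lookup p m)"
  unfolding cnj_poly_def by (simp add: Poly_Mapping.map.rep_eq when_def)

lemma cnj_Sum_any: "cnj (Sum_any g) = Sum_any (\<lambda>a. cnj (g a))"
  by (simp add: Sum_any.expand_set)

lemma cnj_poly_mult: "cnj_poly (p * q) = cnj_poly p * cnj_poly q"
proof (rule poly_mapping_eqI)
  fix m
  have *: "cnj (x when P) = (cnj x when P)" for x P
    by (simp add: when_def)
  show "Poly_Mapping.lookup (cnj_poly (p * q)) m = Poly_Mapping.lookup (cnj_poly p * cnj_poly q) m"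
    by (simp add: lookup_cnj_poly lookup_mult cnj_Sum_any *)
qed

lemma complexify_norm_sq: "Poly_Mapping.map complex_of_real (norm_sq p) = p * cnj_poly p"
proof (rule poly_mapping_eqI)
  fix m
  have "cnj_poly (cnj_poly p) = p"
    by (rule poly_mapping_eqI) (simp add: lookup_cnj_poly)
  then have "cnj_poly (p * cnj_poly p) = p * cnj_poly p"
    by (simp add: cnj_poly_mult mult.commute)
  then have "cnj (Poly_Mapping.lookup (p * cnj_poly p) m) = Poly_Mapping.lookup (p * cnj_poly p) m"
    by (metis lookup_cnj_poly)
  then show "Poly_Mapping.lookup (Poly_Mapping.map complex_of_real (norm_sq p)) m
      = Poly_Mapping.lookup (p * cnj_poly p) m"
    unfolding norm_sq_def
    by (auto simp: Poly_Mapping.map.rep_eq when_def complex_eq_iff)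
qed

section \<open>Quadratic modules and linear functionals\<close>

text \<open>In the next two definitions \<open>D\<close> is the carrier of a subring of the ambient ring, here always
  a \<open>poly_ring J\<close>.\<close>

definition quadratic_module :: "'a::comm_ring_1 set \<Rightarrow> 'a set \<Rightarrow> bool" where
  "quadratic_module D M \<longleftrightarrow> M \<subseteq> D \<and> 1 \<in> M \<and> (\<forall>f\<in>M. \<forall>g\<in>M. f + g \<in> M) \<and>
     (\<forall>a\<in>D. \<forall>f\<in>M. a\<^sup>2 * f \<in> M)"

definition archimedean_module :: "'a::comm_ring_1 set \<Rightarrow> 'a set \<Rightarrow> bool" where
  "archimedean_module D M \<longleftrightarrow> (\<forall>a\<in>D. \<exists>k::int. of_int k + a \<in> M \<and> of_int k - a \<in> M)"

definition linear_functional_on :: "('i, real) mpoly set \<Rightarrow> (('i, real) mpoly \<Rightarrow> real) \<Rightarrow> bool" where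
  "linear_functional_on A L \<longleftrightarrow> (\<forall>f\<in>A. \<forall>g\<in>A. L (f + g) = L f + L g) \<and>
     (\<forall>c. \<forall>f\<in>A. L (Const c * f) = c * L f)"

text \<open>The real power with exponent \<open>\<Omega>\<close> is the topspace of \<^term>\<open>powertop_real \<Omega>\<close>: functions
  constrained on \<open>\<Omega>\<close> only, with the fixed value \<open>undefined\<close> elsewhere.\<close>

definition nonneg_set :: "'i set \<Rightarrow> ('i, real) mpoly set \<Rightarrow> ('i \<Rightarrow> real) set" where
  "nonneg_set \<Omega> M = {\<alpha> \<in> topspace (powertop_real \<Omega>). \<forall>g\<in>M. 0 \<le> poly_eval g \<alpha>}"

section \<open>Radon measures\<close>

definition borel_of :: "'a topology \<Rightarrow> 'a measure" where
  "borel_of T = sigma (topspace T) {U. openin T U}"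

text \<open>Meant for Hausdorff spaces, where compact sets are Borel.\<close>

definition radon_measure :: "'a topology \<Rightarrow> 'a measure \<Rightarrow> bool" where
  "radon_measure T \<nu> \<longleftrightarrow> sets \<nu> = sets (borel_of T) \<and>
     (\<forall>x\<in>topspace T. \<exists>U. openin T U \<and> x \<in> U \<and> emeasure \<nu> U < \<infinity>) \<and>
     (\<forall>B\<in>sets \<nu>. emeasure \<nu> B = (SUP K\<in>{K. compactin T K \<and> K \<subseteq> B}. emeasure \<nu> K))"

definition supported_by :: "'a measure \<Rightarrow> 'a set \<Rightarrow> bool" where
  "supported_by \<nu> Y \<longleftrightarrow> (\<forall>E\<in>sets \<nu>. E \<inter> Y = {} \<longrightarrow> emeasure \<nu> E = 0)"

definition represents ::
    "'i set \<Rightarrow> (('i, real) mpoly \<Rightarrow> real) \<Rightarrow> ('i \<Rightarrow> real) measure \<Rightarrow> bool" where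
  "represents \<Omega> L \<nu> \<longleftrightarrow>
     (\<forall>f\<in>poly_ring \<Omega>. integrable \<nu> (poly_eval f) \<and> L f = (\<integral>\<alpha>. poly_eval f \<alpha> \<partial>\<nu>))"

end

theory Submission
  imports Defs "HOL-Library.Function_Algebras"
begin

text \<open>For \<open>j \<in> I\<close> the approximation hypothesis lets one divide by \<open>1 + x\<^sub>j\<^sup>2\<close>: the functional
  \<open>f \<mapsto> L (f / (1 + x\<^sub>j\<^sup>2))\<close> is the limit of \<open>f \<mapsto> L (\<bar>q\<^sub>j\<^sub>k\<bar>\<^sup>2 f)\<close>, hence nonnegative on \<open>M\<close>, and it is
  the only positive one. So \<open>L\<close> extends uniquely to the algebra of fractions with denominators
  products of the \<open>1 + x\<^sub>j\<^sup>2\<close>. That algebra contains bounded coordinates: \<open>x\<^sub>i\<close> for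
  \<open>i \<in> \<Omega> - I\<close>, bounded because \<open>M\<close> is archimedean there, and \<open>1 / (1 + x\<^sub>j\<^sup>2)\<close> and
  \<open>x\<^sub>j / (1 + x\<^sub>j\<^sup>2)\<close> for \<open>j \<in> I\<close>. A polynomial in these coordinates that is nonnegative on the
  cube has a nonnegative value under the functional (Bernstein operators, one variable at a time), so
  the Stone-Weierstrass and Riesz theorems give a Radon measure on the cube. The hyperplanes
  \<open>1 / (1 + x\<^sub>j\<^sup>2) = 0\<close> at infinity are null; as \<open>I\<close> is countable they can all be discarded, and the
  measure is transported to \<open>\<real>\<^sup>\<Omega>\<close>. Conversely every representing measure integrates the
  fractions as the extended functional does, which yields uniqueness and the support statement.\<close>

section \<open>Positive functionals on function algebras\<close>

text \<open>The obstacle: the extended functional is known to be nonnegative only on squares times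
  members of \<open>M\<close>, not on pointwise nonnegative functions, and its algebra still
  contains the unbounded \<open>x_j\<close> with \<open>j \<in> I\<close>. Boundedness of the new
  coordinates is therefore expressed inside the functional, as a bound on their even moments against
  every square; this condition survives multiplication by Bernstein weights, which lets the
  induction on variables run. The measure on the cube only knows polynomials in the bounded
  coordinates. Integrals of the original polynomials come back through a geometric series: if
  \<open>Q\<close> stands for \<open>1 / d\<close>, then \<open>g (1 - (1 - Q)^n)\<close> exhausts
  \<open>g\<close>, and for \<open>g \<in> M\<close> the rest is at most a constant over
  \<open>n\<close>, because \<open>n Q (1 - Q)^n \<le> 1\<close>. The same estimate makes the
  hyperplanes at infinity null. For a given representing measure, the bounds on the coordinates
  outside \<open>I\<close> and the inequalities \<open>g \<ge> 0\<close> with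
  \<open>g \<in> M\<close> each hold almost everywhere, but there may be uncountably many of them.
  Their exceptional sets are open, and inner regularity by compact sets makes the union
  null.\<close>

lemma power_fun_apply: "(f ^ n) x = (f x) ^ n"
  for f :: "'x \<Rightarrow> 'a::comm_ring_1"
  by (induction n) auto

lemmas fun_apply = plus_fun_apply times_fun_apply one_fun_apply zero_fun_apply minus_apply uminus_apply
  power_fun_apply

text \<open>The proof method \<open>induction\<close> eta-expands goals about functions, after which these rewrite
  rules would turn every ring operation into its pointwise form.\<close>

declare fun_apply [simp del]

definition fun_algebra :: "('x \<Rightarrow> real) set \<Rightarrow> bool" where
  "fun_algebra A \<longleftrightarrow> (\<forall>c. (\<lambda>_. c) \<in> A) \<and> (\<forall>f\<in>A. \<forall>g\<in>A. f + g \<in> A \<and> f * g \<in> A)"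

locale fun_alg =
  fixes A :: "('x \<Rightarrow> real) set"
  assumes fun_algebra: "fun_algebra A"
begin

lemma const_in [simp]: "(\<lambda>_. c) \<in> A"
  using fun_algebra by (simp add: fun_algebra_def)

lemma add_in [simp]: "f \<in> A \<Longrightarrow> g \<in> A \<Longrightarrow> f + g \<in> A"
  using fun_algebra by (simp add: fun_algebra_def)

lemma mult_in [simp]: "f \<in> A \<Longrightarrow> g \<in> A \<Longrightarrow> f * g \<in> A"
  using fun_algebra by (simp add: fun_algebra_def)

lemma one_in [simp]: "1 \<in> A"
  using const_in[of 1] by (simp add: one_fun_def)

lemma zero_in [simp]: "0 \<in> A"
  using const_in[of 0] by (simp add: zero_fun_def)

lemma uminus_in [simp]: "f \<in> A \<Longrightarrow> - f \<in> A"
  using mult_in[of "\<lambda>_. -1" f] by (simp add: times_fun_def fun_Compl_def)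

lemma diff_in [simp]: "f \<in> A \<Longrightarrow> g \<in> A \<Longrightarrow> f - g \<in> A"
  using add_in[of f "- g"] by simp

lemma power_in [simp]: "f \<in> A \<Longrightarrow> f ^ n \<in> A"
  by (induction n) auto

lemma sum_in: "(\<And>i. i \<in> S \<Longrightarrow> f i \<in> A) \<Longrightarrow> sum f S \<in> A"
  by (induction S rule: infinite_finite_induct) auto

end

locale functional = fun_alg A for A :: "('x \<Rightarrow> real) set" +
  fixes T :: "('x \<Rightarrow> real) \<Rightarrow> real"
  assumes add: "f \<in> A \<Longrightarrow> g \<in> A \<Longrightarrow> T (f + g) = T f + T g"
    and scale: "f \<in> A \<Longrightarrow> T ((\<lambda>_. c) * f) = c * T f"
begin

lemma uminus: "f \<in> A \<Longrightarrow> T (- f) = - T f"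
  using scale[of f "-1"] by (simp add: times_fun_def fun_Compl_def)

lemma diff: "f \<in> A \<Longrightarrow> g \<in> A \<Longrightarrow> T (f - g) = T f - T g"
  using add[of f "- g"] uminus[of g] by simp

lemma zero [simp]: "T 0 = 0"
  using diff[of 0 0] by simp

lemma sum: "(\<And>i. i \<in> S \<Longrightarrow> f i \<in> A) \<Longrightarrow> T (sum f S) = (\<Sum>i\<in>S. T (f i))"
  by (induction S rule: infinite_finite_induct) (auto simp: add sum_in)

lemma functional_times: "d \<in> A \<Longrightarrow> functional A (\<lambda>f. T (d * f))"
  using scale[of "d * f" c for f c]
  by unfold_locales (auto simp: distrib_left add mult.left_commute)

end

locale pos_functional = functional A T for A :: "('x \<Rightarrow> real) set" and T +
  assumes sq: "h \<in> A \<Longrightarrow> 0 \<le> T (h\<^sup>2)"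
begin

text \<open>Discriminant of the nonnegative form \<open>(s, t) \<mapsto> T ((s f + t g)^2)\<close>.
  A nonzero \<open>g\<close> may have \<open>T (g^2) = 0\<close>, which gives the separate case
  \<open>a = 0\<close>.\<close>

lemma Cauchy_Schwarz:
  assumes f: "f \<in> A" and g: "g \<in> A"
  shows "(T (f * g))\<^sup>2 \<le> T (f\<^sup>2) * T (g\<^sup>2)"
proof -
  define a b c where "a = T (g\<^sup>2)" and "b = T (f * g)" and "c = T (f\<^sup>2)"
  have q: "0 \<le> s\<^sup>2 * c + 2 * s * t * b + t\<^sup>2 * a" for s t
  proof -
    have eq: "((\<lambda>_. s) * f + (\<lambda>_. t) * g)\<^sup>2
        = (\<lambda>_. s\<^sup>2) * f\<^sup>2 + ((\<lambda>_. 2 * s * t) * (f * g) + (\<lambda>_. t\<^sup>2) * g\<^sup>2)"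
      by (rule ext) (simp add: fun_apply power2_eq_square algebra_simps)
    have "0 \<le> T (((\<lambda>_. s) * f + (\<lambda>_. t) * g)\<^sup>2)"
      using f g by (intro sq) auto
    also have "\<dots> = s\<^sup>2 * c + 2 * s * t * b + t\<^sup>2 * a"
      unfolding eq a_def b_def c_def using f g by (simp add: add scale)
    finally show ?thesis .
  qed
  have a0: "0 \<le> a" and c0: "0 \<le> c"
    using sq f g by (auto simp: a_def c_def)
  show ?thesis
  proof (cases "a = 0")
    case True
    have "b = 0"
    proof (rule ccontr)
      assume "b \<noteq> 0"
      \<comment> \<open>At this point the form equals \<open>c - (c + 1) = -1\<close>.\<close>
      then show False
        using q[of 1 "-(c+1)/(2*b)"] True by (simp add: field_simps)
    qed
    then show ?thesis using True by (simp add: a_def b_def)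
  next
    case False
    then have a: "a > 0" using a0 by simp
    \<comment> \<open>At \<open>(a, - b)\<close> the form is \<open>a (a c - b^2)\<close>.\<close>
    have "a * b\<^sup>2 \<le> a * (a * c)"
      using q[of a "-b"] by (simp add: power2_eq_square algebra_simps)
    then have "b\<^sup>2 \<le> a * c"
      using a by simp
    then show ?thesis by (simp add: a_def b_def c_def mult.commute)
  qed
qed

lemma Cauchy_Schwarz_abs:
  assumes f: "f \<in> A" and g: "g \<in> A"
  shows "\<bar>T (f * g)\<bar> \<le> sqrt (T (f\<^sup>2)) * sqrt (T (g\<^sup>2))"
  using Cauchy_Schwarz[OF assms] by (simp add: real_le_rsqrt real_sqrt_mult[symmetric])

text \<open>Parallelogram identity, with the nonnegative term \<open>T ((f + g)^2)\<close>
  dropped.\<close>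

lemma sq_diff_le:
  assumes f: "f \<in> A" and g: "g \<in> A"
  shows "T ((f - g)\<^sup>2) \<le> 2 * T (f\<^sup>2) + 2 * T (g\<^sup>2)"
proof -
  have "(f - g)\<^sup>2 + (f + g)\<^sup>2 = (\<lambda>_. 2) * (f\<^sup>2 + g\<^sup>2)"
    by (rule ext) (simp add: fun_apply power2_eq_square algebra_simps)
  then have "T ((f - g)\<^sup>2) + T ((f + g)\<^sup>2) = T ((\<lambda>_. 2) * (f\<^sup>2 + g\<^sup>2))"
    using f g add[of "(f-g)\<^sup>2" "(f+g)\<^sup>2"] by simp
  then show ?thesis
    using sq[of "f + g"] f g by (simp add: scale add)
qed

end

section \<open>Dividing a positive functional by factors \<open>1 + s^2\<close>\<close>

locale extension =
  fixes A M :: "('x \<Rightarrow> real) set" and l :: "('x \<Rightarrow> real) \<Rightarrow> real" and S :: "('x \<Rightarrow> real) set"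
  assumes functional_l: "functional A l"
    and M_sub: "M \<subseteq> A"
    and one_M: "1 \<in> M"
    and add_M: "f \<in> M \<Longrightarrow> g \<in> M \<Longrightarrow> f + g \<in> M"
    and sq_M: "a \<in> A \<Longrightarrow> f \<in> M \<Longrightarrow> a\<^sup>2 * f \<in> M"
    and l_nonneg: "f \<in> M \<Longrightarrow> 0 \<le> l f"
    and S_sub: "S \<subseteq> A"
    and approx: "s \<in> S \<Longrightarrow> \<exists>a b. (\<forall>k::nat. a k \<in> A \<and> b k \<in> A) \<and>
          (\<lambda>k. l ((1 - (1 + s\<^sup>2) * ((a k)\<^sup>2 + (b k)\<^sup>2))\<^sup>2)) \<longlonglongrightarrow> 0"
begin

sublocale functional A l by (rule functional_l)

definition good :: "(('x \<Rightarrow> real) \<Rightarrow> real) \<Rightarrow> bool" where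
  "good T \<longleftrightarrow> functional A T \<and> (\<forall>f\<in>M. 0 \<le> T f)"

text \<open>The monoid of denominators generated by the \<open>1 + s^2\<close>; a list records the
  factors with multiplicity.\<close>

definition D :: "('x \<Rightarrow> real) set" where
  "D = {prod_list (map (\<lambda>s. 1 + s\<^sup>2) ss) | ss. set ss \<subseteq> S}"

lemma D_one: "1 \<in> D"
  unfolding D_def by (auto intro!: exI[of _ "[]"])

lemma D_step: "s \<in> S \<Longrightarrow> d \<in> D \<Longrightarrow> (1 + s\<^sup>2) * d \<in> D"
  unfolding D_def
proof clarify
  fix ss assume "s \<in> S" "set ss \<subseteq> S"
  then show "\<exists>ts. (1 + s\<^sup>2) * prod_list (map (\<lambda>s. 1 + s\<^sup>2) ss) = prod_list (map (\<lambda>s. 1 + s\<^sup>2) ts) \<and> set ts \<subseteq> S"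
    by (intro exI[of _ "s # ss"]) auto
qed

lemma D_induct [consumes 1, case_names one step]:
  assumes "d \<in> D" "P 1" "\<And>s d. s \<in> S \<Longrightarrow> d \<in> D \<Longrightarrow> P d \<Longrightarrow> P ((1 + s\<^sup>2) * d)"
  shows "P d"
proof -
  have "P (prod_list (map (\<lambda>s. 1 + s\<^sup>2) ss))" if "set ss \<subseteq> S" for ss
    using that
  proof (induction ss)
    case (Cons s ss)
    then have "prod_list (map (\<lambda>s. 1 + s\<^sup>2) ss) \<in> D" by (auto simp: D_def)
    then show ?case using Cons assms(3) by simp
  qed (use assms(2) in simp)
  then show ?thesis using assms(1) by (auto simp: D_def)
qed

lemma sq_in_M: "a \<in> A \<Longrightarrow> a\<^sup>2 \<in> M"
  using sq_M[OF _ one_M] by simp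

lemma good_pos: "good T \<Longrightarrow> pos_functional A T"
  by (auto simp: good_def pos_functional_def pos_functional_axioms_def sq_in_M)

lemma good_l: "good l"
  using functional_l l_nonneg by (auto simp: good_def)

lemma D_sub: "d \<in> D \<Longrightarrow> d \<in> A"
  by (induction rule: D_induct) (use S_sub in auto)

lemma D_ge_1: "d \<in> D \<Longrightarrow> 1 \<le> d x"
proof (induction rule: D_induct)
  case (step s d)
  have "1 * 1 \<le> (1 + (s x)\<^sup>2) * d x"
    using step by (intro mult_mono) auto
  then show ?case by (simp add: fun_apply)
qed (simp add: fun_apply)

lemma D_mult: "d \<in> D \<Longrightarrow> e \<in> D \<Longrightarrow> d * e \<in> D"
  by (induction rule: D_induct) (auto intro: D_one D_step simp: mult.assoc)

lemma D_sq_M: "d \<in> D \<Longrightarrow> f \<in> M \<Longrightarrow> d * f \<in> M"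
proof (induction rule: D_induct)
  case (step s d)
  have "(1 + s\<^sup>2) * d * f = d * f + s\<^sup>2 * (d * f)"
    by (simp add: algebra_simps)
  then show ?case
    using step S_sub by (auto intro!: add_M sq_M)
qed auto

text \<open>\<open>d - 1\<close> is a sum of squares: a factor \<open>1 + s^2\<close> adds a term
  with \<open>s h\<close> in place of \<open>h\<close>, hence the induction over all
  \<open>h\<close>.\<close>

lemma D_sq_ge: 
  assumes "d \<in> D" "pos_functional A T" "h \<in> A"
  shows "T (h\<^sup>2) \<le> T (d * h\<^sup>2)"
  using assms
proof (induction arbitrary: h rule: D_induct)
  case one
  then show ?case by simp
next
  case (step s d)
  interpret T: pos_functional A T by fact
  have sA: "s \<in> A" using step S_sub by auto
  have eq: "(1 + s\<^sup>2) * d * h\<^sup>2 = d * h\<^sup>2 + d * (s * h)\<^sup>2"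
    by (simp add: algebra_simps power2_eq_square)
  have dA: "d \<in> A" using step D_sub by auto
  have "T ((1 + s\<^sup>2) * d * h\<^sup>2) = T (d * h\<^sup>2) + T (d * (s * h)\<^sup>2)"
    unfolding eq using sA dA step by (intro T.add) auto
  moreover have "T (h\<^sup>2) \<le> T (d * h\<^sup>2)" "T ((s*h)\<^sup>2) \<le> T (d * (s * h)\<^sup>2)"
    using step sA by auto
  moreover have "0 \<le> T ((s*h)\<^sup>2)"
    using step sA by (intro T.sq) auto
  ultimately show ?case by linarith
qed

lemma pos_times_D:
  assumes "d \<in> D" "pos_functional A T"
  shows "pos_functional A (\<lambda>f. T (d * f))"
proof -
  interpret T: pos_functional A T by fact
  interpret F: functional A "\<lambda>f. T (d * f)"
    by (rule T.functional_times) (rule D_sub[OF assms(1)])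
  show ?thesis
  proof
    fix h assume "h \<in> A"
    then show "0 \<le> T (d * h\<^sup>2)"
      using D_sq_ge[OF assms, of h] T.sq[of h] by linarith
  qed
qed

text \<open>\<open>T\<close> stands for \<open>f \<mapsto> l (f / d)\<close>. By
  \<open>D_sq_ge\<close>, \<open>T (e^2) \<le> T (d e^2) = l (e^2)\<close>, so smallness known for
  \<open>l\<close> passes to \<open>T\<close>, and Cauchy-Schwarz does the rest.\<close>

lemma defect_tendsto:
  assumes d: "d \<in> D" and T: "pos_functional A T" and Tl: "\<And>f. f \<in> A \<Longrightarrow> T (d * f) = l f"
    and e: "\<And>k::nat. e k \<in> A" "(\<lambda>k. l ((e k)\<^sup>2)) \<longlonglongrightarrow> 0" and f: "f \<in> A"
  shows "(\<lambda>k. T (e k * f)) \<longlonglongrightarrow> 0"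
proof -
  interpret T: pos_functional A T by fact
  have 1: "(\<lambda>k. sqrt (l ((e k)\<^sup>2)) * sqrt (T (f\<^sup>2))) \<longlonglongrightarrow> 0"
    using tendsto_mult[OF tendsto_real_sqrt[OF e(2)] tendsto_const] by simp
  show ?thesis
  proof (rule Lim_null_comparison[OF _ 1], rule always_eventually, rule allI)
    fix k
    have "T ((e k)\<^sup>2) \<le> l ((e k)\<^sup>2)"
      using D_sq_ge[OF d T e(1)[of k]] Tl[of "(e k)\<^sup>2"] e by simp
    moreover have "\<bar>T (e k * f)\<bar> \<le> sqrt (T ((e k)\<^sup>2)) * sqrt (T (f\<^sup>2))"
      by (rule T.Cauchy_Schwarz_abs[OF e(1) f])
    ultimately show "norm (T (e k * f)) \<le> sqrt (l ((e k)\<^sup>2)) * sqrt (T (f\<^sup>2))"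
      by (smt (verit) T.sq f mult_right_mono real_norm_def real_sqrt_ge_zero real_sqrt_le_mono)
  qed
qed

text \<open>Positivity determines a functional on \<open>A\<close> that plays the role of \<open>f \<mapsto> l (f / d)\<close>.\<close>

lemma divided_unique:
  assumes "d \<in> D" "pos_functional A T" "pos_functional A T'"
    and "\<And>f. f \<in> A \<Longrightarrow> T (d * f) = l f" "\<And>f. f \<in> A \<Longrightarrow> T' (d * f) = l f"
    and "f \<in> A"
  shows "T f = T' f"
  using assms
proof (induction arbitrary: T T' f rule: D_induct)
  case one
  then show ?case by simp
next
  case (step s d)
  define w where "w = 1 + s\<^sup>2"
  have wd: "w * d \<in> D" using step unfolding w_def by (intro D_step)
  have sA: "s \<in> A" using step S_sub by auto
  have wD: "w \<in> D" using D_step[OF step(1) D_one] by (simp add: w_def)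
  have wA: "w \<in> A" using sA by (simp add: w_def)
  have dA: "d \<in> A" using step D_sub by auto
  obtain a b where ab: "\<And>k::nat. a k \<in> A" "\<And>k. b k \<in> A"
    and lim: "(\<lambda>k. l ((1 - (1 + s\<^sup>2) * ((a k)\<^sup>2 + (b k)\<^sup>2))\<^sup>2)) \<longlonglongrightarrow> 0"
    using approx[OF step(1)] by blast
  \<comment> \<open>\<open>u k\<close> approximates \<open>1 / w\<close> by a sum of two squares;
    \<open>e k\<close> is the defect, and \<open>l ((e k)^2)\<close> tends to 0.\<close>
  define u where "u k = (a k)\<^sup>2 + (b k)\<^sup>2" for k
  define e where "e k = 1 - w * u k" for k
  have uA: "u k \<in> A" for k using ab by (simp add: u_def)
  have eA: "e k \<in> A" for k using uA wA by (simp add: e_def)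
  \<comment> \<open>\<open>f \<mapsto> T (w f)\<close> and \<open>f \<mapsto> T' (w f)\<close> solve
    the problem for the shorter denominator \<open>d\<close>, so they agree. In
    \<open>f = e k * f + w * (u k * f)\<close> only the first term can tell \<open>T\<close> from
    \<open>T'\<close>, and it vanishes in the limit.\<close>
  have eq: "T (w * f) = T' (w * f)" if "f \<in> A" for f
  proof (rule step.IH[where T = "\<lambda>f. T (w * f)" and T' = "\<lambda>f. T' (w * f)"])
    show "T (w * (d * f)) = l f" "T' (w * (d * f)) = l f" if "f \<in> A" for f
      using step.prems(3,4)[OF that] by (simp_all add: w_def mult.assoc)
  qed (use step.prems pos_times_D[OF wD] that in auto)
  have lim0: "(\<lambda>k. P (e k * f)) \<longlonglongrightarrow> 0" if "pos_functional A P" "\<And>f. f \<in> A \<Longrightarrow> P (w * d * f) = l f" for P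
    using defect_tendsto[OF wd that eA _ \<open>f \<in> A\<close>] lim by (simp add: e_def u_def w_def)
  have "(\<lambda>k. T (e k * f) - T' (e k * f)) \<longlonglongrightarrow> 0 - 0"
    by (intro tendsto_diff lim0) (use step.prems in \<open>auto simp: w_def\<close>)
  moreover have "T (e k * f) - T' (e k * f) = T f - T' f" for k
  proof -
    have *: "P (e k * f) = P f - P (w * (u k * f))" if "pos_functional A P" for P
    proof -
      interpret P: pos_functional A P by fact
      have "e k * f = f - w * (u k * f)" by (simp add: e_def algebra_simps)
      then show ?thesis using P.diff[of f "w * (u k * f)"] step.prems uA wA by simp
    qed
    then show ?thesis
      using *[OF step.prems(1)] *[OF step.prems(2)] eq[of "u k * f"] step.prems(5) uA[of k] by simp
  qed
  ultimately have "(\<lambda>k::nat. T f - T' f) \<longlonglongrightarrow> 0" by simp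
  then show ?case
    using LIMSEQ_unique tendsto_const by fastforce
qed

text \<open>\<open>T' f\<close> is the limit of \<open>T (u k * f)\<close> with \<open>u k\<close> a
  sum of two squares approximating \<open>1 / (1 + s^2)\<close>. Multiplication by
  \<open>u k\<close> preserves \<open>M\<close>, so nonnegativity on all of \<open>M\<close>, not
  only on squares, passes to the limit.\<close>

lemma divided_step:
  assumes s: "s \<in> S" and d: "d \<in> D" and T: "good T" and Tl: "\<And>f. f \<in> A \<Longrightarrow> T (d * f) = l f"
  shows "\<exists>T'. good T' \<and> (\<forall>f\<in>A. T' ((1 + s\<^sup>2) * f) = T f)"
proof -
  interpret T: pos_functional A T by (rule good_pos[OF T])
  define w where "w = 1 + s\<^sup>2"
  have sA: "s \<in> A" using s S_sub by auto
  have wA: "w \<in> A" using sA by (simp add: w_def)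
  have dA: "d \<in> A" using d D_sub by auto
  obtain a b where ab: "\<And>k::nat. a k \<in> A" "\<And>k. b k \<in> A"
    and lim: "(\<lambda>k. l ((1 - (1 + s\<^sup>2) * ((a k)\<^sup>2 + (b k)\<^sup>2))\<^sup>2)) \<longlonglongrightarrow> 0"
    using approx[OF s] by blast
  define u where "u k = (a k)\<^sup>2 + (b k)\<^sup>2" for k
  define e where "e k = 1 - w * u k" for k
  have uA: "u k \<in> A" for k using ab by (simp add: u_def)
  have eA: "e k \<in> A" for k using uA wA by (simp add: e_def)
  have lim_e: "(\<lambda>k. l ((e k)\<^sup>2)) \<longlonglongrightarrow> 0"
    using lim by (simp add: e_def u_def w_def)
  have Te: "T ((e k)\<^sup>2) \<le> l ((e k)\<^sup>2)" for k
    using D_sq_ge[OF d good_pos[OF T] eA[of k]] Tl[of "(e k)\<^sup>2"] eA by simp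
  \<comment> \<open>The defects control \<open>w (u m - u n)\<close>; this inequality removes the
    factor \<open>w\<close>.\<close>
  have wT: "T (h\<^sup>2) \<le> T ((w * h)\<^sup>2)" if "h \<in> A" for h
  proof -
    have w2: "w * w * 1 \<in> D" unfolding w_def mult.assoc by (intro D_one D_step s)
    have "(w * h)\<^sup>2 = w * w * 1 * h\<^sup>2" by (simp add: power2_eq_square algebra_simps)
    then show ?thesis
      using D_sq_ge[OF w2 good_pos[OF T] that] by simp
  qed
  have conv: "convergent (\<lambda>k. T (u k * f))" if f: "f \<in> A" for f
  proof (rule Cauchy_convergent)
    show "Cauchy (\<lambda>k. T (u k * f))"
    proof (rule CauchyI)
      fix \<epsilon> :: real assume e0: "\<epsilon> > 0"
      \<comment> \<open>The added 1 keeps \<open>C\<close> positive. The 4 in the threshold below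
        absorbs two defects, each with the factor 2 from \<open>sq_diff_le\<close>.\<close>
      define C where "C = T (f\<^sup>2) + 1"
      have C: "C > 0" using T.sq[OF f] by (simp add: C_def)
      have "eventually (\<lambda>k. l ((e k)\<^sup>2) < \<epsilon>\<^sup>2 / (4 * C)) sequentially"
        using lim_e e0 C by (intro order_tendstoD) auto
      then obtain N where N: "\<And>k. k \<ge> N \<Longrightarrow> l ((e k)\<^sup>2) < \<epsilon>\<^sup>2 / (4 * C)"
        by (auto simp: eventually_sequentially)
      show "\<exists>N. \<forall>m\<ge>N. \<forall>n\<ge>N. norm (T (u m * f) - T (u n * f)) < \<epsilon>"
      proof (intro exI allI impI)
        fix m n assume mn: "m \<ge> N" "n \<ge> N"
        have eq: "w * (u m - u n) = e n - e m"
          by (simp add: e_def algebra_simps)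
        have "T ((u m - u n)\<^sup>2) \<le> T ((w * (u m - u n))\<^sup>2)"
          by (rule wT) (simp add: uA)
        also have "\<dots> \<le> 2 * T ((e n)\<^sup>2) + 2 * T ((e m)\<^sup>2)"
          unfolding eq by (intro T.sq_diff_le eA)
        also have "\<dots> < \<epsilon>\<^sup>2 / C"
          using Te[of m] Te[of n] N[OF mn(1)] N[OF mn(2)] by simp
        finally have 1: "T ((u m - u n)\<^sup>2) < \<epsilon>\<^sup>2 / C" .
        have "T (u m * f) - T (u n * f) = T ((u m - u n) * f)"
          using uA f by (simp add: T.diff[symmetric] algebra_simps)
        then have "(T (u m * f) - T (u n * f))\<^sup>2 \<le> T ((u m - u n)\<^sup>2) * T (f\<^sup>2)"
          using T.Cauchy_Schwarz[of "u m - u n" f] uA f by simp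
        also have "\<dots> \<le> T ((u m - u n)\<^sup>2) * C"
          using T.sq[of "u m - u n"] uA by (intro mult_left_mono) (auto simp: C_def)
        also have "\<dots> < \<epsilon>\<^sup>2" using 1 C by (simp add: field_simps)
        finally show "norm (T (u m * f) - T (u n * f)) < \<epsilon>"
          using e0 by (metis abs_of_pos power2_less_imp_less abs_ge_zero power2_abs real_norm_def less_imp_le)
      qed
    qed
  qed
  define T' where "T' f = lim (\<lambda>k. T (u k * f))" for f
  have T': "(\<lambda>k. T (u k * f)) \<longlonglongrightarrow> T' f" if "f \<in> A" for f
    using conv[OF that] by (simp add: T'_def convergent_LIMSEQ_iff)
  have fun': "functional A T'"
  proof
    fix f g assume fg: "f \<in> A" "g \<in> A"
    have "(\<lambda>k. T (u k * (f + g))) \<longlonglongrightarrow> T' f + T' g"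
      using tendsto_add[OF T'[OF fg(1)] T'[OF fg(2)]] fg uA by (simp add: distrib_left T.add)
    then show "T' (f + g) = T' f + T' g"
      using T'[of "f + g"] fg LIMSEQ_unique by auto
  next
    fix f c assume f: "f \<in> A"
    have "T (u k * ((\<lambda>_. c) * f)) = c * T (u k * f)" for k
      using T.scale[of "u k * f" c] f uA by (simp add: mult.left_commute)
    then have "(\<lambda>k. T (u k * ((\<lambda>_. c) * f))) \<longlonglongrightarrow> c * T' f"
      using tendsto_mult[OF tendsto_const[of c] T'[OF f]] by simp
    then show "T' ((\<lambda>_. c) * f) = c * T' f"
      using T'[of "(\<lambda>_. c) * f"] f LIMSEQ_unique by auto
  qed
  have "0 \<le> T' f" if f: "f \<in> M" for f
  proof -
    have "0 \<le> T (u k * f)" for k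
    proof -
      have "u k * f = (a k)\<^sup>2 * f + (b k)\<^sup>2 * f" by (simp add: u_def algebra_simps)
      then have "u k * f \<in> M" using f ab by (auto intro: add_M sq_M)
      then show ?thesis using T by (simp add: good_def)
    qed
    then show ?thesis using T'[of f] f M_sub LIMSEQ_le_const by fastforce
  qed
  moreover have "T' (w * f) = T f" if f: "f \<in> A" for f
  proof -
    have "(\<lambda>k. T (e k * f)) \<longlonglongrightarrow> 0"
      by (rule defect_tendsto[OF d good_pos[OF T] Tl eA lim_e f])
    then have "(\<lambda>k. T f - T (e k * f)) \<longlonglongrightarrow> T f"
      using tendsto_diff[OF tendsto_const] by fastforce
    moreover have "T f - T (e k * f) = T (u k * (w * f))" for k
    proof -
      have "u k * (w * f) = f - e k * f" by (simp add: e_def algebra_simps)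
      then show ?thesis using T.diff[of f "e k * f"] f eA by simp
    qed
    ultimately show ?thesis
      using T'[of "w * f"] f wA LIMSEQ_unique by auto
  qed
  ultimately show ?thesis
    using fun' unfolding good_def w_def by blast
qed

lemma divided_exists:
  assumes "d \<in> D"
  shows "\<exists>T. good T \<and> (\<forall>f\<in>A. T (d * f) = l f)"
  using assms
proof (induction rule: D_induct)
  case one
  then show ?case using good_l by auto
next
  case (step s d)
  then obtain T where T: "good T" "\<And>f. f \<in> A \<Longrightarrow> T (d * f) = l f" by blast
  obtain T' where T': "good T'" "\<And>f. f \<in> A \<Longrightarrow> T' ((1 + s\<^sup>2) * f) = T f"
    using divided_step[OF step(1,2) T] by blast
  have "T' ((1 + s\<^sup>2) * d * f) = l f" if "f \<in> A" for f
    using T'(2)[of "d * f"] T(2)[OF that] that D_sub[OF step(2)] by (simp add: mult.assoc)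
  then show ?case using T' by blast
qed

text \<open>The functional \<open>f \<mapsto> l (f / d)\<close>. On \<open>A\<close> the choice is
  forced by \<open>divided_unique\<close>; outside \<open>A\<close> it is arbitrary.\<close>

definition divided :: "('x \<Rightarrow> real) \<Rightarrow> ('x \<Rightarrow> real) \<Rightarrow> real" where
  "divided d = (SOME T. good T \<and> (\<forall>f\<in>A. T (d * f) = l f))"

lemma divided:
  assumes "d \<in> D"
  shows "good (divided d)" "f \<in> A \<Longrightarrow> divided d (d * f) = l f"
  using someI_ex[OF divided_exists[OF assms]] unfolding divided_def by auto

text \<open>The rule \<open>e f / (d e) = f / d\<close>: as functionals of \<open>f\<close> both
  sides are positive and send \<open>d f\<close> to \<open>l f\<close>, so uniqueness
  applies.\<close>

lemma divided_mult:
  assumes d: "d \<in> D" and e: "e \<in> D" and f: "f \<in> A"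
  shows "divided (d * e) (e * f) = divided d f"
proof (rule divided_unique[OF d _ _ _ _ f])
  show "pos_functional A (\<lambda>f. divided (d * e) (e * f))"
    using D_mult[OF d e] by (intro pos_times_D e good_pos divided)
  show "pos_functional A (divided d)" by (intro good_pos divided d)
  fix f assume f: "f \<in> A"
  show "divided (d * e) (e * (d * f)) = l f"
    using divided(2)[OF D_mult[OF d e] f] by (simp add: algebra_simps)
  show "divided d (d * f) = l f" by (rule divided(2)[OF d f])
qed

section \<open>The algebra of fractions and the extended functional\<close>

definition B :: "('x \<Rightarrow> real) set" where
  "B = {\<phi>. \<exists>d\<in>D. d * \<phi> \<in> A}"

definition Lam :: "('x \<Rightarrow> real) \<Rightarrow> real" where
  "Lam \<phi> = (let d = SOME d. d \<in> D \<and> d * \<phi> \<in> A in divided d (d * \<phi>))"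

text \<open>Two denominators are compared through their product by \<open>divided_mult\<close>, so
  the choice made in \<open>Lam\<close> is immaterial.\<close>

lemma Lam_eq:
  assumes d: "d \<in> D" and dA: "d * \<phi> \<in> A"
  shows "Lam \<phi> = divided d (d * \<phi>)"
proof -
  define e where "e = (SOME d. d \<in> D \<and> d * \<phi> \<in> A)"
  have e: "e \<in> D" "e * \<phi> \<in> A"
    using someI[of "\<lambda>d. d \<in> D \<and> d * \<phi> \<in> A" d] assms unfolding e_def by auto
  have "Lam \<phi> = divided e (e * \<phi>)" by (simp add: Lam_def Let_def e_def)
  also have "\<dots> = divided (e * d) (d * (e * \<phi>))"
    using divided_mult[OF e(1) d e(2)] by simp
  also have "\<dots> = divided (d * e) (e * (d * \<phi>))" by (simp add: algebra_simps)
  also have "\<dots> = divided d (d * \<phi>)" by (rule divided_mult[OF d e(1) dA])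
  finally show ?thesis .
qed

lemma A_sub_B: "f \<in> A \<Longrightarrow> f \<in> B"
  unfolding B_def using D_one by force

lemma Lam_A: "f \<in> A \<Longrightarrow> Lam f = l f"
  using Lam_eq[OF D_one, of f] divided(2)[OF D_one, of f] by simp

lemma common_denominator:
  assumes "\<phi> \<in> B" "\<psi> \<in> B"
  obtains d where "d \<in> D" "d * \<phi> \<in> A" "d * \<psi> \<in> A"
proof -
  obtain d e where "d \<in> D" "d * \<phi> \<in> A" "e \<in> D" "e * \<psi> \<in> A"
    using assms by (auto simp: B_def)
  then have "d * e \<in> D" "e * (d * \<phi>) \<in> A" "d * (e * \<psi>) \<in> A"
    using D_sub by (auto intro: D_mult)
  then show ?thesis using that[of "d * e"] by (simp add: algebra_simps)
qed

lemma functional_Lam: "functional B Lam"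
proof unfold_locales
  show "fun_algebra B"
    unfolding fun_algebra_def
  proof (intro conjI allI ballI)
    fix c :: real show "(\<lambda>_. c) \<in> B" by (simp add: A_sub_B)
  next
    fix f g assume fg: "f \<in> B" "g \<in> B"
    obtain d where d: "d \<in> D" "d * f \<in> A" "d * g \<in> A" by (rule common_denominator[OF fg])
    then have "d * (f + g) \<in> A" "(d * f) * (d * g) \<in> A" by (auto simp: distrib_left)
    then show "f + g \<in> B"
      using d(1) unfolding B_def by blast
    have eq: "(d * d) * (f * g) = (d * f) * (d * g)" by (simp add: algebra_simps)
    have "(d * d) * (f * g) \<in> A" unfolding eq using d by simp
    then show "f * g \<in> B"
      using D_mult[OF d(1) d(1)] unfolding B_def by blast
  qed
next
  fix f g assume fg: "f \<in> B" "g \<in> B"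
  obtain d where d: "d \<in> D" "d * f \<in> A" "d * g \<in> A" by (rule common_denominator[OF fg])
  interpret T: pos_functional A "divided d" by (intro good_pos divided d)
  have "d * (f + g) \<in> A" using d by (simp add: distrib_left)
  then show "Lam (f + g) = Lam f + Lam g"
    using d by (simp add: Lam_eq distrib_left T.add)
next
  fix f c assume "f \<in> B"
  then obtain d where d: "d \<in> D" "d * f \<in> A" by (auto simp: B_def)
  interpret T: pos_functional A "divided d" by (intro good_pos divided d)
  have eq: "d * ((\<lambda>_. c) * f) = (\<lambda>_. c) * (d * f)" by (simp add: algebra_simps)
  have "d * ((\<lambda>_. c) * f) \<in> A" unfolding eq using d by simp
  then have "Lam ((\<lambda>_. c) * f) = divided d (d * ((\<lambda>_. c) * f))"
    by (rule Lam_eq[OF d(1)])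
  also have "\<dots> = c * Lam f"
    unfolding eq using Lam_eq[OF d] T.scale[OF d(2)] by simp
  finally show "Lam ((\<lambda>_. c) * f) = c * Lam f" .
qed

text \<open>Clearing denominators by the square \<open>d * d\<close> turns \<open>h^2 g\<close> into
  \<open>(d h)^2 g\<close>, a member of \<open>M\<close>.\<close>

lemma Lam_sq_M:
  assumes h: "h \<in> B" and g: "g \<in> M"
  shows "0 \<le> Lam (h\<^sup>2 * g)"
proof -
  obtain d where d: "d \<in> D" "d * h \<in> A" using h by (auto simp: B_def)
  have eq: "d * d * (h\<^sup>2 * g) = (d * h)\<^sup>2 * g" by (simp add: power2_eq_square algebra_simps)
  have M: "(d * h)\<^sup>2 * g \<in> M" using d g by (intro sq_M)
  have "Lam (h\<^sup>2 * g) = divided (d * d) ((d * h)\<^sup>2 * g)"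
    using Lam_eq[OF D_mult[OF d(1) d(1)], of "h\<^sup>2 * g"] M M_sub unfolding eq by auto
  then show ?thesis
    using divided(1)[OF D_mult[OF d(1) d(1)]] M by (simp add: good_def)
qed

lemma inverse_in_B:
  assumes "d \<in> D"
  shows "(\<lambda>x. 1 / d x) \<in> B"
proof -
  have "d * (\<lambda>x. 1 / d x) = 1"
    by (rule ext) (use D_ge_1[OF assms] in \<open>simp add: fun_apply le_less_trans[OF _ less_le_trans] field_simps; metis not_one_le_zero\<close>)
  then show ?thesis unfolding B_def using assms one_in by force
qed

text \<open>Meant for \<open>F\<close> the integral against a representing measure, which is
  nonnegative on pointwise nonnegative functions. Then \<open>f \<mapsto> F (f / d)\<close> is one
  of the functionals that \<open>divided_unique\<close> compares.\<close>

lemma Lam_unique: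
  assumes F: "functional B F" and mono: "\<And>\<phi>. \<phi> \<in> B \<Longrightarrow> (\<And>x. 0 \<le> \<phi> x) \<Longrightarrow> 0 \<le> F \<phi>"
    and eq: "\<And>f. f \<in> A \<Longrightarrow> F f = l f" and \<phi>: "\<phi> \<in> B"
  shows "F \<phi> = Lam \<phi>"
proof -
  interpret F: functional B F by fact
  obtain d where d: "d \<in> D" "d * \<phi> \<in> A" using \<phi> by (auto simp: B_def)
  have d0: "d x > 0" for x using D_ge_1[OF d(1), of x] by linarith
  define i where "i = (\<lambda>x. 1 / d x)"
  have i: "i \<in> B" using inverse_in_B[OF d(1)] by (simp add: i_def)
  have di: "d * (i * f) = f" "i * (d * f) = f" for f
    by (rule ext, use d0 in \<open>simp add: fun_apply i_def less_imp_neq[symmetric]\<close>)+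
  have "F (i * (d * \<phi>)) = divided d (d * \<phi>)"
  proof (rule divided_unique[OF d(1) _ _ _ _ d(2)])
    show "pos_functional A (divided d)" by (intro good_pos divided d)
    have FA: "F (f + g) = F f + F g" if "f \<in> B" "g \<in> B" for f g
      using F.add that by auto
    show "pos_functional A (\<lambda>f. F (i * f))"
    proof
      fix f g c assume "f \<in> A" "g \<in> A"
      then show "F (i * (f + g)) = F (i * f) + F (i * g)"
        using i F.add by (simp add: distrib_left A_sub_B)
    next
      fix f c assume "f \<in> A"
      then show "F (i * ((\<lambda>_. c) * f)) = c * F (i * f)"
        using i F.scale[of "i * f" c] by (simp add: A_sub_B mult.left_commute)
    next
      fix h assume "h \<in> A"
      then show "0 \<le> F (i * h\<^sup>2)"
        using d0 i by (intro mono) (auto simp: i_def A_sub_B fun_apply less_imp_le)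
    qed
    fix f assume "f \<in> A"
    then show "F (i * (d * f)) = l f" "divided d (d * f) = l f"
      using eq d by (auto simp: di divided)
  qed
  then show ?thesis using Lam_eq[OF d] by (simp add: di)
qed

end

section \<open>Positivity on the cube\<close>

text \<open>The ratios \<open>s (m + 1) / s m\<close> cannot decrease, so a first ratio
  \<open>r > 1\<close> would force growth like \<open>r ^ m\<close>.\<close>

lemma log_convex_bounded:
  fixes s :: "nat \<Rightarrow> real"
  assumes nn: "\<And>m. 0 \<le> s m" and lc: "\<And>m. (s (Suc m))\<^sup>2 \<le> s m * s (Suc (Suc m))"
    and bd: "\<And>m. s m \<le> C"
  shows "s 1 \<le> s 0"
proof (rule ccontr)
  assume "\<not> s 1 \<le> s 0"
  then have lt: "s 0 < s 1" by simp
  have s0: "0 < s 0"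
    using lc[of 0] nn[of 0] lt by (cases "s 0 = 0") auto
  define r where "r = s 1 / s 0"
  have r: "r > 1" using lt s0 by (simp add: r_def)
  have grow: "0 < s m \<and> r * s m \<le> s (Suc m)" for m
  proof (induction m)
    case 0
    then show ?case using s0 by (simp add: r_def)
  next
    case (Suc m)
    have "0 < r * s m" using Suc r by simp
    then have pos: "0 < s (Suc m)" using Suc by linarith
    have "s m * (r * s (Suc m)) \<le> s (Suc m) * s (Suc m)"
      using Suc pos by (simp add: mult.left_commute mult_mono)
    also have "\<dots> \<le> s m * s (Suc (Suc m))"
      using lc[of m] by (simp add: power2_eq_square)
    finally have "r * s (Suc m) \<le> s (Suc (Suc m))"
      using Suc by simp
    then show ?case using pos by simp
  qed
  have "r ^ m * s 0 \<le> s m" for m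
  proof (induction m)
    case (Suc m)
    have "r * (r ^ m * s 0) \<le> r * s m" using Suc r by simp
    then show ?case using grow[of m] by simp
  qed simp
  moreover obtain m where "C / s 0 < r ^ m"
    using real_arch_pow[OF r] by blast
  ultimately show False
    using bd[of m] s0 by (smt (verit) pos_divide_less_eq)
qed

text \<open>The factor \<open>x (1 - x)\<close> is kept so that the identity also holds at the end
  points. It turns multiplication by \<open>k - n x\<close> into a derivative, and so yields a
  recursion on powers of \<open>k / n\<close>.\<close>

lemma Bernstein_derivative:
  assumes "k \<le> n"
  shows "\<exists>B'. (Bernstein n k has_real_derivative B') (at x) \<and>
           x * (1 - x) * B' = (real k - real n * x) * Bernstein n k x"
proof -
  let ?B' = "real (n choose k) * (real k * x ^ (k - 1)) * (1 - x) ^ (n - k) +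
       real (n choose k) * x ^ k * (- (real (n - k) * (1 - x) ^ (n - k - 1)))"
  have D: "(Bernstein n k has_real_derivative ?B') (at x)"
    unfolding Bernstein_def by (auto intro!: derivative_eq_intros simp: algebra_simps)
  have a: "x * (real k * x ^ (k - 1)) = real k * x ^ k"
    by (cases k) auto
  have b: "(1 - x) * (real (n - k) * (1 - x) ^ (n - k - 1)) = real (n - k) * (1 - x) ^ (n - k)"
    by (cases "n - k") auto
  have "x * (1 - x) * ?B' = real (n choose k) * (x * (real k * x ^ (k - 1))) * (1 - x) ^ (n - k) * (1 - x)
     - real (n choose k) * x ^ k * x * ((1 - x) * (real (n - k) * (1 - x) ^ (n - k - 1)))"
    by (simp add: algebra_simps)
  also have "\<dots> = (real k - real n * x) * Bernstein n k x"
    unfolding a b using assms by (simp add: Bernstein_def of_nat_diff algebra_simps)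
  finally have "x * (1 - x) * ?B' = (real k - real n * x) * Bernstein n k x" .
  then show ?thesis using D by blast
qed

text \<open>The Bernstein operators do not raise the degree, so their convergence on a monomial can be
  stated for coefficients; uniform convergence would not suffice for an unbounded functional.\<close>

lemma Bernstein_monomial:
  "\<exists>c. (\<forall>n\<ge>1. \<forall>x. (\<Sum>k\<le>n. Bernstein n k x * (real k / real n) ^ r) = (\<Sum>s\<le>r. c n s * x ^ s)) \<and>
       (\<forall>s\<le>r. (\<lambda>n. c n s) \<longlonglongrightarrow> (if s = r then 1 else 0))"
proof (induction r)
  case 0
  show ?case by (rule exI[of _ "\<lambda>n s. 1"]) simp
next
  case (Suc r)
  then obtain c where c: "\<And>n x. n \<ge> 1 \<Longrightarrow> (\<Sum>k\<le>n. Bernstein n k x * (real k / real n) ^ r) = (\<Sum>s\<le>r. c n s * x ^ s)"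
    and lim: "\<And>s. s \<le> r \<Longrightarrow> (\<lambda>n. c n s) \<longlonglongrightarrow> (if s = r then 1 else 0)" by blast
  \<comment> \<open>Write \<open>p_r\<close> for the Bernstein sum of the \<open>r\<close>-th power.
    The derivative formula gives \<open>p_(r+1) = x p_r + x (1 - x) p_r' / n\<close>, and
    \<open>c' n s\<close> is the coefficient of \<open>x ^ s\<close> on the right.\<close>
  define c' where "c' n s = (if s = 0 then 0 else c n (s - 1) * (1 - real (s - 1) / n))
      + (if s \<le> r then c n s * (real s / n) else 0)" for n s
  have "(\<Sum>k\<le>n. Bernstein n k x * (real k / real n) ^ Suc r) = (\<Sum>s\<le>Suc r. c' n s * x ^ s)"
    if n: "n \<ge> 1" for n x
  proof -
    obtain B' where B': "\<And>k. k \<le> n \<Longrightarrow> (Bernstein n k has_real_derivative B' k) (at x)"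
       "\<And>k. k \<le> n \<Longrightarrow> x * (1 - x) * B' k = (real k - real n * x) * Bernstein n k x"
      using Bernstein_derivative[of _ n x] by metis
    have d1: "((\<lambda>x. \<Sum>k\<le>n. Bernstein n k x * (real k / real n) ^ r)
       has_real_derivative (\<Sum>k\<le>n. B' k * (real k / real n) ^ r)) (at x)"
      by (intro DERIV_sum DERIV_cmult_right B') auto
    have d2: "((\<lambda>x. \<Sum>s\<le>r. c n s * x ^ s)
       has_real_derivative (\<Sum>s\<le>r. c n s * (real s * x ^ (s - 1)))) (at x)"
      by (intro DERIV_sum DERIV_cmult) (auto intro!: derivative_eq_intros)
    have "(\<Sum>k\<le>n. B' k * (real k / real n) ^ r) = (\<Sum>s\<le>r. c n s * (real s * x ^ (s - 1)))"
      using d1 d2 c[OF n] by (auto intro: DERIV_unique)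
    then have "x * (1 - x) * (\<Sum>k\<le>n. B' k * (real k / real n) ^ r)
        = x * (1 - x) * (\<Sum>s\<le>r. c n s * (real s * x ^ (s - 1)))" by simp
    moreover have "x * (1 - x) * (\<Sum>k\<le>n. B' k * (real k / real n) ^ r)
        = (\<Sum>k\<le>n. (real k - real n * x) * Bernstein n k x * (real k / real n) ^ r)"
      using B'(2) by (auto simp: sum_distrib_left mult.assoc[symmetric] intro!: sum.cong)
    moreover have "\<dots> = real n * ((\<Sum>k\<le>n. Bernstein n k x * (real k / real n) ^ Suc r)
        - x * (\<Sum>k\<le>n. Bernstein n k x * (real k / real n) ^ r))"
      using n by (auto simp: sum_distrib_left sum_subtractf[symmetric] field_simps intro!: sum.cong)
    moreover have "x * (1 - x) * (\<Sum>s\<le>r. c n s * (real s * x ^ (s - 1)))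
        = (\<Sum>s\<le>r. c n s * real s * x ^ s) - (\<Sum>s\<le>r. c n s * real s * x ^ Suc s)"
    proof -
      have "x * (1 - x) * (c n s * (real s * x ^ (s - 1))) = c n s * real s * x ^ s - c n s * real s * x ^ Suc s" for s
        by (cases s) (auto simp: algebra_simps)
      then show ?thesis by (simp add: sum_distrib_left sum_subtractf)
    qed
    ultimately have "real n * (\<Sum>k\<le>n. Bernstein n k x * (real k / real n) ^ Suc r) =
        real n * x * (\<Sum>s\<le>r. c n s * x ^ s)
        + (\<Sum>s\<le>r. c n s * real s * x ^ s) - (\<Sum>s\<le>r. c n s * real s * x ^ Suc s)"
      using c[OF n] by (simp add: algebra_simps)
    then have "(\<Sum>k\<le>n. Bernstein n k x * (real k / real n) ^ Suc r) =
        (real n * x * (\<Sum>s\<le>r. c n s * x ^ s)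
        + (\<Sum>s\<le>r. c n s * real s * x ^ s) - (\<Sum>s\<le>r. c n s * real s * x ^ Suc s)) / n"
      using n by (simp add: field_simps)
    also have "\<dots> = (\<Sum>s\<le>r. c n s * (1 - real s / n) * x ^ Suc s) + (\<Sum>s\<le>r. c n s * (real s / n) * x ^ s)"
      using n by (simp add: sum_distrib_left sum_divide_distrib sum_subtractf[symmetric] sum.distrib[symmetric] add_divide_distrib diff_divide_distrib algebra_simps)
    also have "\<dots> = (\<Sum>s\<le>Suc r. c' n s * x ^ s)"
    proof -
      have "(\<Sum>s\<le>Suc r. c' n s * x ^ s) =
          (\<Sum>s\<le>Suc r. (if s = 0 then 0 else c n (s - 1) * (1 - real (s - 1) / n)) * x ^ s)
         + (\<Sum>s\<le>Suc r. (if s \<le> r then c n s * (real s / n) else 0) * x ^ s)"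
        by (simp only: c'_def distrib_right sum.distrib)
      also have "(\<Sum>s\<le>Suc r. (if s = 0 then 0 else c n (s - 1) * (1 - real (s - 1) / n)) * x ^ s)
          = (\<Sum>s\<le>r. c n s * (1 - real s / n) * x ^ Suc s)"
        by (simp only: sum.atMost_Suc_shift) simp
      also have "(\<Sum>s\<le>Suc r. (if s \<le> r then c n s * (real s / n) else 0) * x ^ s)
          = (\<Sum>s\<le>r. c n s * (real s / n) * x ^ s)"
        by simp
      finally show ?thesis by simp
    qed
    finally show ?thesis .
  qed
  moreover have "(\<lambda>n. c' n s) \<longlonglongrightarrow> (if s = Suc r then 1 else 0)" if s: "s \<le> Suc r" for s
  proof -
    have z: "(\<lambda>n. a / real n) \<longlonglongrightarrow> 0" for a
      by (rule lim_const_over_n)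
    have 1: "(\<lambda>n. if s = 0 then 0 else c n (s - 1) * (1 - real (s - 1) / n)) \<longlonglongrightarrow> (if s = Suc r then 1 else 0)"
    proof (cases s)
      case (Suc q)
      have "(\<lambda>n. c n q * (1 - real q / n)) \<longlonglongrightarrow> (if q = r then 1 else 0) * (1 - 0)"
        using s Suc by (intro tendsto_mult lim tendsto_diff tendsto_const z) auto
      then show ?thesis using Suc by simp
    qed simp
    have 2: "(\<lambda>n. if s \<le> r then c n s * (real s / n) else 0) \<longlonglongrightarrow> 0"
    proof (cases "s \<le> r")
      case True
      have "(\<lambda>n. c n s * (real s / n)) \<longlonglongrightarrow> (if s = r then 1 else 0) * 0"
        using True by (intro tendsto_mult lim z) auto
      then show ?thesis using True by simp
    qed simp
    show ?thesis unfolding c'_def using tendsto_add[OF 1 2] by simp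
  qed
  ultimately show ?case by blast
qed

section \<open>Polynomial functions and their expansion in one variable\<close>

inductive polyfun :: "'n set \<Rightarrow> (('n \<Rightarrow> real) \<Rightarrow> real) \<Rightarrow> bool" for V where
  const: "polyfun V (\<lambda>_. c)"
| var: "i \<in> V \<Longrightarrow> polyfun V (\<lambda>t. t i)"
| add: "polyfun V P \<Longrightarrow> polyfun V Q \<Longrightarrow> polyfun V (\<lambda>t. P t + Q t)"
| mult: "polyfun V P \<Longrightarrow> polyfun V Q \<Longrightarrow> polyfun V (\<lambda>t. P t * Q t)"

lemma polyfun_mono: "polyfun V P \<Longrightarrow> V \<subseteq> W \<Longrightarrow> polyfun W P"
  by (induction rule: polyfun.induct) (auto intro: polyfun.intros)

lemma polyfun_finite: "polyfun V P \<Longrightarrow> \<exists>W. finite W \<and> W \<subseteq> V \<and> polyfun W P"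
proof (induction rule: polyfun.induct)
  case (const c)
  show ?case by (rule exI[of _ "{}"]) (auto intro: polyfun.intros)
next
  case (var i)
  then show ?case by (intro exI[of _ "{i}"]) (auto intro: polyfun.intros)
next
  case (add P Q)
  then obtain W1 W2 where "finite W1" "W1 \<subseteq> V" "polyfun W1 P" "finite W2" "W2 \<subseteq> V" "polyfun W2 Q"
    by blast
  then show ?case
    by (intro exI[of _ "W1 \<union> W2"]) (auto intro!: polyfun.intros intro: polyfun_mono)
next
  case (mult P Q)
  then obtain W1 W2 where "finite W1" "W1 \<subseteq> V" "polyfun W1 P" "finite W2" "W2 \<subseteq> V" "polyfun W2 Q"
    by blast
  then show ?case
    by (intro exI[of _ "W1 \<union> W2"]) (auto intro!: polyfun.intros intro: polyfun_mono)
qed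

lemma polyfun_empty: "polyfun {} P \<Longrightarrow> \<exists>c. P = (\<lambda>_. c)"
  by (induction rule: polyfun.induct) auto

lemma polyfun_cong: "polyfun V P \<Longrightarrow> (\<And>i. i \<in> V \<Longrightarrow> s i = t i) \<Longrightarrow> P s = P t"
  by (induction rule: polyfun.induct) auto

lemma polyfun_power: "polyfun V P \<Longrightarrow> polyfun V (\<lambda>t. P t ^ n)"
  by (induction n) (auto intro: polyfun.intros)

lemma polyfun_cmult: "polyfun V P \<Longrightarrow> polyfun V (\<lambda>t. c * P t)"
  by (intro polyfun.intros)

lemma polyfun_diff: "polyfun V P \<Longrightarrow> polyfun V Q \<Longrightarrow> polyfun V (\<lambda>t. P t - Q t)"
  using polyfun.add[OF _ polyfun_cmult[of V Q "-1"], of P] by simp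

lemma polyfun_sum: "(\<And>i. i \<in> S \<Longrightarrow> polyfun V (P i)) \<Longrightarrow> polyfun V (\<lambda>t. \<Sum>i\<in>S. P i t)"
  by (induction S rule: infinite_finite_induct) (auto intro: polyfun.intros)

lemma polyfun_prod: "(\<And>i. i \<in> S \<Longrightarrow> polyfun V (P i)) \<Longrightarrow> polyfun V (\<lambda>t. \<Prod>i\<in>S. P i t)"
  by (induction S rule: infinite_finite_induct) (auto intro: polyfun.intros)

text \<open>Polynomials in \<open>t i\<close> whose coefficients use the variables \<open>V\<close>
  only. Induction over this form reduces statements about an operator in the variable
  \<open>i\<close> to the terms \<open>Q t * t i ^ r\<close>.\<close>

inductive monomial_span :: "'n \<Rightarrow> 'n set \<Rightarrow> (('n \<Rightarrow> real) \<Rightarrow> real) \<Rightarrow> bool" for i V where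
  base: "polyfun V Q \<Longrightarrow> monomial_span i V (\<lambda>t. Q t * t i ^ r)"
| add: "monomial_span i V P \<Longrightarrow> monomial_span i V Q \<Longrightarrow> monomial_span i V (\<lambda>t. P t + Q t)"

lemma monomial_span_mult:
  assumes "monomial_span i V P" "monomial_span i V Q"
  shows "monomial_span i V (\<lambda>t. P t * Q t)"
  using assms
proof (induction rule: monomial_span.induct)
  case (base P r)
  from base(2,1) show ?case
  proof (induction rule: monomial_span.induct)
    case (base Q s)
    have "monomial_span i V (\<lambda>t. (P t * Q t) * t i ^ (r + s))"
      using base by (intro monomial_span.base polyfun.mult)
    then show ?case by (simp add: power_add mult_ac)
  next
    case (add Q R)
    then show ?case
      using monomial_span.add[of i V "\<lambda>t. P t * t i ^ r * Q t" "\<lambda>t. P t * t i ^ r * R t"]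
      by (simp add: distrib_left)
  qed
next
  case (add P R)
  then show ?case
    using monomial_span.add[of i V "\<lambda>t. P t * Q t" "\<lambda>t. R t * Q t"] by (simp add: distrib_right)
qed

lemma polyfun_insert: "polyfun (insert i V) P \<Longrightarrow> monomial_span i V P"
proof (induction rule: polyfun.induct)
  case (const c)
  show ?case using monomial_span.base[OF polyfun.const[of V c], of i 0] by simp
next
  case (var j)
  show ?case
  proof (cases "j = i")
    case True
    then show ?thesis using monomial_span.base[OF polyfun.const[of V 1], of i 1] by simp
  next
    case False
    then have "polyfun V (\<lambda>t. t j)" using var by (intro polyfun.var) auto
    then show ?thesis using monomial_span.base[of V "\<lambda>t. t j" i 0] by simp
  qed
qed (auto intro: monomial_span.add monomial_span_mult)

lemma monomial_span_update:
  "monomial_span i V P \<Longrightarrow> i \<notin> V \<Longrightarrow> polyfun V (\<lambda>t. P (t(i := a)))"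
proof (induction rule: monomial_span.induct)
  case (base Q r)
  have "Q (t(i := a)) = Q t" for t
    by (rule polyfun_cong[OF base(1)]) (use base in auto)
  then show ?case using base polyfun.mult[OF _ polyfun.const[of V "a ^ r"], of Q] by (simp del: fun_upd_apply add: fun_upd_same)
qed (auto intro: polyfun.intros)

section \<open>Functionals that see the generators as bounded\<close>

locale generators = fun_alg B for B :: "('x \<Rightarrow> real) set" +
  fixes b :: "'n \<Rightarrow> 'x \<Rightarrow> real"
  assumes b_in [simp]: "b n \<in> B"
begin

text \<open>\<open>C\<close> may depend on \<open>h\<close> and \<open>n\<close>: this weak form is
  easily inherited by weighted functionals, and \<open>admissible_contraction\<close> sharpens it to
  the bound that \<open>\<bar>b n\<bar> \<le> 1\<close> would give.\<close>

definition admissible :: "(('x \<Rightarrow> real) \<Rightarrow> real) \<Rightarrow> bool" where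
  "admissible \<Phi> \<longleftrightarrow> pos_functional B \<Phi> \<and> (\<forall>n. \<forall>h\<in>B. \<exists>C. \<forall>m. \<Phi> (h\<^sup>2 * b n ^ (2 * m)) \<le> C)"

text \<open>Moves the range \<open>[-1, 1]\<close> to \<open>[0, 1]\<close>, where the Bernstein
  weights are nonnegative.\<close>

definition u :: "'n \<Rightarrow> 'x \<Rightarrow> real" where
  "u n = (\<lambda>x. (1 + b n x) / 2)"

lemma u_alt: "u n = (\<lambda>_. 1/2) * (1 + b n)"
  by (rule ext) (simp add: fun_apply u_def)

lemma u_in [simp]: "u n \<in> B"
  unfolding u_alt by simp

text \<open>The even moments of \<open>b n\<close> against \<open>h^2\<close> are log-convex by
  Cauchy-Schwarz and bounded by admissibility, so \<open>log_convex_bounded\<close> compares the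
  first two.\<close>

lemma admissible_contraction:
  assumes "admissible \<Phi>" "h \<in> B"
  shows "\<Phi> (h\<^sup>2 * (b n)\<^sup>2) \<le> \<Phi> (h\<^sup>2)"
proof -
  interpret pos_functional B \<Phi> using assms by (simp add: admissible_def)
  obtain C where C: "\<And>m. \<Phi> (h\<^sup>2 * b n ^ (2 * m)) \<le> C"
    using assms unfolding admissible_def by blast
  define s where "s m = \<Phi> (h\<^sup>2 * b n ^ (2 * m))" for m
  have "s 1 \<le> s 0"
  proof (rule log_convex_bounded)
    show "s m \<le> C" for m using C by (simp add: s_def)
    have eq: "(h * b n ^ m)\<^sup>2 = h\<^sup>2 * b n ^ (2 * m)" for m
      by (rule ext) (simp add: fun_apply power_mult_distrib power_even_eq power2_eq_square power_mult)
    show "0 \<le> s m" for m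
      using sq[of "h * b n ^ m"] assms by (simp add: s_def eq)
    show "(s (Suc m))\<^sup>2 \<le> s m * s (Suc (Suc m))" for m
    proof -
      have "(h * b n ^ m) * (h * b n ^ Suc (Suc m)) = (h * b n ^ Suc m)\<^sup>2"
        by (simp add: power2_eq_square mult_ac)
      then show ?thesis
        using Cauchy_Schwarz[of "h * b n ^ m" "h * b n ^ Suc (Suc m)"] assms
        unfolding s_def eq[symmetric] by simp
    qed
  qed
  then show ?thesis by (simp add: s_def)
qed

text \<open>By \<open>v = ((1 + v) / 2)^2 - ((1 - v) / 2)^2\<close>, a moment of the weighted
  functional is at most the moment of \<open>\<Phi>\<close> with \<open>p = (1 + v) h / 2\<close> in
  place of \<open>h\<close>.\<close>

lemma admissible_times:
  assumes "admissible \<Phi>" and v: "v \<in> B" and nonneg: "\<And>h. h \<in> B \<Longrightarrow> 0 \<le> \<Phi> (v * h\<^sup>2)"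
  shows "admissible (\<lambda>f. \<Phi> (v * f))"
proof -
  interpret P: pos_functional B \<Phi> using assms by (simp add: admissible_def)
  interpret F: functional B "\<lambda>f. \<Phi> (v * f)" by (rule P.functional_times[OF v])
  have "\<exists>C. \<forall>m. \<Phi> (v * (h\<^sup>2 * b n ^ (2 * m))) \<le> C" if h: "h \<in> B" for n h
  proof -
    define p where "p = (\<lambda>_. 1/2) * (1 + v) * h"
    define q where "q = (\<lambda>_. 1/2) * (1 - v) * h"
    have pq: "p \<in> B" "q \<in> B" using v h by (auto simp: p_def q_def)
    obtain C where C: "\<And>m. \<Phi> (p\<^sup>2 * b n ^ (2 * m)) \<le> C"
      using assms(1) pq unfolding admissible_def by blast
    have "\<Phi> (v * (h\<^sup>2 * b n ^ (2 * m))) \<le> C" for m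
    proof -
      have "v * (h\<^sup>2 * b n ^ (2 * m)) = p\<^sup>2 * b n ^ (2 * m) - (q * b n ^ m)\<^sup>2"
        by (rule ext) (simp add: fun_apply p_def q_def power2_eq_square power_mult_distrib power_mult field_simps)
      then have "\<Phi> (v * (h\<^sup>2 * b n ^ (2 * m))) = \<Phi> (p\<^sup>2 * b n ^ (2 * m)) - \<Phi> ((q * b n ^ m)\<^sup>2)"
        using pq by (simp add: P.diff)
      then show ?thesis
        using C[of m] P.sq[of "q * b n ^ m"] pq by simp
    qed
    then show ?thesis by blast
  qed
  then show ?thesis
    unfolding admissible_def
    by (auto intro!: pos_functional.intro pos_functional_axioms.intro nonneg F.functional_axioms)
qed

text \<open>For \<open>c^2 = 1\<close>,
  \<open>(1 + c b) / 2 = ((1 + c b)^2 + (1 - b^2)) / 4\<close>; against \<open>h^2\<close> the first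
  summand gives a square and the second is handled by \<open>admissible_contraction\<close>. The
  signs \<open>c = 1\<close> and \<open>c = -1\<close> give the two weights.\<close>

lemma admissible_u:
  assumes "admissible \<Phi>"
  shows "admissible (\<lambda>f. \<Phi> (u n * f))" "admissible (\<lambda>f. \<Phi> ((1 - u n) * f))"
proof -
  interpret P: pos_functional B \<Phi> using assms by (simp add: admissible_def)
  have *: "0 \<le> \<Phi> ((\<lambda>x. (1 + c * b n x) / 2) * h\<^sup>2)" if h: "h \<in> B" and c: "c\<^sup>2 = 1" for c h
  proof -
    define p where "p = ((\<lambda>_. 1) + (\<lambda>_. c) * b n) * h"
    have p: "p \<in> B" using h by (simp add: p_def)
    have "c * (c * y) = y" for y
      using c by (simp add: power2_eq_square mult.assoc[symmetric])
    then have "(\<lambda>x. (1 + c * b n x) / 2) * h\<^sup>2 = (\<lambda>_. 1/4) * (p\<^sup>2 + (h\<^sup>2 - h\<^sup>2 * (b n)\<^sup>2))"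
      by (intro ext) (simp add: fun_apply p_def power2_eq_square field_simps)
    then have "\<Phi> ((\<lambda>x. (1 + c * b n x) / 2) * h\<^sup>2) = 1/4 * (\<Phi> (p\<^sup>2) + (\<Phi> (h\<^sup>2) - \<Phi> (h\<^sup>2 * (b n)\<^sup>2)))"
      using p h by (simp add: P.add P.diff P.scale)
    then show ?thesis
      using P.sq[OF p] admissible_contraction[OF assms h, of n] by simp
  qed
  have "1 - u n = (\<lambda>x. (1 + (-1) * b n x) / 2)"
    by (rule ext) (simp add: fun_apply u_def field_simps)
  then have "0 \<le> \<Phi> (u n * h\<^sup>2)" "0 \<le> \<Phi> ((1 - u n) * h\<^sup>2)" if "h \<in> B" for h
    using *[OF that, of 1] *[OF that, of "-1"] by (auto simp: u_def)
  then show "admissible (\<lambda>f. \<Phi> (u n * f))" "admissible (\<lambda>f. \<Phi> ((1 - u n) * f))"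
    by (auto intro!: admissible_times assms)
qed

lemma admissible_u_power:
  assumes "admissible \<Phi>"
  shows "admissible (\<lambda>f. \<Phi> (u n ^ k * (1 - u n) ^ j * f))"
proof -
  have 1: "admissible (\<lambda>f. \<Phi> ((1 - u n) ^ j * f))" for j
  proof (induction j)
    case (Suc j)
    from admissible_u(2)[OF this, of n] show ?case by (simp add: mult_ac)
  qed (use assms in simp)
  show ?thesis
  proof (induction k)
    case (Suc k)
    from admissible_u(1)[OF this, of n] show ?case by (simp add: mult_ac)
  qed (use 1[of j] in simp)
qed

definition \<beta> :: "'x \<Rightarrow> 'n \<Rightarrow> real" where
  "\<beta> x n = u n x"

lemma polyfun_in_B: "polyfun V P \<Longrightarrow> (\<lambda>x. P (\<beta> x)) \<in> B"
proof (induction rule: polyfun.induct)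
  case (var i)
  then show ?case using u_in[of i] by (simp add: \<beta>_def)
next
  case (add P Q)
  then show ?case using add_in by (simp add: plus_fun_def)
next
  case (mult P Q)
  then show ?case using mult_in by (simp add: times_fun_def)
qed simp

text \<open>A Bernstein operator in the variable \<open>i\<close> freezes \<open>t i\<close> at the
  grid points \<open>k / n\<close>, leaving one variable fewer, and its weights are absorbed into
  the functional; hence the induction over all admissible \<open>\<Phi>\<close>.\<close>

lemma admissible_nonneg_finite:
  assumes "finite V" "admissible \<Phi>" "polyfun V P" "\<And>t. (\<forall>i. 0 \<le> t i \<and> t i \<le> 1) \<Longrightarrow> 0 \<le> P t"
  shows "0 \<le> \<Phi> (\<lambda>x. P (\<beta> x))"
  using assms
proof (induction V arbitrary: \<Phi> P rule: finite_induct)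
  case empty
  interpret P: pos_functional B \<Phi> using empty by (simp add: admissible_def)
  obtain c where c: "P = (\<lambda>_. c)" using polyfun_empty empty by blast
  have "c \<ge> 0" using empty(3)[of "\<lambda>_. 0"] by (simp add: c)
  moreover have "\<Phi> ((\<lambda>_. c) * 1) = c * \<Phi> 1" by (intro P.scale) simp
  moreover have "0 \<le> \<Phi> 1" using P.sq[of 1] by simp
  ultimately show ?case by (simp add: c)
next
  case (insert i V)
  interpret P: pos_functional B \<Phi> using insert by (simp add: admissible_def)
  define op where "op n Q = (\<Sum>k\<le>n. (\<lambda>_. real (n choose k)) * (u i ^ k * (1 - u i) ^ (n - k) *
       (\<lambda>x. Q ((\<beta> x)(i := real k / real n)))))" for n Q
  have span: "monomial_span i V P" using insert by (intro polyfun_insert)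
  have nonneg: "0 \<le> \<Phi> (op n P)" if n: "n \<ge> 1" for n
  proof -
    have poly: "polyfun V (\<lambda>t. P (t(i := real k / real n)))" for k
      using monomial_span_update[OF span] insert by blast
    have "0 \<le> \<Phi> (u i ^ k * (1 - u i) ^ (n - k) * (\<lambda>x. P ((\<beta> x)(i := real k / real n))))" if "k \<le> n" for k
      using that n
      by (intro insert.IH[OF admissible_u_power[OF insert.prems(1)] poly] insert.prems) auto
    moreover have "(\<lambda>x. P ((\<beta> x)(i := real k / real n))) \<in> B" for k
      using polyfun_in_B[OF poly] by simp
    ultimately show ?thesis
      unfolding op_def by (subst P.sum) (auto intro!: sum_nonneg simp: P.scale)
  qed
  \<comment> \<open>On a term \<open>Q t * t i ^ r\<close> the operator leaves \<open>Q\<close>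
    alone and yields powers \<open>u i ^ s\<close> with \<open>s \<le> r\<close>. A fixed finite
    combination with convergent coefficients passes through \<open>\<Phi>\<close> by linearity
    alone.\<close>
  have "(\<lambda>n. \<Phi> (op n P)) \<longlonglongrightarrow> \<Phi> (\<lambda>x. P (\<beta> x)) \<and> (\<forall>n. op n P \<in> B) \<and> (\<lambda>x. P (\<beta> x)) \<in> B"
    using span
  proof (induction rule: monomial_span.induct)
    case (base Q r)
    obtain c where c: "\<And>n x. n \<ge> 1 \<Longrightarrow> (\<Sum>k\<le>n. Bernstein n k x * (real k / real n) ^ r) = (\<Sum>s\<le>r. c n s * x ^ s)"
      and lim: "\<And>s. s \<le> r \<Longrightarrow> (\<lambda>n. c n s) \<longlonglongrightarrow> (if s = r then 1 else 0)"
      using Bernstein_monomial[of r] by blast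
    define R where "R = (\<lambda>x. Q (\<beta> x))"
    have R: "R \<in> B" unfolding R_def by (rule polyfun_in_B[OF base])
    have upd: "Q ((\<beta> x)(i := a)) = R x" for x a
      unfolding R_def using insert base by (intro polyfun_cong[OF base]) auto
    have op_B: "op n (\<lambda>t. Q t * t i ^ r) \<in> B" for n
    proof -
      have "(\<lambda>x. Q ((\<beta> x)(i := a)) * ((\<beta> x)(i := a)) i ^ r) = (\<lambda>_. a ^ r) * R" for a
        by (rule ext) (simp add: fun_apply upd)
      then show ?thesis unfolding op_def using R by (auto intro!: sum_in simp del: fun_upd_apply)
    qed
    have op_eq: "op n (\<lambda>t. Q t * t i ^ r) = (\<Sum>s\<le>r. (\<lambda>_. c n s) * (R * u i ^ s))" if n: "n \<ge> 1" for n
    proof (rule ext)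
      fix x
      have sum_app: "(\<Sum>k\<in>K. F k) x = (\<Sum>k\<in>K. F k x)" for K and F :: "nat \<Rightarrow> 'x \<Rightarrow> real"
        by (induction K rule: infinite_finite_induct) (auto simp: fun_apply)
      have "op n (\<lambda>t. Q t * t i ^ r) x = R x * (\<Sum>k\<le>n. Bernstein n k (u i x) * (real k / real n) ^ r)"
        unfolding op_def sum_app sum_distrib_left
        by (intro sum.cong) (auto simp: upd Bernstein_def fun_apply)
      also have "\<dots> = R x * (\<Sum>s\<le>r. c n s * u i x ^ s)" using c[OF n] by simp
      also have "\<dots> = (\<Sum>s\<le>r. (\<lambda>_. c n s) * (R * u i ^ s)) x"
        unfolding sum_app fun_apply sum_distrib_left by (intro sum.cong) (auto simp: fun_apply)
      finally show "op n (\<lambda>t. Q t * t i ^ r) x = (\<Sum>s\<le>r. (\<lambda>_. c n s) * (R * u i ^ s)) x" .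
    qed
    have eq: "\<Phi> (op n (\<lambda>t. Q t * t i ^ r)) = (\<Sum>s\<le>r. c n s * \<Phi> (R * u i ^ s))" if n: "n \<ge> 1" for n
      unfolding op_eq[OF n] using R by (subst P.sum) (auto simp: P.scale)
    have "(\<lambda>n. \<Sum>s\<le>r. c n s * \<Phi> (R * u i ^ s)) \<longlonglongrightarrow> (\<Sum>s\<le>r. (if s = r then 1 else 0) * \<Phi> (R * u i ^ s))"
      by (intro tendsto_sum tendsto_mult lim tendsto_const) auto
    also have "(\<Sum>s\<le>r. (if s = r then 1 else 0) * \<Phi> (R * u i ^ s)) = \<Phi> (R * u i ^ r)"
      by (simp add: if_distrib[of "\<lambda>a. a * _"] cong: if_cong)
    also have "R * u i ^ r = (\<lambda>x. Q (\<beta> x) * \<beta> x i ^ r)"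
      by (rule ext) (simp add: fun_apply R_def \<beta>_def)
    finally have "(\<lambda>n. \<Phi> (op n (\<lambda>t. Q t * t i ^ r))) \<longlonglongrightarrow> \<Phi> (\<lambda>x. Q (\<beta> x) * \<beta> x i ^ r)"
      by (rule Lim_transform_eventually) (use eq in \<open>auto intro!: eventually_sequentiallyI[of 1]\<close>)
    moreover have "(\<lambda>x. Q (\<beta> x) * \<beta> x i ^ r) = R * u i ^ r"
      by (rule ext) (simp add: fun_apply R_def \<beta>_def)
    ultimately show ?case using R op_B by auto
  next
    case (add P Q)
    have op_add: "op n (\<lambda>t. P t + Q t) = op n P + op n Q" for n
    proof -
      have "(\<lambda>x. P ((\<beta> x)(i := a)) + Q ((\<beta> x)(i := a))) = (\<lambda>x. P ((\<beta> x)(i := a))) + (\<lambda>x. Q ((\<beta> x)(i := a)))" for a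
        by (rule ext) (simp add: fun_apply)
      then show ?thesis by (simp add: op_def distrib_left sum.distrib)
    qed
    have "(\<lambda>x. P (\<beta> x) + Q (\<beta> x)) = (\<lambda>x. P (\<beta> x)) + (\<lambda>x. Q (\<beta> x))"
      by (rule ext) (simp add: fun_apply)
    then show ?case
      using add.IH tendsto_add[of "\<lambda>n. \<Phi> (op n P)" _ sequentially "\<lambda>n. \<Phi> (op n Q)"] by (simp add: op_add P.add)
  qed
  then have "(\<lambda>n. \<Phi> (op n P)) \<longlonglongrightarrow> \<Phi> (\<lambda>x. P (\<beta> x))" by blast
  then show ?case
    by (rule LIMSEQ_le_const) (use nonneg in blast)
qed

theorem admissible_nonneg:
  assumes "admissible \<Phi>" "polyfun V P" "\<And>t. (\<forall>i. 0 \<le> t i \<and> t i \<le> 1) \<Longrightarrow> 0 \<le> P t"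
  shows "0 \<le> \<Phi> (\<lambda>x. P (\<beta> x))"
proof -
  obtain W where "finite W" "polyfun W P" using polyfun_finite[OF assms(2)] by blast
  then show ?thesis by (rule admissible_nonneg_finite[OF _ assms(1) _ assms(3)])
qed

end

section \<open>The Riesz representation theorem on compact spaces\<close>

lemma space_borel_of [simp]: "space (borel_of T) = topspace T"
  unfolding borel_of_def by (rule space_measure_of_conv)

lemma sets_borel_of: "sets (borel_of T) = sigma_sets (topspace T) {U. openin T U}"
  unfolding borel_of_def by (rule sets_measure_of) (auto dest: openin_subset)

lemma openin_sets_borel_of: "openin T U \<Longrightarrow> U \<in> sets (borel_of T)"
  unfolding sets_borel_of by (rule sigma_sets.Basic) simp

lemma closedin_sets_borel_of: "closedin T U \<Longrightarrow> U \<in> sets (borel_of T)"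
proof -
  assume U: "closedin T U"
  then have "space (borel_of T) - (topspace T - U) \<in> sets (borel_of T)"
    by (intro sets.compl_sets openin_sets_borel_of) auto
  moreover have "topspace T - (topspace T - U) = U"
    using closedin_subset[OF U] by auto
  ultimately show ?thesis by simp
qed

lemma continuous_map_measurable_borel_of:
  assumes "sets M = sets (borel_of T)" "continuous_map T euclideanreal f"
  shows "f \<in> borel_measurable M"
proof (rule borel_measurableI)
  fix S :: "real set" assume "open S"
  have sp: "space M = topspace T" using sets_eq_imp_space_eq[OF assms(1)] by simp
  have "openin T {x \<in> topspace T. f x \<in> S}"
    using assms(2) \<open>open S\<close> by (intro openin_continuous_map_preimage) auto
  moreover have "f -` S \<inter> space M = {x \<in> topspace T. f x \<in> S}" using sp by auto
  ultimately show "f -` S \<inter> space M \<in> sets M" using assms(1) openin_sets_borel_of by metis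
qed

text \<open>Cuts the height \<open>y\<close> into unit layers, for the layer-cake estimate in
  \<open>I_le_integral\<close>.\<close>

lemma sum_clamp:
  fixes y :: real
  assumes "0 \<le> y"
  shows "(\<Sum>k<n. min 1 (max 0 (y - real k))) = min y (real n)"
  by (induction n) (use assms in auto)

lemma Urysohn_compact_Hausdorff:
  assumes "compact_space X" "Hausdorff_space X" "closedin X S" "closedin X T" "S \<inter> T = {}"
  obtains h where "continuous_map X euclideanreal h" "\<And>x. x \<in> topspace X \<Longrightarrow> 0 \<le> h x \<and> h x \<le> 1"
    "\<And>x. x \<in> S \<Longrightarrow> h x = 0" "\<And>x. x \<in> T \<Longrightarrow> h x = 1"
proof -
  have "normal_space X"
    using assms by (simp add: compact_Hausdorff_or_regular_imp_normal_space)
  then obtain f where f: "continuous_map X (top_of_set {0..1::real}) f" "f ` S \<subseteq> {0}" "f ` T \<subseteq> {1}"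
    using Urysohn_lemma[of X S T 0 1] assms by (auto simp: disjnt_def)
  then show ?thesis
    using that[of f] by (auto simp: continuous_map_in_subtopology image_subset_iff Pi_iff)
qed

text \<open>\<open>I\<close> is constrained on continuous functions only. As \<open>I_nonneg\<close>
  inspects values on \<open>topspace X\<close> alone, continuous functions that agree there receive
  the same value.\<close>

locale riesz =
  fixes X :: "'a topology" and I :: "('a \<Rightarrow> real) \<Rightarrow> real"
  assumes compact: "compact_space X" and Hausdorff: "Hausdorff_space X"
    and I_add: "continuous_map X euclideanreal f \<Longrightarrow> continuous_map X euclideanreal g \<Longrightarrow>
        I (\<lambda>x. f x + g x) = I f + I g"
    and I_scale: "continuous_map X euclideanreal f \<Longrightarrow> I (\<lambda>x. c * f x) = c * I f"
    and I_nonneg: "continuous_map X euclideanreal f \<Longrightarrow> (\<And>x. x \<in> topspace X \<Longrightarrow> 0 \<le> f x) \<Longrightarrow> 0 \<le> I f"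
begin

abbreviation cont :: "('a \<Rightarrow> real) \<Rightarrow> bool" where
  "cont f \<equiv> continuous_map X euclideanreal f"

lemma I_diff: "cont f \<Longrightarrow> cont g \<Longrightarrow> I (\<lambda>x. f x - g x) = I f - I g"
  using I_add[of f "\<lambda>x. -1 * g x"] I_scale[of g "-1"] by (simp add: continuous_map_minus)

lemma I_mono: "cont f \<Longrightarrow> cont g \<Longrightarrow> (\<And>x. x \<in> topspace X \<Longrightarrow> f x \<le> g x) \<Longrightarrow> I f \<le> I g"
  using I_nonneg[of "\<lambda>x. g x - f x"] I_diff[of g f] by (simp add: continuous_map_diff)

lemma I_const: "I (\<lambda>_. c) = c * I (\<lambda>_. 1)"
  using I_scale[of "\<lambda>_. 1" c] by simp

lemma I_zero: "I (\<lambda>_. 0) = 0"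
  using I_const[of 0] by simp

lemma I_one_nonneg: "0 \<le> I (\<lambda>_. 1)"
  by (rule I_nonneg) auto

lemma I_sum: "(\<And>k. k \<in> K \<Longrightarrow> cont (f k)) \<Longrightarrow> I (\<lambda>x. \<Sum>k\<in>K. f k x) = (\<Sum>k\<in>K. I (f k))"
  by (induction K rule: infinite_finite_induct) (auto simp: I_zero I_add continuous_map_sum)

lemmas Urysohn = Urysohn_compact_Hausdorff[OF compact Hausdorff]

text \<open>Asks only that \<open>f\<close> vanish off \<open>U\<close>, not that its support be a
  compact subset of \<open>U\<close>; where compactness matters, \<open>below_cutoff\<close>
  supplies it.\<close>

definition below :: "'a set \<Rightarrow> ('a \<Rightarrow> real) \<Rightarrow> bool" where
  "below U f \<longleftrightarrow> cont f \<and> (\<forall>x\<in>topspace X. 0 \<le> f x \<and> f x \<le> 1 \<and> (x \<notin> U \<longrightarrow> f x = 0))"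

definition content :: "'a set \<Rightarrow> real" where
  "content U = Sup (I ` Collect (below U))"

lemma below_le_one: "below U f \<Longrightarrow> I f \<le> I (\<lambda>_. 1)"
  by (rule I_mono) (auto simp: below_def)

lemma below_zero: "below U (\<lambda>_. 0)"
  by (simp add: below_def)

lemma content_upper: "below U f \<Longrightarrow> I f \<le> content U"
  unfolding content_def
  by (rule cSup_upper) (auto intro!: bdd_aboveI[of _ "I (\<lambda>_. 1)"] below_le_one)

lemma content_least: "(\<And>f. below U f \<Longrightarrow> I f \<le> c) \<Longrightarrow> content U \<le> c"
  unfolding content_def by (rule cSup_least) (use below_zero in auto)

lemma content_nonneg: "0 \<le> content U"
  using content_upper[OF below_zero] I_zero by simp

lemma content_le_one: "content U \<le> I (\<lambda>_. 1)"
  by (rule content_least) (rule below_le_one)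

lemma content_topspace: "content (topspace X) = I (\<lambda>_. 1)"
  by (rule antisym[OF content_le_one]) (rule content_upper, simp add: below_def)

lemma content_approx:
  assumes "\<epsilon> > 0" obtains f where "below U f" "content U < I f + \<epsilon>"
proof -
  have "\<exists>y \<in> I ` Collect (below U). content U - \<epsilon> < y"
    unfolding content_def using assms below_zero[of U] less_cSupE[of "content U - \<epsilon>" "I ` Collect (below U)"]
    by (metis (no_types, lifting) content_def diff_less_eq empty_iff imageI less_add_same_cancel1 mem_Collect_eq)
  then show ?thesis using that by (auto simp: algebra_simps)
qed

lemma content_mono: "U \<inter> topspace X \<subseteq> V \<Longrightarrow> content U \<le> content V"
  by (rule content_least, rule content_upper) (auto simp: below_def)

lemma content_empty: "content {} = 0"
proof (rule antisym[OF content_least content_nonneg])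
  fix f assume "below {} f"
  then have "I f \<le> I (\<lambda>_. 0)" by (intro I_mono) (auto simp: below_def)
  then show "I f \<le> 0" by (simp add: I_zero)
qed

text \<open>Cutting off at height \<open>\<delta>\<close> replaces the support of \<open>f\<close> by the compact set \<open>{\<delta> \<le> f}\<close>.\<close>

lemma below_cutoff:
  assumes f: "below U f" and \<delta>: "0 < \<delta>"
  shows "cont (\<lambda>x. max 0 (f x - \<delta>))" "I f \<le> I (\<lambda>x. max 0 (f x - \<delta>)) + \<delta> * I (\<lambda>_. 1)"
    "closedin X {x \<in> topspace X. \<delta> \<le> f x}" "{x \<in> topspace X. \<delta> \<le> f x} \<subseteq> U"
    "x \<in> topspace X \<Longrightarrow> 0 \<le> max 0 (f x - \<delta>) \<and> max 0 (f x - \<delta>) \<le> 1"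
proof -
  have c: "cont f" using f by (simp add: below_def)
  show c': "cont (\<lambda>x. max 0 (f x - \<delta>))" using c by (intro continuous_intros)
  have "I f \<le> I (\<lambda>x. max 0 (f x - \<delta>) + \<delta>)"
    using c c' by (intro I_mono continuous_intros) auto
  then show "I f \<le> I (\<lambda>x. max 0 (f x - \<delta>)) + \<delta> * I (\<lambda>_. 1)"
    using I_add[OF c', of "\<lambda>_. \<delta>"] I_const[of \<delta>] by simp
  have "closedin X {x \<in> topspace X. f x \<in> {\<delta>..}}"
    using c by (rule closedin_continuous_map_preimage) auto
  then show "closedin X {x \<in> topspace X. \<delta> \<le> f x}" by simp
  show "{x \<in> topspace X. \<delta> \<le> f x} \<subseteq> U" using f \<delta> by (force simp: below_def)
  show "x \<in> topspace X \<Longrightarrow> 0 \<le> max 0 (f x - \<delta>) \<and> max 0 (f x - \<delta>) \<le> 1"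
    using f \<delta> by (force simp: below_def)
qed

lemma cutoff_height:
  assumes "0 < e" obtains \<delta> where "0 < \<delta>" "\<delta> * I (\<lambda>_. 1) \<le> e"
  using that[of "e / (I (\<lambda>_. 1) + 1)"] assms I_one_nonneg by (simp add: field_simps)

lemma le_by_cutoff:
  assumes "\<And>\<delta>. 0 < \<delta> \<Longrightarrow> a \<le> c + \<delta> * I (\<lambda>_. 1)"
  shows "a \<le> c"
  by (rule field_le_epsilon, erule cutoff_height) (use assms in force)

text \<open>A two-piece partition of unity: after the cutoff, \<open>K - U\<close> and
  \<open>K - V\<close> are disjoint closed sets, and a Urysohn function \<open>h\<close> splits
  \<open>f'\<close> into \<open>f' h\<close>, which lives in \<open>U\<close>, and
  \<open>f' (1 - h)\<close>, which lives in \<open>V\<close>.\<close>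

lemma content_Un:
  assumes U: "openin X U" and V: "openin X V"
  shows "content (U \<union> V) \<le> content U + content V"
proof (rule content_least, rule le_by_cutoff)
  fix f \<delta> assume f: "below (U \<union> V) f" and \<delta>: "(0::real) < \<delta>"
  define f' where "f' x = max 0 (f x - \<delta>)" for x
  define K where "K = {x \<in> topspace X. \<delta> \<le> f x}"
  note cut = below_cutoff[OF f \<delta>, folded f'_def K_def]
  have "closedin X (K - U)" "closedin X (K - V)"
    using cut(3) U V by (auto intro: closedin_diff)
  moreover have "(K - U) \<inter> (K - V) = {}" using cut(4) by auto
  ultimately obtain h where h: "cont h" "\<And>x. x \<in> topspace X \<Longrightarrow> 0 \<le> h x \<and> h x \<le> 1"
    "\<And>x. x \<in> K - U \<Longrightarrow> h x = 0" "\<And>x. x \<in> K - V \<Longrightarrow> h x = 1"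
    using Urysohn[of "K - U" "K - V"] by blast
  have out: "f' x = 0" if "x \<in> topspace X" "x \<notin> K" for x using that by (simp add: f'_def K_def)
  have c1: "cont (\<lambda>x. f' x * h x)" and c2: "cont (\<lambda>x. f' x * (1 - h x))"
    using cut(1) h(1) by (auto intro!: continuous_intros)
  have "below U (\<lambda>x. f' x * h x)"
    unfolding below_def
  proof (intro conjI ballI impI c1)
    fix x assume x: "x \<in> topspace X"
    show "0 \<le> f' x * h x" "f' x * h x \<le> 1" using cut(5)[OF x] h(2)[OF x] by (auto intro: mult_le_one)
    show "f' x * h x = 0" if "x \<notin> U" using that out[OF x] h(3)[of x] by auto
  qed
  moreover have "below V (\<lambda>x. f' x * (1 - h x))"
    unfolding below_def
  proof (intro conjI ballI impI c2)
    fix x assume x: "x \<in> topspace X"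
    show "0 \<le> f' x * (1 - h x)" "f' x * (1 - h x) \<le> 1" using cut(5)[OF x] h(2)[OF x] by (auto intro: mult_le_one)
    show "f' x * (1 - h x) = 0" if "x \<notin> V" using that out[OF x] h(4)[of x] by auto
  qed
  moreover have "I f' = I (\<lambda>x. f' x * h x) + I (\<lambda>x. f' x * (1 - h x))"
    using I_add[OF c1 c2] by (simp add: algebra_simps)
  moreover have "I f \<le> I f' + \<delta> * I (\<lambda>_. 1)" using cut(2) by simp
  ultimately show "I f \<le> content U + content V + \<delta> * I (\<lambda>_. 1)"
    using content_upper by (smt (verit))
qed

lemma content_UN_finite:
  assumes "\<And>i::nat. openin X (U i)"
  shows "content (\<Union>i<n. U i) \<le> (\<Sum>i<n. content (U i))"
proof (induction n)
  case (Suc n)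
  have "content (\<Union>i<Suc n. U i) = content ((\<Union>i<n. U i) \<union> U n)"
    by (simp add: lessThan_Suc Un_commute)
  also have "\<dots> \<le> content (\<Union>i<n. U i) + content (U n)"
    using assms by (intro content_Un) auto
  finally show ?case using Suc by simp
qed (simp add: content_empty)

text \<open>The compact set \<open>K\<close> left by the cutoff meets only finitely many
  \<open>U i\<close> of a subcover, so finite subadditivity suffices. Half of \<open>e\<close> pays
  for the choice of \<open>f\<close>, half for the cutoff.\<close>

lemma content_UN:
  assumes "\<And>i::nat. openin X (U i)"
  shows "ennreal (content (\<Union>i. U i)) \<le> (suminf (\<lambda>i. ennreal (content (U i))))"
proof (rule ennreal_le_epsilon)
  fix e :: real assume e: "0 < e"
  obtain f where f: "below (\<Union>i. U i) f" "content (\<Union>i. U i) < I f + e/2"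
    by (rule content_approx[of "e/2"]) (use e in auto)
  obtain \<delta> where \<delta>: "\<delta> > 0" and \<delta>e: "\<delta> * I (\<lambda>_. 1) \<le> e/2"
    by (rule cutoff_height[of "e/2"]) (use e in auto)
  define f' where "f' x = max 0 (f x - \<delta>)" for x
  define K where "K = {x \<in> topspace X. \<delta> \<le> f x}"
  note cut = below_cutoff[OF f(1) \<delta>, folded f'_def K_def]
  have "compactin X K" using cut(3) compact by (rule closedin_compact_space[rotated])
  then obtain F where F: "finite F" "F \<subseteq> range U" "K \<subseteq> \<Union>F"
    using cut(4) compactinD[of X K "range U"] assms by blast
  then obtain J where J: "finite J" "F = U ` J" by (meson finite_subset_image)
  obtain n where n: "J \<subseteq> {..<n}" using finite_nat_iff_bounded[of J] J(1) by blast
  have "below (\<Union>i<n. U i) f'"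
    unfolding below_def
  proof (intro conjI ballI impI)
    fix x assume "x \<in> topspace X" "x \<notin> (\<Union>i<n. U i)"
    then have "x \<notin> K" using F J n by fastforce
    then show "f' x = 0" using \<open>x \<in> topspace X\<close> by (simp add: f'_def K_def)
  qed (use cut(1,5) in auto)
  then have "I f' \<le> (\<Sum>i<n. content (U i))"
    using content_upper content_UN_finite[of U n] assms by (smt (verit))
  then have "content (\<Union>i. U i) \<le> (\<Sum>i<n. content (U i)) + e"
    using f(2) \<delta>e cut(2) by simp
  then have "ennreal (content (\<Union>i. U i)) \<le> ennreal (\<Sum>i<n. content (U i)) + ennreal e"
    using e by (simp add: content_nonneg sum_nonneg ennreal_plus[symmetric] del: ennreal_plus)
  also have "ennreal (\<Sum>i<n. content (U i)) = (\<Sum>i<n. ennreal (content (U i)))"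
    by (simp add: content_nonneg sum_ennreal)
  also have "\<dots> \<le> (suminf (\<lambda>i. ennreal (content (U i))))"
    by (rule sum_le_suminf) auto
  finally show "ennreal (content (\<Union>i. U i)) \<le> (suminf (\<lambda>i. ennreal (content (U i)))) + ennreal e"
    by (simp add: add_right_mono)
qed

section \<open>The outer measure and the Borel measure it induces\<close>

definition outer :: "'a set \<Rightarrow> ennreal" where
  "outer E = (INF U\<in>{U. openin X U \<and> E \<subseteq> U}. ennreal (content U))"

lemma outer_upper: "openin X U \<Longrightarrow> E \<subseteq> U \<Longrightarrow> outer E \<le> ennreal (content U)"
  unfolding outer_def by (rule INF_lower) simp

lemma outer_open: "openin X U \<Longrightarrow> outer U = ennreal (content U)"
  by (rule antisym[OF outer_upper]) (auto simp: outer_def intro!: INF_greatest ennreal_leI content_mono)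

lemma outer_mono: "E \<subseteq> F \<Longrightarrow> outer E \<le> outer F"
  unfolding outer_def by (rule INF_superset_mono) auto

lemma outer_finite: "E \<subseteq> topspace X \<Longrightarrow> outer E < \<infinity>"
  using outer_upper[of "topspace X" E] by (auto simp: less_top[symmetric] top_unique)

lemma outer_approx:
  assumes "E \<subseteq> topspace X" "0 < e"
  obtains U where "openin X U" "E \<subseteq> U" "ennreal (content U) \<le> outer E + ennreal e"
proof -
  have "outer E < outer E + ennreal e"
    using outer_finite[OF assms(1)] assms(2)
    by (cases "outer E" rule: ennreal_cases) (auto simp: ennreal_less_iff simp flip: ennreal_plus)
  then obtain U where "openin X U" "E \<subseteq> U" "ennreal (content U) < outer E + ennreal e"
    unfolding outer_def[of E] by (subst (asm) INF_less_iff) auto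
  then show ?thesis using that less_imp_le by blast
qed

lemma outer_measure_space_outer: "outer_measure_space (Pow (topspace X)) outer"
  unfolding outer_measure_space_def
proof (intro conjI)
  show "positive (Pow (topspace X)) outer"
    using outer_open[of "{}"] by (simp add: positive_def content_empty)
  show "increasing (Pow (topspace X)) outer"
    by (auto simp: increasing_def intro: outer_mono)
  show "countably_subadditive (Pow (topspace X)) outer"
    unfolding countably_subadditive_def
  proof (intro allI impI)
    fix A :: "nat \<Rightarrow> 'a set" assume A: "range A \<subseteq> Pow (topspace X)"
    show "outer (\<Union>i. A i) \<le> (suminf (\<lambda>i. outer (A i)))"
    proof (rule ennreal_le_epsilon)
      fix e :: real assume e: "0 < e"
      have "\<exists>U. openin X U \<and> A i \<subseteq> U \<and> ennreal (content U) \<le> outer (A i) + ennreal (e * (1/2) ^ Suc i)" for i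
        by (rule outer_approx[of "A i" "e * (1/2) ^ Suc i"]) (use A e in auto)
      then obtain U where U: "\<And>i. openin X (U i)" "\<And>i. A i \<subseteq> U i"
        "\<And>i. ennreal (content (U i)) \<le> outer (A i) + ennreal (e * (1/2) ^ Suc i)" by metis
      have "outer (\<Union>i. A i) \<le> ennreal (content (\<Union>i. U i))"
        using U by (intro outer_upper) auto
      also have "\<dots> \<le> (suminf (\<lambda>i. ennreal (content (U i))))"
        by (rule content_UN[OF U(1)])
      also have "\<dots> \<le> (suminf (\<lambda>i. outer (A i) + ennreal (e * (1/2) ^ Suc i)))"
        by (intro suminf_le U(3)) auto
      also have "\<dots> = (suminf (\<lambda>i. outer (A i))) + (suminf (\<lambda>i. ennreal e * ennreal ((1/2) ^ Suc i)))"
        using e by (subst suminf_add[symmetric])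
          (auto simp del: ennreal_suminf_cmult simp add: ennreal_mult[symmetric])
      also have "\<dots> = (suminf (\<lambda>i. outer (A i))) + e"
        unfolding ennreal_suminf_cmult
        by (subst suminf_ennreal_eq[OF zero_le_power power_half_series]) auto
      finally show "outer (\<Union>i. A i) \<le> (suminf (\<lambda>i. outer (A i))) + ennreal e" .
    qed
  qed
qed

lemma outer_splits_open:
  assumes U: "openin X U" and E: "E \<subseteq> topspace X"
  shows "outer (U \<inter> E) + outer ((topspace X - U) \<inter> E) \<le> outer E"
proof (rule ennreal_le_epsilon)
  fix e :: real assume e: "0 < e"
  obtain V where V: "openin X V" "E \<subseteq> V" "ennreal (content V) \<le> outer E + ennreal (e/4)"
    by (rule outer_approx[OF E, of "e/4"]) (use e in auto)
  obtain f where f: "below (V \<inter> U) f" "content (V \<inter> U) < I f + e/4"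
    by (rule content_approx[of "e/4"]) (use e in auto)
  obtain \<delta> where \<delta>: "\<delta> > 0" and \<delta>e: "\<delta> * I (\<lambda>_. 1) \<le> e/4"
    by (rule cutoff_height[of "e/4"]) (use e in auto)
  define f' where "f' x = max 0 (f x - \<delta>)" for x
  define K where "K = {x \<in> topspace X. \<delta> \<le> f x}"
  note cut = below_cutoff[OF f(1) \<delta>, folded f'_def K_def]
  obtain g where g: "below (V - K) g" "content (V - K) < I g + e/4"
    by (rule content_approx[of "e/4"]) (use e in auto)
  have cg: "cont g" using g by (simp add: below_def)
  have "below V (\<lambda>x. f' x + g x)"
    unfolding below_def
  proof (intro conjI ballI impI)
    show "cont (\<lambda>x. f' x + g x)" using cut(1) cg by (simp add: continuous_map_add)
    fix x assume x: "x \<in> topspace X"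
    show "0 \<le> f' x + g x" "f' x + g x \<le> 1"
      using x cut(5)[OF x] g(1) by (cases "x \<in> K"; force simp: below_def f'_def K_def)+
    show "f' x + g x = 0" if "x \<notin> V"
      using that x cut(4) g(1) by (cases "x \<in> K"; force simp: below_def f'_def K_def)
  qed
  then have "I f' + I g \<le> content V"
    using content_upper I_add[OF cut(1) cg] by metis
  then have le: "content (V \<inter> U) + content (V - K) \<le> content V + 3 * (e/4)"
    using f(2) g(2) \<delta>e cut(2) by simp
  have "outer (U \<inter> E) \<le> ennreal (content (V \<inter> U))"
    using V U by (intro outer_upper) auto
  moreover have "outer ((topspace X - U) \<inter> E) \<le> ennreal (content (V - K))"
    using V cut(3,4) by (intro outer_upper openin_diff) auto
  ultimately have "outer (U \<inter> E) + outer ((topspace X - U) \<inter> E) \<le> ennreal (content (V \<inter> U)) + ennreal (content (V - K))"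
    by (rule add_mono)
  also have "\<dots> \<le> ennreal (content V) + ennreal (3 * (e/4))"
    using le e by (simp add: content_nonneg ennreal_plus[symmetric] del: ennreal_plus)
  also have "\<dots> \<le> outer E + ennreal (e/4) + ennreal (3 * (e/4))"
    using V(3) by (rule add_right_mono)
  also have "\<dots> = outer E + ennreal e"
    using e by (simp add: add.assoc ennreal_plus[symmetric] del: ennreal_plus)
  finally show "outer (U \<inter> E) + outer ((topspace X - U) \<inter> E) \<le> outer E + ennreal e" .
qed

definition riesz_measure :: "'a measure" where
  "riesz_measure = measure_of (topspace X) {U. openin X U} outer"

lemma sets_riesz_measure: "sets riesz_measure = sets (borel_of X)"
  unfolding riesz_measure_def sets_borel_of by (rule sets_measure_of) (auto dest: openin_subset)

lemma space_riesz_measure: "space riesz_measure = topspace X"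
  using sets_eq_imp_space_eq[OF sets_riesz_measure] by simp

text \<open>\<open>measure_of\<close> returns \<open>outer\<close> only once \<open>outer\<close> is
  a measure on the Borel sets. Open sets satisfy the Caratheodory condition by
  \<open>outer_splits_open\<close>, and the sets that satisfy it form a sigma-algebra.\<close>

lemma emeasure_riesz_measure:
  assumes "A \<in> sets riesz_measure"
  shows "emeasure riesz_measure A = outer A"
proof -
  interpret P: sigma_algebra "topspace X" "Pow (topspace X)" by (rule sigma_algebra_Pow)
  have pos: "positive (Pow (topspace X)) outer" and csa: "countably_subadditive (Pow (topspace X)) outer"
    using outer_measure_space_outer by (auto simp: outer_measure_space_def)
  have sub: "subadditive (Pow (topspace X)) outer"
    by (rule P.countably_subadditive_subadditive[OF pos csa])
  define La where "La = lambda_system (topspace X) (Pow (topspace X)) outer"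
  have ms: "measure_space (topspace X) La outer"
    unfolding La_def by (rule P.caratheodory_lemma[OF outer_measure_space_outer])
  have op: "{U. openin X U} \<subseteq> La"
  proof
    fix U assume "U \<in> {U. openin X U}"
    then have U: "openin X U" by simp
    show "U \<in> La"
      unfolding La_def lambda_system_def
    proof (intro CollectI conjI ballI)
      show "U \<in> Pow (topspace X)" using openin_subset[OF U] by simp
      fix E assume E: "E \<in> Pow (topspace X)"
      have "outer ((U \<inter> E) \<union> ((topspace X - U) \<inter> E)) \<le> outer (U \<inter> E) + outer ((topspace X - U) \<inter> E)"
        using E by (intro subadditiveD[OF sub]) auto
      moreover have "(U \<inter> E) \<union> ((topspace X - U) \<inter> E) = E" using E by auto
      ultimately show "outer (U \<inter> E) + outer ((topspace X - U) \<inter> E) = outer E"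
        using outer_splits_open[OF U, of E] E by auto
    qed
  qed
  interpret La: sigma_algebra "topspace X" La using ms by (simp add: measure_space_def)
  have "measure_space (topspace X) (sigma_sets (topspace X) {U. openin X U}) outer"
    by (rule measure_down[OF ms]) (auto intro!: sigma_algebra_sigma_sets La.sigma_sets_subset op dest: openin_subset)
  then show ?thesis
    using assms unfolding riesz_measure_def
    by (intro emeasure_measure_of[where \<mu> = outer and A = "{U. openin X U}" and \<Omega> = "topspace X"])
       (auto simp: measure_space_def sets_measure_of_conv riesz_measure_def dest: openin_subset)
qed

lemma finite_measure_riesz: "finite_measure riesz_measure"
  by (rule finite_measureI)
    (use emeasure_riesz_measure[OF sets.top] outer_finite[of "topspace X"] in \<open>auto simp: space_riesz_measure\<close>)

text \<open>Outer regularity is built into \<open>outer\<close>. Applied to the complement of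
  \<open>B\<close> it becomes inner regularity of \<open>B\<close>, since closed subsets of a
  compact space are compact.\<close>

lemma radon_riesz_measure: "radon_measure X riesz_measure"
  unfolding radon_measure_def
proof (intro conjI ballI)
  interpret finite_measure riesz_measure by (rule finite_measure_riesz)
  show "sets riesz_measure = sets (borel_of X)" by (rule sets_riesz_measure)
  show "\<exists>U. openin X U \<and> x \<in> U \<and> emeasure riesz_measure U < \<infinity>" if "x \<in> topspace X" for x
    using that by (intro exI[of _ "topspace X"]) (simp add: less_top[symmetric])
  fix B assume B: "B \<in> sets riesz_measure"
  let ?S = "SUP K\<in>{K. compactin X K \<and> K \<subseteq> B}. emeasure riesz_measure K"
  have Bs: "B \<subseteq> topspace X" using sets.sets_into_space[OF B] space_riesz_measure by simp
  show "emeasure riesz_measure B = ?S"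
  proof (rule antisym)
    show "?S \<le> emeasure riesz_measure B" using B by (intro SUP_least emeasure_mono) auto
    show "emeasure riesz_measure B \<le> ?S"
    proof (rule ennreal_le_epsilon)
      fix e :: real assume e: "0 < e"
      let ?C = "topspace X - B"
      have C: "?C \<in> sets riesz_measure" using sets.compl_sets[OF B] by (simp add: space_riesz_measure)
      obtain U where U: "openin X U" "?C \<subseteq> U" "ennreal (content U) \<le> outer ?C + ennreal e"
        by (rule outer_approx[of ?C e]) (use e in auto)
      have Us: "U \<in> sets riesz_measure" using U openin_sets_borel_of sets_riesz_measure by metis
      define K where "K = topspace X - U"
      have K: "compactin X K" unfolding K_def
        using U compact by (intro closedin_compact_space) auto
      have Ks: "K \<in> sets riesz_measure" using sets.compl_sets[OF Us] by (simp add: space_riesz_measure K_def)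
      have "emeasure riesz_measure U = emeasure riesz_measure ?C + emeasure riesz_measure (U - ?C)"
        using U C Us by (subst plus_emeasure) (auto intro!: arg_cong[of _ _ "emeasure riesz_measure"])
      then have "emeasure riesz_measure ?C + emeasure riesz_measure (U - ?C) \<le> emeasure riesz_measure ?C + ennreal e"
        using U emeasure_riesz_measure[OF Us] emeasure_riesz_measure[OF C] outer_open[OF U(1)] by simp
      then have small: "emeasure riesz_measure (U - ?C) \<le> ennreal e"
        by (simp add: ennreal_add_left_cancel_le)
      have "emeasure riesz_measure B \<le> emeasure riesz_measure (K \<union> (U - ?C))"
        using B C Us Ks Bs by (intro emeasure_mono) (auto simp: K_def)
      also have "\<dots> \<le> emeasure riesz_measure K + emeasure riesz_measure (U - ?C)"
        using C Us Ks by (intro emeasure_subadditive) auto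
      also have "\<dots> \<le> ?S + ennreal e"
        using K U by (intro add_mono small SUP_upper) (auto simp: K_def)
      finally show "emeasure riesz_measure B \<le> ?S + ennreal e" .
    qed
  qed
qed

lemma integrable_riesz:
  assumes "cont f" shows "integrable riesz_measure f"
proof -
  interpret finite_measure riesz_measure by (rule finite_measure_riesz)
  have "compactin euclideanreal (f ` topspace X)"
    using compact assms unfolding compact_space_def by (rule image_compactin)
  then have "bounded (f ` topspace X)" by (simp add: compact_imp_bounded)
  then obtain c where "\<forall>x\<in>topspace X. \<bar>f x\<bar> \<le> c"
    by (auto simp: bounded_iff)
  then show ?thesis
    using continuous_map_measurable_borel_of[OF sets_riesz_measure assms]
    by (intro integrable_const_bound[where B = c]) (auto simp: space_riesz_measure intro!: AE_I2)
qed

text \<open>Cut \<open>n f\<close> into \<open>n\<close> layers of height 1. Layer \<open>k\<close>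
  lives in the open set \<open>U k\<close>, so \<open>I (\<phi> k)\<close> is at most its measure,
  while at each point at most \<open>n f + 1\<close> of the \<open>U k\<close> occur. Division by
  \<open>n\<close> removes the extra total mass in the limit.\<close>

lemma I_le_integral:
  assumes f: "cont f" and b: "\<And>x. x \<in> topspace X \<Longrightarrow> 0 \<le> f x \<and> f x \<le> 1"
  shows "I f \<le> (\<integral>x. f x \<partial>riesz_measure)"
proof -
  interpret finite_measure riesz_measure by (rule finite_measure_riesz)
  let ?\<nu> = riesz_measure
  have le: "real n * I f \<le> real n * (\<integral>x. f x \<partial>?\<nu>) + measure ?\<nu> (space ?\<nu>)" for n
  proof -
    define \<phi> where "\<phi> k x = min 1 (max 0 (real n * f x - real k))" for k :: nat and x
    define U where "U k = {x \<in> topspace X. real k < real n * f x}" for k :: nat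
    have c\<phi>: "cont (\<phi> k)" for k unfolding \<phi>_def using f by (intro continuous_intros)
    have U: "openin X (U k)" for k
    proof -
      have "openin X {x \<in> topspace X. real n * f x \<in> {real k<..}}"
        using f by (intro openin_continuous_map_preimage[where Y = euclideanreal] continuous_intros) auto
      then show ?thesis by (simp add: U_def)
    qed
    have Us: "U k \<in> sets ?\<nu>" for k using U openin_sets_borel_of sets_riesz_measure by metis
    have "real n * I f = I (\<lambda>x. real n * f x)" using I_scale[OF f] by simp
    also have "\<dots> = I (\<lambda>x. \<Sum>k<n. \<phi> k x)"
    proof (rule antisym; rule I_mono)
      show "real n * f x \<le> (\<Sum>k<n. \<phi> k x)" "(\<Sum>k<n. \<phi> k x) \<le> real n * f x" if "x \<in> topspace X" for x
        unfolding \<phi>_def using b[OF that] by (auto simp: sum_clamp mult_left_le)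
    qed (use f c\<phi> in \<open>auto intro!: continuous_intros continuous_map_sum\<close>)
    also have "\<dots> = (\<Sum>k<n. I (\<phi> k))" by (rule I_sum[OF c\<phi>])
    also have "\<dots> \<le> (\<Sum>k<n. measure ?\<nu> (U k))"
    proof (rule sum_mono)
      fix k
      have "below (U k) (\<phi> k)" using c\<phi> by (auto simp: below_def \<phi>_def U_def)
      then have "I (\<phi> k) \<le> content (U k)" by (rule content_upper)
      also have "content (U k) = measure ?\<nu> (U k)"
        using emeasure_riesz_measure[OF Us] outer_open[OF U]
        by (simp add: measure_def content_nonneg)
      finally show "I (\<phi> k) \<le> measure ?\<nu> (U k)" .
    qed
    also have "\<dots> = (\<integral>x. (\<Sum>k<n. indicator (U k) x) \<partial>?\<nu>)"
      using Us by (subst Bochner_Integration.integral_sum)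
        (auto simp: integral_indicator less_top[symmetric] intro!: sum.cong arg_cong[of _ _ "measure ?\<nu>"] dest: sets.sets_into_space)
    also have "\<dots> \<le> (\<integral>x. real n * f x + 1 \<partial>?\<nu>)"
    proof (rule integral_mono)
      show "integrable ?\<nu> (\<lambda>x. \<Sum>k<n. indicator (U k) x :: real)"
        using Us by (intro Bochner_Integration.integrable_sum integrable_real_indicator) (auto simp: less_top[symmetric])
      show "integrable ?\<nu> (\<lambda>x. real n * f x + 1)" using integrable_riesz[OF f] by auto
      fix x assume "x \<in> space ?\<nu>"
      then have x: "x \<in> topspace X" by (simp add: space_riesz_measure)
      have "(\<Sum>k<n. indicator (U k) x :: real) \<le> (\<Sum>k<n. min 1 (max 0 (real n * f x + 1 - real k)))"
        by (rule sum_mono) (auto simp: indicator_def U_def)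
      also have "\<dots> \<le> real n * f x + 1"
        using b[OF x] by (subst sum_clamp) auto
      finally show "(\<Sum>k<n. indicator (U k) x) \<le> real n * f x + 1" .
    qed
    also have "\<dots> = real n * (\<integral>x. f x \<partial>?\<nu>) + measure ?\<nu> (space ?\<nu>)"
      using integrable_riesz[OF f] by simp
    finally show ?thesis .
  qed
  show ?thesis
  proof (rule ccontr)
    assume "\<not> ?thesis"
    then have "0 < I f - (\<integral>x. f x \<partial>?\<nu>)" by simp
    then obtain n where "measure ?\<nu> (space ?\<nu>) < real n * (I f - (\<integral>x. f x \<partial>?\<nu>))"
      by (metis reals_Archimedean3)
    then show False using le[of n] by (simp add: algebra_simps)
  qed
qed

text \<open>The inequality for both \<open>g\<close> and \<open>1 - g\<close>, together with equal
  total mass, gives equality when \<open>0 \<le> g \<le> 1\<close>. A bounded \<open>f\<close> is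
  reduced to such a \<open>g\<close> by an affine change.\<close>

lemma integral_riesz:
  assumes f: "cont f"
  shows "(\<integral>x. f x \<partial>riesz_measure) = I f"
proof -
  interpret finite_measure riesz_measure by (rule finite_measure_riesz)
  have "measure riesz_measure (topspace X) = I (\<lambda>_. 1)"
    using emeasure_riesz_measure[of "topspace X"] outer_open[of "topspace X"] sets.top[of riesz_measure]
    by (simp add: measure_def content_topspace I_one_nonneg space_riesz_measure)
  then have one: "(\<integral>x. 1 \<partial>riesz_measure) = I (\<lambda>_. 1)" by (simp add: space_riesz_measure)
  have unit: "(\<integral>x. g x \<partial>riesz_measure) = I g"
    if g: "cont g" and b: "\<And>x. x \<in> topspace X \<Longrightarrow> 0 \<le> g x \<and> g x \<le> 1" for g
  proof (rule antisym)
    show "I g \<le> (\<integral>x. g x \<partial>riesz_measure)" by (rule I_le_integral[OF g b])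
    have "I (\<lambda>x. 1 - g x) \<le> (\<integral>x. 1 - g x \<partial>riesz_measure)"
      using b g by (intro I_le_integral) (auto intro!: continuous_intros)
    also have "\<dots> = I (\<lambda>_. 1) - (\<integral>x. g x \<partial>riesz_measure)"
      using one integrable_riesz[OF g] by simp
    finally show "(\<integral>x. g x \<partial>riesz_measure) \<le> I g"
      using I_diff[of "\<lambda>_. 1" g] g by simp
  qed
  have "compactin euclideanreal (f ` topspace X)"
    using compact f unfolding compact_space_def by (rule image_compactin)
  then have "bounded (f ` topspace X)" by (simp add: compact_imp_bounded)
  then obtain c where c: "\<forall>x\<in>topspace X. \<bar>f x\<bar> \<le> c" "c > 0"
    by (auto simp: bounded_pos)
  define g where "g x = (1 / (2 * c)) * (f x + c)" for x
  have g: "cont g" unfolding g_def using f by (intro continuous_intros) auto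
  have eq: "f x = 2 * c * g x - c" for x using c(2) by (simp add: g_def)
  have "(\<integral>x. g x \<partial>riesz_measure) = I g"
    using c by (intro unit[OF g]) (force simp: g_def field_simps abs_le_iff)
  then have "(\<integral>x. 2 * c * g x - c \<partial>riesz_measure) = 2 * c * I g - c * I (\<lambda>_. 1)"
    using integrable_riesz[OF g] one by simp
  also have "\<dots> = I (\<lambda>x. 2 * c * g x - c)"
    using I_diff[of "\<lambda>x. 2 * c * g x" "\<lambda>_. c"] g I_const[of c] I_scale[OF g, of "2 * c"]
    by (simp add: continuous_intros)
  finally show ?thesis by (simp add: eq[symmetric])
qed

end

section \<open>Representing measures on the cube\<close>

lemma open_coordinate_vimage: "open W \<Longrightarrow> open ((\<lambda>h. h i) -` W)"
  for W :: "'b::topological_space set"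
  by (rule open_vimage[OF _ continuous_on_product_coordinates])

text \<open>The class \<open>t2_space\<close> sits above \<open>t0_space\<close> and
  \<open>t1_space\<close>. It is the sort required of the points in the Stone-Weierstrass locale and
  in \<open>Hausdorff_space_euclidean\<close>.\<close>

instance "fun" :: (type, t0_space) t0_space
proof
  fix f g :: "'a \<Rightarrow> 'b" assume "f \<noteq> g"
  then obtain i where i: "f i \<noteq> g i" by auto
  obtain U where "open U" "\<not> (f i \<in> U \<longleftrightarrow> g i \<in> U)"
    using t0_space_class.t0_space[OF i] by blast
  then show "\<exists>U. open U \<and> \<not> (f \<in> U \<longleftrightarrow> g \<in> U)"
    by (intro exI[of _ "(\<lambda>h. h i) -` U"]) (auto intro: open_coordinate_vimage)
qed

instance "fun" :: (type, t1_space) t1_space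
proof
  fix f g :: "'a \<Rightarrow> 'b" assume "f \<noteq> g"
  then obtain i where i: "f i \<noteq> g i" by auto
  obtain U where "open U" "f i \<in> U" "g i \<notin> U"
    using t1_space_class.t1_space[OF i] by blast
  then show "\<exists>U. open U \<and> f \<in> U \<and> g \<notin> U"
    by (intro exI[of _ "(\<lambda>h. h i) -` U"]) (auto intro: open_coordinate_vimage)
qed

instance "fun" :: (type, t2_space) t2_space
proof
  fix f g :: "'a \<Rightarrow> 'b" assume "f \<noteq> g"
  then obtain i where "f i \<noteq> g i" by auto
  then obtain U V where "open U" "open V" "f i \<in> U" "g i \<in> V" "U \<inter> V = {}"
    using hausdorff[of "f i" "g i"] by blast
  then show "\<exists>U V. open U \<and> open V \<and> f \<in> U \<and> g \<in> V \<and> U \<inter> V = {}"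
    by (intro exI[of _ "(\<lambda>h. h i) -` U"] exI[of _ "(\<lambda>h. h i) -` V"])
       (auto intro: open_coordinate_vimage)
qed

definition cube :: "('n \<Rightarrow> real) set" where
  "cube = {t. \<forall>i. 0 \<le> t i \<and> t i \<le> 1}"

lemma compact_cube: "compact (cube :: ('n \<Rightarrow> real) set)"
proof -
  have "compactin (product_topology (\<lambda>i::'n. euclideanreal) UNIV) (PiE UNIV (\<lambda>_. {0..1}))"
    unfolding compactin_PiE by auto
  moreover have "PiE UNIV (\<lambda>_. {0..1}) = (cube :: ('n \<Rightarrow> real) set)"
    by (auto simp: cube_def PiE_def extensional_def Pi_iff)
  ultimately show ?thesis by (simp add: euclidean_product_topology)
qed

lemma compact_space_cube: "compact_space (top_of_set cube)"
  using compact_cube compact_space_subtopology[of euclidean cube] by simp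

lemma Hausdorff_space_euclidean: "Hausdorff_space (euclidean :: 'a::t2_space topology)"
  unfolding Hausdorff_space_def disjnt_def open_openin[symmetric] using hausdorff by metis

lemma Hausdorff_space_cube: "Hausdorff_space (top_of_set (cube :: ('n \<Rightarrow> real) set))"
  by (rule Hausdorff_space_subtopology[OF Hausdorff_space_euclidean])

lemma continuous_on_polyfun: "polyfun V P \<Longrightarrow> continuous_on S P"
  by (induction rule: polyfun.induct)
     (auto intro!: continuous_intros intro: continuous_on_subset[OF continuous_on_product_coordinates])

lemma polyfun_approx:
  fixes f :: "('n \<Rightarrow> real) \<Rightarrow> real"
  assumes f: "continuous_on cube f" and e: "e > 0"
  obtains P where "polyfun UNIV P" "\<And>t. t \<in> cube \<Longrightarrow> \<bar>f t - P t\<bar> \<le> e"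
proof -
  interpret function_ring_on "Collect (polyfun UNIV)" "cube :: ('n \<Rightarrow> real) set"
  proof
    fix s t :: "'n \<Rightarrow> real" assume "s \<noteq> t"
    then obtain i where "s i \<noteq> t i" by auto
    then show "\<exists>f\<in>Collect (polyfun UNIV). f s \<noteq> f t"
      by (intro bexI[of _ "\<lambda>t. t i"]) (auto intro: polyfun.var)
  qed (auto intro: polyfun.intros compact_cube continuous_on_polyfun)
  show ?thesis
    using Stone_Weierstrass_basic[OF f e] that less_imp_le by blast
qed

locale cube_functional =
  fixes \<phi> :: "(('n \<Rightarrow> real) \<Rightarrow> real) \<Rightarrow> real"
  assumes \<phi>_add: "polyfun UNIV P \<Longrightarrow> polyfun UNIV Q \<Longrightarrow> \<phi> (\<lambda>t. P t + Q t) = \<phi> P + \<phi> Q"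
    and \<phi>_scale: "polyfun UNIV P \<Longrightarrow> \<phi> (\<lambda>t. c * P t) = c * \<phi> P"
    and \<phi>_nonneg: "polyfun UNIV P \<Longrightarrow> (\<And>t. t \<in> cube \<Longrightarrow> 0 \<le> P t) \<Longrightarrow> 0 \<le> \<phi> P"
begin

abbreviation mass :: real where "mass \<equiv> \<phi> (\<lambda>_. 1)"

definition approximates :: "(('n \<Rightarrow> real) \<Rightarrow> real) \<Rightarrow> real \<Rightarrow> (('n \<Rightarrow> real) \<Rightarrow> real) \<Rightarrow> bool" where
  "approximates f e P \<longleftrightarrow> polyfun UNIV P \<and> (\<forall>t\<in>cube. \<bar>f t - P t\<bar> \<le> e)"

text \<open>Extension by uniform density without choosing sequences. Each approximation confines the
  value to an interval of radius \<open>e * mass\<close> around \<open>\<phi> P\<close>; these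
  intervals meet pairwise, and the supremum of their left ends lies in all of them.\<close>

definition ext :: "(('n \<Rightarrow> real) \<Rightarrow> real) \<Rightarrow> real" where
  "ext f = Sup {\<phi> P - e * mass | P e. approximates f e P}"

lemma \<phi>_le:
  assumes P: "polyfun UNIV P" and Q: "polyfun UNIV Q" and le: "\<And>t. t \<in> cube \<Longrightarrow> P t \<le> Q t + c"
  shows "\<phi> P \<le> \<phi> Q + c * mass"
proof -
  have 1: "polyfun UNIV (\<lambda>t. Q t + c * 1)" by (intro polyfun.intros Q)
  have 2: "polyfun UNIV (\<lambda>t. - 1 * P t)" by (intro polyfun.intros P)
  have "0 \<le> \<phi> (\<lambda>t. (Q t + c * 1) + - 1 * P t)"
    by (rule \<phi>_nonneg[OF polyfun.add[OF 1 2]]) (use le in force)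
  also have "\<dots> = \<phi> Q + c * mass - \<phi> P"
    using \<phi>_add[OF 1 2] \<phi>_add[OF Q polyfun_cmult[OF polyfun.const], of c 1] \<phi>_scale[OF P, of "-1"]
      \<phi>_scale[OF polyfun.const, of c 1] by simp
  finally show ?thesis by simp
qed

lemma mass_nonneg: "0 \<le> mass"
  by (rule \<phi>_nonneg) (auto intro: polyfun.const)

lemma ext_approx:
  assumes "approximates f e P"
  shows "\<bar>ext f - \<phi> P\<bar> \<le> e * mass"
proof -
  have le: "\<phi> Q - d * mass \<le> \<phi> P + e * mass" if "approximates f d Q" for Q d
  proof -
    have "Q t \<le> P t + (d + e)" if "t \<in> cube" for t
    proof -
      have "\<bar>f t - Q t\<bar> \<le> d" "\<bar>f t - P t\<bar> \<le> e"
        using that \<open>approximates f d Q\<close> assms by (auto simp: approximates_def)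
      then show ?thesis by linarith
    qed
    then have "\<phi> Q \<le> \<phi> P + (d + e) * mass"
      using that assms by (intro \<phi>_le) (auto simp: approximates_def)
    then show ?thesis by (simp add: algebra_simps)
  qed
  have "ext f \<le> \<phi> P + e * mass"
    unfolding ext_def by (rule cSup_least) (use le assms in auto)
  moreover have "\<phi> P - e * mass \<le> ext f"
    unfolding ext_def
    by (rule cSup_upper) (use le assms in \<open>auto intro!: bdd_aboveI[of _ "\<phi> P + e * mass"]\<close>)
  ultimately show ?thesis by linarith
qed

lemma ext_polyfun: "polyfun UNIV P \<Longrightarrow> ext P = \<phi> P"
  using ext_approx[of P 0 P] by (simp add: approximates_def)

lemma approximates_exists:
  assumes "continuous_on cube f" "e > 0"
  obtains P where "approximates f e P"
  by (rule polyfun_approx[OF assms]) (use that in \<open>auto simp: approximates_def\<close>)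

lemma eq_by_approx:
  assumes "\<And>e. e > 0 \<Longrightarrow> \<bar>a - b\<bar> \<le> e * c * mass"
  shows "a = (b::real)"
proof -
  have "\<bar>a - b\<bar> \<le> 0"
  proof (rule field_le_epsilon)
    fix d :: real assume d: "0 < d"
    define e where "e = d / (\<bar>c\<bar> * mass + 1)"
    have p: "\<bar>c\<bar> * mass + 1 > 0" using mass_nonneg by (smt (verit) mult_nonneg_nonneg abs_ge_zero)
    then have e: "e > 0" using d by (simp add: e_def)
    have "e * c * mass \<le> e * (\<bar>c\<bar> * mass)"
      using e mass_nonneg by (simp add: mult.assoc mult_left_mono mult_right_mono)
    also have "\<dots> \<le> d" using p d mass_nonneg by (simp add: e_def field_simps)
    finally show "\<bar>a - b\<bar> \<le> 0 + d" using assms[OF e] by linarith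
  qed
  then show ?thesis by simp
qed

lemma riesz_ext: "riesz (top_of_set cube) ext"
proof
  show "compact_space (top_of_set (cube :: ('n \<Rightarrow> real) set))" by (rule compact_space_cube)
  show "Hausdorff_space (top_of_set (cube :: ('n \<Rightarrow> real) set))" by (rule Hausdorff_space_cube)
next
  fix f g :: "('n \<Rightarrow> real) \<Rightarrow> real"
  assume "continuous_map (top_of_set cube) euclideanreal f" "continuous_map (top_of_set cube) euclideanreal g"
  then have fg: "continuous_on cube f" "continuous_on cube g" by auto
  show "ext (\<lambda>x. f x + g x) = ext f + ext g"
  \<comment> \<open>Errors: \<open>e\<close> for \<open>f\<close>, \<open>e\<close> for
    \<open>g\<close> and \<open>2 e\<close> for the sum.\<close>
  proof (rule eq_by_approx[where c = 4])
    fix e :: real assume e: "e > 0"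
    obtain P where P: "approximates f e P" by (rule approximates_exists[OF fg(1) e])
    obtain Q where Q: "approximates g e Q" by (rule approximates_exists[OF fg(2) e])
    have PQ: "approximates (\<lambda>x. f x + g x) (2 * e) (\<lambda>x. P x + Q x)"
      unfolding approximates_def
    proof (intro conjI ballI)
      show "polyfun UNIV (\<lambda>x. P x + Q x)" using P Q by (auto simp: approximates_def intro: polyfun.intros)
      fix t :: "'n \<Rightarrow> real" assume "t \<in> cube"
      then have "\<bar>f t - P t\<bar> \<le> e" "\<bar>g t - Q t\<bar> \<le> e" using P Q by (auto simp: approximates_def)
      then show "\<bar>f t + g t - (P t + Q t)\<bar> \<le> 2 * e" by linarith
    qed
    have "\<phi> (\<lambda>x. P x + Q x) = \<phi> P + \<phi> Q"
      using P Q by (intro \<phi>_add) (auto simp: approximates_def)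
    moreover have "\<bar>ext f - \<phi> P\<bar> \<le> e * mass" "\<bar>ext g - \<phi> Q\<bar> \<le> e * mass"
      "\<bar>ext (\<lambda>x. f x + g x) - \<phi> (\<lambda>x. P x + Q x)\<bar> \<le> 2 * e * mass"
      using P Q PQ by (auto intro!: ext_approx)
    moreover have "2 * e * mass = e * mass + e * mass" "e * 4 * mass = 4 * (e * mass)" by auto
    ultimately show "\<bar>ext (\<lambda>x. f x + g x) - (ext f + ext g)\<bar> \<le> e * 4 * mass"
      by linarith
  qed
next
  fix f :: "('n \<Rightarrow> real) \<Rightarrow> real" and c :: real
  assume "continuous_map (top_of_set cube) euclideanreal f"
  then have f: "continuous_on cube f" by auto
  show "ext (\<lambda>x. c * f x) = c * ext f"
  proof (rule eq_by_approx[where c = "2 * \<bar>c\<bar>"])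
    fix e :: real assume e: "e > 0"
    obtain P where P: "approximates f e P" by (rule approximates_exists[OF f e])
    have cP: "approximates (\<lambda>x. c * f x) (\<bar>c\<bar> * e) (\<lambda>x. c * P x)"
      using P by (auto simp: approximates_def abs_mult right_diff_distrib[symmetric] intro: polyfun_cmult mult_left_mono)
    have "\<phi> (\<lambda>x. c * P x) = c * \<phi> P"
      using P by (intro \<phi>_scale) (auto simp: approximates_def)
    moreover have "\<bar>c\<bar> * \<bar>ext f - \<phi> P\<bar> \<le> \<bar>c\<bar> * (e * mass)"
      using ext_approx[OF P] by (intro mult_left_mono) auto
    then have "\<bar>c * ext f - c * \<phi> P\<bar> \<le> \<bar>c\<bar> * e * mass"
      by (simp add: abs_mult[symmetric] right_diff_distrib mult.assoc)
    moreover have "\<bar>ext (\<lambda>x. c * f x) - \<phi> (\<lambda>x. c * P x)\<bar> \<le> \<bar>c\<bar> * e * mass"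
      by (rule ext_approx[OF cP])
    moreover have "e * (2 * \<bar>c\<bar>) * mass = \<bar>c\<bar> * e * mass + \<bar>c\<bar> * e * mass" by simp
    ultimately show "\<bar>ext (\<lambda>x. c * f x) - c * ext f\<bar> \<le> e * (2 * \<bar>c\<bar>) * mass"
      by linarith
  qed
next
  fix f :: "('n \<Rightarrow> real) \<Rightarrow> real"
  assume "continuous_map (top_of_set cube) euclideanreal f" and pos: "\<And>x. x \<in> topspace (top_of_set cube) \<Longrightarrow> 0 \<le> f x"
  then have f: "continuous_on cube f" by auto
  show "0 \<le> ext f"
  proof (rule ccontr)
    assume "\<not> 0 \<le> ext f"
    then have neg: "ext f < 0" by simp
    \<comment> \<open>Small enough for \<open>2 e mass < - ext f\<close>; the added 1 covers the
      case of zero mass.\<close>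
    define e where "e = - ext f / (2 * (mass + 1))"
    have e: "e > 0" using neg mass_nonneg unfolding e_def by (intro divide_pos_pos) auto
    have em: "2 * (e * mass) < - ext f" using neg mass_nonneg by (simp add: e_def field_simps)
    obtain P where P: "approximates f e P" by (rule approximates_exists[OF f e])
    have "0 \<le> P t + e" if "t \<in> cube" for t
    proof -
      have "\<bar>f t - P t\<bar> \<le> e" using P that by (auto simp: approximates_def)
      then show ?thesis using pos[of t] that by auto
    qed
    then have "\<phi> (\<lambda>_. 0) \<le> \<phi> P + e * mass"
      using P by (intro \<phi>_le polyfun.const) (auto simp: approximates_def)
    moreover have "\<phi> (\<lambda>_. 0) = 0" using \<phi>_scale[OF polyfun.const, of 0 0] by simp
    ultimately show False using ext_approx[OF P] em by linarith
  qed
qed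

theorem representing_measure:
  "\<exists>\<nu>. radon_measure (top_of_set cube) \<nu> \<and> finite_measure \<nu> \<and>
      (\<forall>P. polyfun UNIV P \<longrightarrow> integrable \<nu> P \<and> (\<integral>t. P t \<partial>\<nu>) = \<phi> P)"
proof -
  interpret riesz "top_of_set cube" ext by (rule riesz_ext)
  have "continuous_map (top_of_set cube) euclideanreal P" if "polyfun UNIV P" for P :: "('n \<Rightarrow> real) \<Rightarrow> real"
    using continuous_on_polyfun[OF that] by simp
  then show ?thesis
    using radon_riesz_measure finite_measure_riesz integrable_riesz integral_riesz ext_polyfun
    by (intro exI[of _ riesz_measure]) simp
qed

end

section \<open>Polynomials as functions\<close>

definition monomial_at :: "('i \<Rightarrow>\<^sub>0 nat) \<Rightarrow> ('i \<Rightarrow> 'a::comm_ring_1) \<Rightarrow> 'a" where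
  "monomial_at m \<alpha> = (\<Prod>i\<in>Poly_Mapping.keys m. \<alpha> i ^ Poly_Mapping.lookup m i)"

text \<open>Over any commutative ring, because the complex polynomials \<open>q k\<close> of the
  hypothesis are evaluated too, at real points.\<close>

definition eval_at :: "('i, 'a::comm_ring_1) mpoly \<Rightarrow> ('i \<Rightarrow> 'a) \<Rightarrow> 'a" where
  "eval_at p \<alpha> = (\<Sum>m\<in>Poly_Mapping.keys p. Poly_Mapping.lookup p m * monomial_at m \<alpha>)"

lemma poly_eval_eq: "poly_eval f = eval_at f"
  by (rule ext) (simp add: poly_eval_def eval_at_def monomial_at_def)

lemma monomial_at_superset:
  assumes "finite F" "Poly_Mapping.keys m \<subseteq> F"
  shows "monomial_at m \<alpha> = (\<Prod>i\<in>F. \<alpha> i ^ Poly_Mapping.lookup m i)"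
  unfolding monomial_at_def using assms
  by (intro prod.mono_neutral_left) (auto simp: in_keys_iff)

lemma monomial_at_add: "monomial_at (m + n) \<alpha> = monomial_at m \<alpha> * monomial_at n \<alpha>"
proof -
  let ?F = "Poly_Mapping.keys m \<union> Poly_Mapping.keys n"
  have "monomial_at (m + n) \<alpha> = (\<Prod>i\<in>?F. \<alpha> i ^ Poly_Mapping.lookup (m + n) i)"
    by (rule monomial_at_superset) (auto dest: subsetD[OF Poly_Mapping.keys_add])
  also have "\<dots> = monomial_at m \<alpha> * monomial_at n \<alpha>"
    by (subst (1 2) monomial_at_superset[of ?F])
       (auto simp: lookup_add power_add prod.distrib)
  finally show ?thesis .
qed

lemma eval_at_superset:
  assumes "finite F" "Poly_Mapping.keys p \<subseteq> F"
  shows "eval_at p \<alpha> = (\<Sum>m\<in>F. Poly_Mapping.lookup p m * monomial_at m \<alpha>)"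
  unfolding eval_at_def using assms
  by (intro sum.mono_neutral_left) (auto simp: in_keys_iff)

lemma eval_at_add: "eval_at (p + q) \<alpha> = eval_at p \<alpha> + eval_at q \<alpha>"
proof -
  let ?F = "Poly_Mapping.keys p \<union> Poly_Mapping.keys q"
  have "eval_at (p + q) \<alpha> = (\<Sum>m\<in>?F. Poly_Mapping.lookup (p + q) m * monomial_at m \<alpha>)"
    by (rule eval_at_superset) (auto dest: subsetD[OF Poly_Mapping.keys_add])
  also have "\<dots> = eval_at p \<alpha> + eval_at q \<alpha>"
    by (subst (1 2) eval_at_superset[of ?F])
       (auto simp: lookup_add distrib_right sum.distrib)
  finally show ?thesis .
qed

lemma eval_at_zero [simp]: "eval_at 0 \<alpha> = 0"
  by (simp add: eval_at_def)

lemma eval_at_single: "eval_at (Poly_Mapping.single m c) \<alpha> = c * monomial_at m \<alpha>"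
  by (cases "c = 0") (auto simp: eval_at_def)

lemma eval_at_uminus: "eval_at (- p) \<alpha> = - eval_at p \<alpha>"
  using eval_at_add[of p "- p" \<alpha>] by (simp add: eq_neg_iff_add_eq_0 add.commute)

lemma eval_at_diff: "eval_at (p - q) \<alpha> = eval_at p \<alpha> - eval_at q \<alpha>"
  using eval_at_add[of p "- q" \<alpha>] by (simp add: eval_at_uminus)

lemma update_eq_add_single:
  "k \<notin> Poly_Mapping.keys f \<Longrightarrow> Poly_Mapping.update k v f = f + Poly_Mapping.single k v"
  by (rule poly_mapping_eqI) (auto simp: lookup_update lookup_add lookup_single in_keys_iff when_def)

lemma mpoly_induct [case_names zero add]:
  fixes p :: "('i, 'a::comm_ring_1) mpoly"
  assumes "P 0" "\<And>p m c. P p \<Longrightarrow> P (p + Poly_Mapping.single m c)"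
  shows "P p"
  by (induction p rule: update_induct) (auto simp: update_eq_add_single assms)

lemma eval_at_mult: "eval_at (p * q) \<alpha> = eval_at p \<alpha> * eval_at q \<alpha>"
proof (induction p rule: mpoly_induct)
  case (add p m c)
  have "eval_at (Poly_Mapping.single m c * q) \<alpha> = c * monomial_at m \<alpha> * eval_at q \<alpha>"
    by (induction q rule: mpoly_induct)
       (auto simp: distrib_left eval_at_add mult_single eval_at_single monomial_at_add algebra_simps)
  then show ?case using add by (simp add: distrib_right eval_at_add eval_at_single)
qed simp

lemma eval_at_Const [simp]: "eval_at (Const c) \<alpha> = c"
  by (simp add: Const_def eval_at_single monomial_at_def)

lemma eval_at_one [simp]: "eval_at 1 \<alpha> = 1"
  using eval_at_Const[of 1] by (simp add: Const_def)

lemma eval_at_Var [simp]: "eval_at (Var i) \<alpha> = \<alpha> i"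
  by (simp add: Var_def eval_at_single monomial_at_def)

lemma eval_at_power: "eval_at (p ^ n) \<alpha> = eval_at p \<alpha> ^ n"
  by (induction n) (auto simp: eval_at_mult)

section \<open>Kronecker substitution: a real polynomial is determined by its values\<close>

lemma base_representation_unique:
  fixes a b :: "nat \<Rightarrow> nat"
  assumes "\<And>k. k < n \<Longrightarrow> a k < N" "\<And>k. k < n \<Longrightarrow> b k < N"
    and "(\<Sum>k<n. a k * N ^ k) = (\<Sum>k<n. b k * N ^ k)" and "k < n"
  shows "a k = b k"
  using assms
proof (induction n arbitrary: a b k)
  case (Suc n)
  have split: "(\<Sum>k<Suc n. c k * N ^ k) = c 0 + N * (\<Sum>k<n. c (Suc k) * N ^ k)" for c :: "nat \<Rightarrow> nat"
    by (simp add: sum.lessThan_Suc_shift sum_distrib_left mult_ac del: sum.lessThan_Suc)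
  have N: "a 0 < N" "b 0 < N" using Suc.prems by auto
  have eq: "a 0 + N * (\<Sum>k<n. a (Suc k) * N ^ k) = b 0 + N * (\<Sum>k<n. b (Suc k) * N ^ k)"
    using Suc.prems(3) by (simp only: split)
  have "(a 0 + N * (\<Sum>k<n. a (Suc k) * N ^ k)) mod N = (b 0 + N * (\<Sum>k<n. b (Suc k) * N ^ k)) mod N"
    using eq by simp
  then have 0: "a 0 = b 0" using N by simp
  then have eq': "(\<Sum>k<n. a (Suc k) * N ^ k) = (\<Sum>k<n. b (Suc k) * N ^ k)"
    using eq N by simp
  show ?case
  proof (cases k)
    case (Suc j)
    then show ?thesis
      using Suc.IH[of "\<lambda>k. a (Suc k)" "\<lambda>k. b (Suc k)" j] Suc.prems eq' by auto
  qed (use 0 in simp)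
qed simp

text \<open>With \<open>N\<close> larger than every exponent in \<open>S\<close> and powers of
  \<open>N\<close> as weights, the exponents of a monomial are the base-\<open>N\<close> digits of
  its weighted degree.\<close>

lemma Kronecker_weights:
  fixes S :: "('i \<Rightarrow>\<^sub>0 nat) set"
  assumes "finite S"
  obtains e :: "'i \<Rightarrow> nat" where "inj_on (\<lambda>m. \<Sum>i\<in>Poly_Mapping.keys m. Poly_Mapping.lookup m i * e i) S"
proof -
  define V where "V = (\<Union>m\<in>S. Poly_Mapping.keys m)"
  have V: "finite V" using assms by (simp add: V_def)
  obtain h where h: "bij_betw h {0..<card V} V" using ex_bij_betw_nat_finite[OF V] by blast
  define N where "N = Suc (\<Sum>m\<in>S. \<Sum>i\<in>V. Poly_Mapping.lookup m i)"
  have N: "Poly_Mapping.lookup m i < N" if "m \<in> S" "i \<in> V" for m i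
  proof -
    have "Poly_Mapping.lookup m i \<le> (\<Sum>i\<in>V. Poly_Mapping.lookup m i)"
      using that V by (intro member_le_sum) auto
    also have "\<dots> \<le> (\<Sum>m\<in>S. \<Sum>i\<in>V. Poly_Mapping.lookup m i)"
      using that assms by (intro member_le_sum[where f = "\<lambda>m. \<Sum>i\<in>V. Poly_Mapping.lookup m i"]) auto
    finally show ?thesis by (simp add: N_def)
  qed
  define e where "e i = N ^ the_inv_into {0..<card V} h i" for i
  have w: "(\<Sum>i\<in>Poly_Mapping.keys m. Poly_Mapping.lookup m i * e i) = (\<Sum>k<card V. Poly_Mapping.lookup m (h k) * N ^ k)"
    if "m \<in> S" for m
  proof -
    have "(\<Sum>i\<in>Poly_Mapping.keys m. Poly_Mapping.lookup m i * e i) = (\<Sum>i\<in>V. Poly_Mapping.lookup m i * e i)"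
      using that V by (intro sum.mono_neutral_left) (auto simp: V_def in_keys_iff)
    also have "\<dots> = (\<Sum>k\<in>{0..<card V}. Poly_Mapping.lookup m (h k) * e (h k))"
      by (rule sum.reindex_bij_betw[OF h, symmetric])
    also have "\<dots> = (\<Sum>k\<in>{0..<card V}. Poly_Mapping.lookup m (h k) * N ^ k)"
      using h by (intro sum.cong) (auto simp: e_def the_inv_into_f_f bij_betw_def)
    finally show ?thesis by (simp add: atLeast0LessThan)
  qed
  have "inj_on (\<lambda>m. \<Sum>i\<in>Poly_Mapping.keys m. Poly_Mapping.lookup m i * e i) S"
  proof (rule inj_onI)
    fix m n assume mn: "m \<in> S" "n \<in> S"
      and eq: "(\<Sum>i\<in>Poly_Mapping.keys m. Poly_Mapping.lookup m i * e i) = (\<Sum>i\<in>Poly_Mapping.keys n. Poly_Mapping.lookup n i * e i)"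
    have hV: "h k \<in> V" if "k < card V" for k using h that by (auto simp: bij_betw_def)
    have same: "Poly_Mapping.lookup m (h k) = Poly_Mapping.lookup n (h k)" if "k < card V" for k
      using eq mn that hV N unfolding w[OF mn(1)] w[OF mn(2)]
      by (intro base_representation_unique[of "card V" "\<lambda>k. Poly_Mapping.lookup m (h k)" N]) auto
    show "m = n"
    proof (rule poly_mapping_eqI)
      fix i
      show "Poly_Mapping.lookup m i = Poly_Mapping.lookup n i"
      proof (cases "i \<in> V")
        case True
        then obtain k where "k < card V" "i = h k"
          using h unfolding bij_betw_def by (metis atLeastLessThan_iff imageE)
        then show ?thesis using same by simp
      next
        case False
        then show ?thesis using mn by (auto simp: V_def in_keys_iff)
      qed
    qed
  qed
  then show ?thesis by (rule that)
qed

text \<open>Substituting \<open>t ^ e i\<close> for the variable \<open>i\<close> gives a univariate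
  polynomial with the same coefficients, placed at distinct degrees; it vanishes identically, so it
  is 0.\<close>

lemma eval_at_eq_zero:
  fixes p :: "('i, real) mpoly"
  assumes "\<And>\<alpha>. eval_at p \<alpha> = 0"
  shows "p = 0"
proof (rule ccontr)
  assume "p \<noteq> 0"
  then obtain m0 where m0: "m0 \<in> Poly_Mapping.keys p"
    by (metis all_not_in_conv keys_eq_empty)
  define w where "w e m = (\<Sum>i\<in>Poly_Mapping.keys m. Poly_Mapping.lookup m i * e i)" for e :: "'i \<Rightarrow> nat" and m
  obtain e where "inj_on (\<lambda>m. \<Sum>i\<in>Poly_Mapping.keys m. Poly_Mapping.lookup m i * e i) (Poly_Mapping.keys p)"
    by (rule Kronecker_weights[OF finite_keys])
  then have inj: "inj_on (w e) (Poly_Mapping.keys p)" by (simp add: w_def[abs_def])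
  define P where "P = (\<Sum>m\<in>Poly_Mapping.keys p. monom (Poly_Mapping.lookup p m) (w e m))"
  have "poly P t = 0" for t
  proof -
    have "monomial_at m (\<lambda>i. t ^ e i) = t ^ w e m" for m
      by (simp add: monomial_at_def w_def power_sum power_mult[symmetric] mult.commute)
    then have "poly P t = eval_at p (\<lambda>i. t ^ e i)"
      by (simp add: P_def poly_sum poly_monom eval_at_def)
    then show ?thesis using assms by simp
  qed
  then have "P = 0" by (simp add: poly_all_0_iff_0[symmetric])
  moreover have "coeff P (w e m0) = Poly_Mapping.lookup p m0"
  proof -
    have "coeff P (w e m0) = (\<Sum>m\<in>Poly_Mapping.keys p. if m = m0 then Poly_Mapping.lookup p m else 0)"
      unfolding P_def coeff_sum using inj m0 by (intro sum.cong) (auto simp: inj_on_def)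
    then show ?thesis using m0 by simp
  qed
  ultimately show False using m0 by (simp add: in_keys_iff)
qed

text \<open>Allows \<open>L\<close>, given on formal polynomials, to be read as a functional on
  polynomial functions via \<open>inv poly_eval\<close>.\<close>

lemma inj_poly_eval: "inj poly_eval"
proof (rule injI)
  fix f g :: "('i, real) mpoly" assume "poly_eval f = poly_eval g"
  then have "eval_at (f - g) \<alpha> = 0" for \<alpha>
    by (simp add: poly_eval_eq eval_at_diff)
  then show "f = g" using eval_at_eq_zero[of "f - g"] by simp
qed

lemma poly_ring_iff: "p \<in> poly_ring J \<longleftrightarrow> (\<forall>m\<in>Poly_Mapping.keys p. Poly_Mapping.keys m \<subseteq> J)"
  by (auto simp: poly_ring_def vars_def)

lemma poly_ring_add: "p \<in> poly_ring J \<Longrightarrow> q \<in> poly_ring J \<Longrightarrow> p + q \<in> poly_ring J"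
  using Poly_Mapping.keys_add[of p q] unfolding poly_ring_iff by blast

lemma poly_ring_mult:
  assumes "p \<in> poly_ring J" "q \<in> poly_ring J"
  shows "p * q \<in> poly_ring J"
proof -
  have "Poly_Mapping.keys m \<subseteq> J" if m: "m \<in> Poly_Mapping.keys (p * q)" for m
  proof -
    obtain a b where ab: "m = a + b" "a \<in> Poly_Mapping.keys p" "b \<in> Poly_Mapping.keys q"
      using subsetD[OF keys_mult m] by auto
    then have "Poly_Mapping.keys m \<subseteq> Poly_Mapping.keys a \<union> Poly_Mapping.keys b"
      using Poly_Mapping.keys_add[of a b] by simp
    then show ?thesis using assms ab unfolding poly_ring_iff by blast
  qed
  then show ?thesis by (auto simp: poly_ring_def vars_def)
qed

lemma poly_ring_Const: "Const c \<in> poly_ring J"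
  by (cases "c = 0") (auto simp: poly_ring_def vars_def Const_def)

lemma poly_ring_Var: "i \<in> J \<Longrightarrow> Var i \<in> poly_ring J"
  by (simp add: poly_ring_def vars_def Var_def)

lemma keys_map_subset: "Poly_Mapping.keys (Poly_Mapping.map f p) \<subseteq> Poly_Mapping.keys p"
  by (auto simp: in_keys_iff Poly_Mapping.map.rep_eq when_def)

lemma poly_ring_map: "p \<in> poly_ring J \<Longrightarrow> Poly_Mapping.map f p \<in> poly_ring J"
  using keys_map_subset[of f p] unfolding poly_ring_iff by blast

lemma eval_at_map:
  assumes "f 0 = 0"
  shows "eval_at (Poly_Mapping.map f p) \<alpha> = (\<Sum>m\<in>Poly_Mapping.keys p. f (Poly_Mapping.lookup p m) * monomial_at m \<alpha>)"
  by (subst eval_at_superset[OF _ keys_map_subset])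
     (auto simp: Poly_Mapping.map.rep_eq when_def assms intro!: sum.cong)

lemma monomial_at_of_real: "monomial_at m (\<lambda>i. complex_of_real (\<alpha> i)) = complex_of_real (monomial_at m \<alpha>)"
  by (simp add: monomial_at_def)

lemma eval_at_Re: "eval_at (Poly_Mapping.map Re p) \<alpha> = Re (eval_at p (\<lambda>i. complex_of_real (\<alpha> i)))"
  by (subst eval_at_map) (auto simp: eval_at_def monomial_at_of_real)

lemma eval_at_Im: "eval_at (Poly_Mapping.map Im p) \<alpha> = Im (eval_at p (\<lambda>i. complex_of_real (\<alpha> i)))"
  by (subst eval_at_map) (auto simp: eval_at_def monomial_at_of_real)

lemma eval_at_cnj_poly:
  "eval_at (cnj_poly p) (\<lambda>i. complex_of_real (\<alpha> i)) = cnj (eval_at p (\<lambda>i. complex_of_real (\<alpha> i)))"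
  unfolding cnj_poly_def by (subst eval_at_map) (auto simp: eval_at_def monomial_at_of_real)

lemma poly_eval_norm_sq: "poly_eval (norm_sq p) \<alpha> = (cmod (eval_at p (\<lambda>i. complex_of_real (\<alpha> i))))\<^sup>2"
  by (simp add: poly_eval_eq norm_sq_def eval_at_Re eval_at_mult eval_at_cnj_poly
    cmod_power2 complex_mult_cnj)

text \<open>At a real point \<open>q * cnj_poly q\<close> is the sum of the squares of the real and
  imaginary parts of \<open>q\<close>, so the defect is real and the hypothesis takes the form that
  \<open>extension\<close> expects.\<close>

lemma poly_eval_defect:
  fixes q :: "('i, complex) mpoly"
  shows "poly_eval (norm_sq (1 - (1 + (Var j)\<^sup>2) * q * cnj_poly q))
    = (1 - (1 + (\<lambda>\<alpha>. \<alpha> j)\<^sup>2) * ((poly_eval (Poly_Mapping.map Re q))\<^sup>2 + (poly_eval (Poly_Mapping.map Im q))\<^sup>2))\<^sup>2"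
proof (rule ext)
  fix \<alpha> :: "'i \<Rightarrow> real"
  let ?z = "eval_at q (\<lambda>i. complex_of_real (\<alpha> i))"
  have "eval_at (1 - (1 + (Var j)\<^sup>2) * q * cnj_poly q) (\<lambda>i. complex_of_real (\<alpha> i))
      = 1 - (1 + (complex_of_real (\<alpha> j))\<^sup>2) * (?z * cnj ?z)"
    by (simp add: eval_at_diff eval_at_add eval_at_mult eval_at_power eval_at_cnj_poly mult.assoc)
  also have "\<dots> = complex_of_real (1 - (1 + (\<alpha> j)\<^sup>2) * ((Re ?z)\<^sup>2 + (Im ?z)\<^sup>2))"
    by (simp add: complex_mult_cnj)
  finally show "poly_eval (norm_sq (1 - (1 + (Var j)\<^sup>2) * q * cnj_poly q)) \<alpha>
    = ((1 - (1 + (\<lambda>\<alpha>. \<alpha> j)\<^sup>2) * ((poly_eval (Poly_Mapping.map Re q))\<^sup>2 + (poly_eval (Poly_Mapping.map Im q))\<^sup>2))\<^sup>2) \<alpha>"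
    unfolding poly_eval_norm_sq by (simp only: norm_of_real) (simp add: fun_apply poly_eval_eq eval_at_Re eval_at_Im)
qed

lemma polyfun_poly_eval: "f \<in> poly_ring J \<Longrightarrow> polyfun J (poly_eval f)"
proof -
  assume f: "f \<in> poly_ring J"
  have "polyfun J (\<lambda>\<alpha>. \<Sum>m\<in>Poly_Mapping.keys f. Poly_Mapping.lookup f m *
     (\<Prod>i\<in>Poly_Mapping.keys m. \<alpha> i ^ Poly_Mapping.lookup m i))"
    using f by (intro polyfun_sum polyfun_cmult polyfun_prod polyfun_power polyfun.var)
      (auto simp: poly_ring_def vars_def)
  then show ?thesis by (simp add: poly_eval_def[abs_def])
qed

lemma polyfun_imp_poly_eval: "polyfun J P \<Longrightarrow> \<exists>f\<in>poly_ring J. poly_eval f = P"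
proof (induction rule: polyfun.induct)
  case (const c)
  show ?case by (rule bexI[of _ "Const c"]) (auto simp: poly_eval_eq poly_ring_Const)
next
  case (var i)
  then show ?case by (intro bexI[of _ "Var i"]) (auto simp: poly_eval_eq poly_ring_Var)
next
  case (add P Q)
  then obtain f g where "f \<in> poly_ring J" "poly_eval f = P" "g \<in> poly_ring J" "poly_eval g = Q" by blast
  then show ?case by (intro bexI[of _ "f + g"]) (auto simp: poly_eval_eq eval_at_add poly_ring_add)
next
  case (mult P Q)
  then obtain f g where "f \<in> poly_ring J" "poly_eval f = P" "g \<in> poly_ring J" "poly_eval g = Q" by blast
  then show ?case by (intro bexI[of _ "f * g"]) (auto simp: poly_eval_eq eval_at_mult poly_ring_mult)
qed

lemma poly_eval_image: "poly_eval ` poly_ring J = Collect (polyfun J)"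
  using polyfun_poly_eval polyfun_imp_poly_eval by blast

section \<open>The moment functional\<close>

lemma inv_poly_eval [simp]: "inv poly_eval (poly_eval p) = p"
  by (simp add: inv_f_f inj_poly_eval)

lemma fun_algebra_polyfun: "fun_algebra (Collect (polyfun V))"
  by (auto simp: fun_algebra_def plus_fun_def times_fun_def intro: polyfun.intros)

text \<open>Bernoulli gives \<open>n p \<le> (1 + p) ^ n\<close>, and
  \<open>(1 + p) (1 - p) \<le> 1\<close>.\<close>

lemma power_decay:
  fixes p :: real
  assumes "0 \<le> p" "p \<le> 1"
  shows "real n * (p * (1 - p) ^ n) \<le> 1"
proof -
  have "real n * p \<le> (1 + p) ^ n"
    using Bernoulli_inequality[of p n] assms by simp
  then have "real n * p * (1 - p) ^ n \<le> (1 + p) ^ n * (1 - p) ^ n"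
    using assms by (intro mult_right_mono) auto
  also have "\<dots> = (1 - p\<^sup>2) ^ n"
    by (simp add: power_mult_distrib[symmetric] power2_eq_square algebra_simps)
  also have "\<dots> \<le> 1"
    using assms by (intro power_le_one) (auto simp: power_le_one)
  finally show ?thesis by (simp add: mult.assoc)
qed

locale moment =
  fixes \<Omega> I :: "'i set" and M :: "('i, real) mpoly set" and L :: "('i, real) mpoly \<Rightarrow> real"
  assumes M: "quadratic_module (poly_ring \<Omega>) M"
    and I_sub: "I \<subseteq> \<Omega>" and countable_I: "countable I"
    and archimedean: "archimedean_module (poly_ring (\<Omega> - I)) (M \<inter> poly_ring (\<Omega> - I))"
    and linear_L: "linear_functional_on (poly_ring \<Omega>) L"
    and L_nonneg: "\<forall>f\<in>M. 0 \<le> L f"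
    and approx_L: "\<forall>j\<in>I. \<exists>q :: nat \<Rightarrow> ('i, complex) mpoly. (\<forall>k. q k \<in> poly_ring \<Omega>) \<and>
           (\<lambda>k. L (norm_sq (1 - (1 + (Var j)\<^sup>2) * q k * cnj_poly (q k)))) \<longlonglongrightarrow> 0"
begin

abbreviation (input) x :: "'i \<Rightarrow> ('i \<Rightarrow> real) \<Rightarrow> real" where
  "x i \<equiv> (\<lambda>\<alpha>. \<alpha> i)"

lemma extension: "extension (Collect (polyfun \<Omega>)) (poly_eval ` M) (\<lambda>\<phi>. L (inv poly_eval \<phi>)) (x ` I)"
proof
  show "fun_algebra (Collect (polyfun \<Omega>))" by (rule fun_algebra_polyfun)
next
  fix f g assume "f \<in> Collect (polyfun \<Omega>)" "g \<in> Collect (polyfun \<Omega>)"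
  then obtain p q where pq: "p \<in> poly_ring \<Omega>" "f = poly_eval p" "q \<in> poly_ring \<Omega>" "g = poly_eval q"
    unfolding poly_eval_image[symmetric] by blast
  have eq: "f + g = poly_eval (p + q)"
    by (rule ext) (simp add: pq poly_eval_eq eval_at_add fun_apply)
  show "L (inv poly_eval (f + g)) = L (inv poly_eval f) + L (inv poly_eval g)"
    unfolding eq unfolding pq inv_poly_eval using linear_L pq by (simp add: linear_functional_on_def)
next
  fix f c assume "f \<in> Collect (polyfun \<Omega>)"
  then obtain p where p: "p \<in> poly_ring \<Omega>" "f = poly_eval p"
    unfolding poly_eval_image[symmetric] by blast
  have eq: "(\<lambda>_. c) * f = poly_eval (Const c * p)"
    by (rule ext) (simp add: p poly_eval_eq eval_at_mult fun_apply)
  show "L (inv poly_eval ((\<lambda>_. c) * f)) = c * L (inv poly_eval f)"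
    unfolding eq unfolding p inv_poly_eval using linear_L p by (simp add: linear_functional_on_def)
next
  show "poly_eval ` M \<subseteq> Collect (polyfun \<Omega>)"
    unfolding poly_eval_image[symmetric] using M by (auto simp: quadratic_module_def)
  have "poly_eval 1 = 1"
    by (rule ext) (simp add: poly_eval_eq fun_apply)
  then show "1 \<in> poly_eval ` M"
    using M by (metis imageI quadratic_module_def)
next
  fix f g assume "f \<in> poly_eval ` M" "g \<in> poly_eval ` M"
  then obtain p q where pq: "p \<in> M" "f = poly_eval p" "q \<in> M" "g = poly_eval q" by blast
  have "f + g = poly_eval (p + q)"
    by (rule ext) (simp add: pq poly_eval_eq eval_at_add fun_apply)
  then show "f + g \<in> poly_eval ` M" using M pq by (auto simp: quadratic_module_def)
next
  fix a f assume "a \<in> Collect (polyfun \<Omega>)" "f \<in> poly_eval ` M"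
  then obtain p q where pq: "p \<in> poly_ring \<Omega>" "a = poly_eval p" "q \<in> M" "f = poly_eval q"
    unfolding poly_eval_image[symmetric] by blast
  have "a\<^sup>2 * f = poly_eval (p\<^sup>2 * q)"
    by (rule ext) (simp add: pq poly_eval_eq eval_at_mult eval_at_power fun_apply)
  then show "a\<^sup>2 * f \<in> poly_eval ` M" using M pq by (auto simp: quadratic_module_def)
next
  fix f assume "f \<in> poly_eval ` M"
  then show "0 \<le> L (inv poly_eval f)" using L_nonneg by auto
next
  show "x ` I \<subseteq> Collect (polyfun \<Omega>)" using I_sub by (auto intro: polyfun.var)
next
  fix s assume "s \<in> x ` I"
  then obtain j where j: "j \<in> I" "s = x j" by blast
  obtain q :: "nat \<Rightarrow> ('i, complex) mpoly" where q: "\<And>k. q k \<in> poly_ring \<Omega>"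
    and lim: "(\<lambda>k. L (norm_sq (1 - (1 + (Var j)\<^sup>2) * q k * cnj_poly (q k)))) \<longlonglongrightarrow> 0"
    using approx_L j by blast
  define a where "a k = poly_eval (Poly_Mapping.map Re (q k))" for k
  define b where "b k = poly_eval (Poly_Mapping.map Im (q k))" for k
  have "(1 - (1 + s\<^sup>2) * ((a k)\<^sup>2 + (b k)\<^sup>2))\<^sup>2 = poly_eval (norm_sq (1 - (1 + (Var j)\<^sup>2) * q k * cnj_poly (q k)))" for k
    unfolding poly_eval_defect a_def b_def j ..
  then have "(\<lambda>k. L (inv poly_eval ((1 - (1 + s\<^sup>2) * ((a k)\<^sup>2 + (b k)\<^sup>2))\<^sup>2))) \<longlonglongrightarrow> 0"
    using lim by simp
  moreover have "a k \<in> Collect (polyfun \<Omega>)" "b k \<in> Collect (polyfun \<Omega>)" for k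
    unfolding a_def b_def using q by (auto intro!: polyfun_poly_eval poly_ring_map)
  ultimately show "\<exists>a b. (\<forall>k::nat. a k \<in> Collect (polyfun \<Omega>) \<and> b k \<in> Collect (polyfun \<Omega>)) \<and>
     (\<lambda>k. L (inv poly_eval ((1 - (1 + s\<^sup>2) * ((a k)\<^sup>2 + (b k)\<^sup>2))\<^sup>2))) \<longlonglongrightarrow> 0"
    by blast
qed

sublocale ext: extension "Collect (polyfun \<Omega>)" "poly_eval ` M" "\<lambda>\<phi>. L (inv poly_eval \<phi>)" "x ` I"
  by (rule extension)

sublocale Lam: functional ext.B ext.Lam
  by (rule ext.functional_Lam)

lemma Lam_poly_eval: "f \<in> poly_ring \<Omega> \<Longrightarrow> ext.Lam (poly_eval f) = L f"
  by (subst ext.Lam_A) (auto intro: polyfun_poly_eval)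

lemma const_M: "0 \<le> c \<Longrightarrow> (\<lambda>_. c) \<in> poly_eval ` M"
proof -
  assume "0 \<le> c"
  then have "(\<lambda>_. c) = (\<lambda>_. sqrt c)\<^sup>2" by (intro ext) (simp add: fun_apply)
  moreover have "(\<lambda>_. sqrt c)\<^sup>2 \<in> poly_eval ` M"
    by (rule ext.sq_in_M) (simp add: polyfun.const)
  ultimately show ?thesis by metis
qed

text \<open>The archimedean property is applied to the square of the variable, which puts
  \<open>k - x_i^2\<close> into \<open>M\<close>. Raising \<open>k\<close> to at least 1 adds a
  nonnegative constant, that is a square, and makes the bound positive.\<close>

lemma archimedean_bound:
  assumes i: "i \<in> \<Omega> - I"
  shows "\<exists>k>0. (\<lambda>_. k\<^sup>2) - (x i)\<^sup>2 \<in> poly_eval ` M"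
proof -
  have "(Var i)\<^sup>2 \<in> (poly_ring (\<Omega> - I) :: ('i, real) mpoly set)"
    unfolding power2_eq_square using i by (intro poly_ring_mult poly_ring_Var)
  then obtain k :: int where k: "of_int k - (Var i)\<^sup>2 \<in> M"
    using archimedean unfolding archimedean_module_def by blast
  define c where "c = max 1 (real_of_int k)"
  have "of_int k = (Const (of_int k) :: ('i, real) mpoly)"
    by (simp add: Const_def)
  then have "poly_eval (of_int k - (Var i)\<^sup>2) = (\<lambda>_. of_int k) - (x i)\<^sup>2"
    by (intro ext) (simp add: poly_eval_eq eval_at_diff eval_at_power fun_apply)
  then have "(\<lambda>_. of_int k) - (x i)\<^sup>2 \<in> poly_eval ` M" using k by (metis imageI)
  moreover have "(\<lambda>_. c - of_int k) \<in> poly_eval ` M" by (rule const_M) (simp add: c_def)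
  ultimately have "((\<lambda>_. of_int k) - (x i)\<^sup>2) + (\<lambda>_. c - of_int k) \<in> poly_eval ` M"
    by (rule ext.add_M)
  moreover have "((\<lambda>_. of_int k) - (x i)\<^sup>2) + (\<lambda>_. c - of_int k) = (\<lambda>_. (sqrt c)\<^sup>2) - (x i)\<^sup>2"
    by (rule ext) (simp add: fun_apply c_def)
  ultimately have "(\<lambda>_. (sqrt c)\<^sup>2) - (x i)\<^sup>2 \<in> poly_eval ` M" by metis
  moreover have "sqrt c > 0" by (simp add: c_def)
  ultimately show ?thesis by blast
qed

definition \<kappa> :: "'i \<Rightarrow> real" where
  "\<kappa> i = (SOME k. k > 0 \<and> (\<lambda>_. k\<^sup>2) - (x i)\<^sup>2 \<in> poly_eval ` M)"

lemma \<kappa>: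
  assumes "i \<in> \<Omega> - I"
  shows "\<kappa> i > 0" "(\<lambda>_. (\<kappa> i)\<^sup>2) - (x i)\<^sup>2 \<in> poly_eval ` M"
  using someI_ex[OF archimedean_bound[OF assms]] unfolding \<kappa>_def by auto

text \<open>For \<open>j \<in> I\<close> the point \<open>(b (j, True), b (j, False))\<close> is the inverse stereographic projection of
  \<open>\<alpha> j\<close> to the unit circle; the remaining second coordinates are dummies.\<close>

definition b :: "'i \<times> bool \<Rightarrow> ('i \<Rightarrow> real) \<Rightarrow> real" where
  "b n = (\<lambda>\<alpha>. if fst n \<in> I then if snd n then 2 * (1 / (1 + (\<alpha> (fst n))\<^sup>2)) - 1
                               else 2 * (\<alpha> (fst n) * (1 / (1 + (\<alpha> (fst n))\<^sup>2)))
              else if fst n \<in> \<Omega> \<and> \<not> snd n then \<alpha> (fst n) / \<kappa> (fst n) else 0)"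

definition y :: "'i \<Rightarrow> ('i \<Rightarrow> real) \<Rightarrow> real" where
  "y j = (\<lambda>\<alpha>. 1 / (1 + (\<alpha> j)\<^sup>2))"

lemma b_True: "j \<in> I \<Longrightarrow> b (j, True) = (\<lambda>_. 2) * y j - 1"
  by (rule ext) (simp add: b_def y_def fun_apply)

lemma b_False: "j \<in> I \<Longrightarrow> b (j, False) = (\<lambda>_. 2) * (x j * y j)"
  by (rule ext) (simp add: b_def y_def fun_apply)

lemma b_bounded: "i \<in> \<Omega> - I \<Longrightarrow> b (i, False) = (\<lambda>_. 1 / \<kappa> i) * x i"
  by (rule ext) (simp add: b_def fun_apply)

lemma b_dummy: "i \<notin> I \<Longrightarrow> i \<notin> \<Omega> \<or> s \<Longrightarrow> b (i, s) = 0"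
  by (rule ext) (auto simp: b_def fun_apply)

lemma b_cases:
  obtains j where "j \<in> I" "n = (j, True)" | j where "j \<in> I" "n = (j, False)"
  | i where "i \<in> \<Omega> - I" "n = (i, False)" | "b n = 0"
  using b_dummy[of "fst n" "snd n"] by (cases n; cases "snd n") fastforce+

lemma D_factor: "j \<in> I \<Longrightarrow> 1 + (x j)\<^sup>2 \<in> ext.D"
  using ext.D_step[OF _ ext.D_one, of "x j"] by simp

lemma x_in_B: "i \<in> \<Omega> \<Longrightarrow> x i \<in> ext.B"
  by (rule ext.A_sub_B) (simp add: polyfun.var)

lemma y_in_B: "j \<in> I \<Longrightarrow> y j \<in> ext.B"
  using ext.inverse_in_B[OF D_factor, of j] by (simp add: y_def fun_apply)

lemma b_in_B: "b n \<in> ext.B"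
proof (cases n rule: b_cases)
  case (1 j)
  then show ?thesis using y_in_B by (simp add: b_True)
next
  case (2 j)
  then show ?thesis using y_in_B x_in_B I_sub by (auto simp: b_False)
next
  case (3 i)
  then show ?thesis using x_in_B by (simp add: b_bounded)
qed simp

sublocale generators ext.B b
  by unfold_locales (rule b_in_B)

lemma Lam_sq: "h \<in> ext.B \<Longrightarrow> 0 \<le> ext.Lam (h\<^sup>2)"
  using ext.Lam_sq_M[OF _ ext.one_M, of h] by simp

text \<open>For \<open>j \<in> I\<close> the two coordinates lie on the unit circle, so
  \<open>1 - b^2\<close> is the square of the other one. For a bounded coordinate
  \<open>1 - b^2\<close> is a positive constant times \<open>\<kappa>^2 - x_i^2\<close>, a member of
  \<open>M\<close>.\<close>

lemma Lam_contraction: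
  assumes h: "h \<in> ext.B"
  shows "ext.Lam (h\<^sup>2 * (b n)\<^sup>2) \<le> ext.Lam (h\<^sup>2)"
proof -
  have *: ?thesis if "h\<^sup>2 - h\<^sup>2 * (b n)\<^sup>2 = q" "0 \<le> ext.Lam q" for q
    using that Lam.diff[of "h\<^sup>2" "h\<^sup>2 * (b n)\<^sup>2"] h by simp
  have circle: "(\<alpha> j)\<^sup>2 * (y j \<alpha>)\<^sup>2 = y j \<alpha> - (y j \<alpha>)\<^sup>2" for j \<alpha>
  proof -
    have "1 + (\<alpha> j)\<^sup>2 \<noteq> 0" by (smt (verit) zero_le_power2)
    then show ?thesis unfolding y_def by (simp add: divide_simps) (simp add: power2_eq_square algebra_simps)
  qed
  have real1: "c\<^sup>2 - c\<^sup>2 * (2 * v - 1)\<^sup>2 = (2 * (a * v) * c)\<^sup>2"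
    and real2: "c\<^sup>2 - c\<^sup>2 * (2 * (a * v))\<^sup>2 = ((2 * v - 1) * c)\<^sup>2"
    if "a\<^sup>2 * v\<^sup>2 = v - v\<^sup>2" for a c v :: real
    using that by algebra+
  show ?thesis
  proof (cases n rule: b_cases)
    case (1 j)
    have "h\<^sup>2 - h\<^sup>2 * (b n)\<^sup>2 = ((\<lambda>_. 2) * (x j * y j) * h)\<^sup>2"
      unfolding 1 b_True[OF 1(1)] by (rule ext, simp only: fun_apply, rule real1, rule circle)
    moreover have "(\<lambda>_. 2) * (x j * y j) * h \<in> ext.B"
      using 1 h x_in_B y_in_B I_sub by auto
    ultimately show ?thesis by (rule *[OF _ Lam_sq])
  next
    case (2 j)
    have "h\<^sup>2 - h\<^sup>2 * (b n)\<^sup>2 = (((\<lambda>_. 2) * y j - 1) * h)\<^sup>2"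
      unfolding 2 b_False[OF 2(1)] by (rule ext, simp only: fun_apply, rule real2, rule circle)
    moreover have "((\<lambda>_. 2) * y j - 1) * h \<in> ext.B"
      using 2 h y_in_B by auto
    ultimately show ?thesis by (rule *[OF _ Lam_sq])
  next
    case (3 i)
    have "h\<^sup>2 - h\<^sup>2 * (b n)\<^sup>2 = ((\<lambda>_. 1 / \<kappa> i) * h)\<^sup>2 * ((\<lambda>_. (\<kappa> i)\<^sup>2) - (x i)\<^sup>2)"
      unfolding 3(2) b_bounded[OF 3(1)]
      by (rule ext) (use \<kappa>(1)[OF 3(1)] in \<open>simp add: fun_apply field_simps power2_eq_square\<close>)
    then show ?thesis
      by (rule *[OF _ ext.Lam_sq_M[OF _ \<kappa>(2)[OF 3(1)]]]) (use h in auto)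
  next
    case 4
    then show ?thesis using Lam_sq[OF h] by (simp add: power2_eq_square)
  qed
qed

lemma Lam_b_power:
  assumes h: "h \<in> ext.B"
  shows "ext.Lam (h\<^sup>2 * b n ^ (2 * m)) \<le> ext.Lam (h\<^sup>2)"
proof (induction m)
  case (Suc m)
  have "h\<^sup>2 * b n ^ (2 * Suc m) = (h * b n ^ m)\<^sup>2 * (b n)\<^sup>2"
    by (rule ext) (simp add: fun_apply power_mult_distrib power_mult power_add power2_eq_square mult_ac)
  then have "ext.Lam (h\<^sup>2 * b n ^ (2 * Suc m)) \<le> ext.Lam ((h * b n ^ m)\<^sup>2)"
    using Lam_contraction[of "h * b n ^ m" n] h by simp
  also have "(h * b n ^ m)\<^sup>2 = h\<^sup>2 * b n ^ (2 * m)"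
    by (rule ext) (simp add: fun_apply power_mult_distrib power_mult[symmetric] mult.commute)
  finally show ?case using Suc by simp
qed simp

lemma admissible_Lam: "admissible ext.Lam"
  unfolding admissible_def
proof (intro conjI allI ballI)
  show "pos_functional ext.B ext.Lam"
    by unfold_locales (rule Lam_sq)
  show "\<exists>C. \<forall>m. ext.Lam (h\<^sup>2 * b n ^ (2 * m)) \<le> C" if "h \<in> ext.B" for h n
    using Lam_b_power[OF that] by blast
qed

text \<open>\<open>f \<mapsto> Lam (g * f)\<close> is itself admissible, as
  \<open>Lam (g * h^2)\<close> is nonnegative for \<open>g \<in> M\<close>. The weight
  \<open>g = 1\<close> serves existence; general \<open>g\<close> serves the decay estimate and the
  support statement.\<close>

lemma weighted_nonneg:
  assumes g: "g \<in> poly_eval ` M" and P: "polyfun V P" "\<And>t. t \<in> cube \<Longrightarrow> 0 \<le> P t"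
  shows "0 \<le> ext.Lam (g * (\<lambda>\<alpha>. P (\<beta> \<alpha>)))"
proof (rule admissible_nonneg[OF admissible_times[OF admissible_Lam] P(1)])
  show "g \<in> ext.B" using g ext.M_sub ext.A_sub_B by blast
  show "0 \<le> ext.Lam (g * h\<^sup>2)" if "h \<in> ext.B" for h
    using ext.Lam_sq_M[OF that g] by (simp add: mult.commute)
qed (use P in \<open>auto simp: cube_def\<close>)

lemma \<beta>_True: "j \<in> I \<Longrightarrow> \<beta> \<alpha> (j, True) = y j \<alpha>"
  by (simp add: \<beta>_def u_def b_True fun_apply)

lemma \<beta>_False: "j \<in> I \<Longrightarrow> \<beta> \<alpha> (j, False) = \<alpha> j * y j \<alpha> + 1 / 2"
  by (simp add: \<beta>_def u_def b_False fun_apply)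

lemma \<beta>_bounded: "i \<in> \<Omega> - I \<Longrightarrow> \<beta> \<alpha> (i, False) = (1 + \<alpha> i / \<kappa> i) / 2"
  by (simp add: \<beta>_def u_def b_bounded fun_apply)

section \<open>Passing between polynomials on the original space and on the cube\<close>

definition finite_part :: "('i \<times> bool \<Rightarrow> real) set" where
  "finite_part = {t \<in> cube. \<forall>j\<in>I. 0 < t (j, True)}"

text \<open>Undoes \<open>\<beta>\<close>: the formulas of \<open>\<beta>_True\<close>,
  \<open>\<beta>_False\<close> and \<open>\<beta>_bounded\<close> solved for
  \<open>\<alpha> i\<close>. It is applied on all of \<open>finite_part\<close>, also to points that
  are not of the form \<open>\<beta> \<alpha>\<close>.\<close>

definition r :: "('i \<times> bool \<Rightarrow> real) \<Rightarrow> 'i \<Rightarrow> real" where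
  "r t = (\<lambda>i\<in>\<Omega>. if i \<in> I then (t (i, False) - 1 / 2) / t (i, True) else \<kappa> i * (2 * t (i, False) - 1))"

text \<open>\<open>Q\<close> compactifies \<open>1 / d\<close> and \<open>P\<close> compactifies \<open>\<phi> / d\<close>.\<close>

definition compactifies where
  "compactifies \<phi> d Q P \<longleftrightarrow> d \<in> ext.D \<and> polyfun UNIV Q \<and> polyfun UNIV P \<and>
    (\<forall>\<alpha>. Q (\<beta> \<alpha>) * d \<alpha> = 1 \<and> P (\<beta> \<alpha>) * d \<alpha> = \<phi> \<alpha>) \<and>
    (\<forall>t\<in>cube. 0 \<le> Q t \<and> Q t \<le> 1) \<and>
    (\<forall>t\<in>finite_part. 0 < Q t \<and> Q t * \<phi> (r t) = P t)"

lemma compactifies_factor: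
  assumes j: "j \<in> I"
  shows "compactifies (x j) (1 + (x j)\<^sup>2) (\<lambda>t. t (j, True)) (\<lambda>t. t (j, False) - 1 / 2)"
proof -
  have nz: "1 + a\<^sup>2 \<noteq> 0" for a :: real by (smt (verit) zero_le_power2)
  have "j \<in> \<Omega>" using j I_sub by auto
  then show ?thesis
    using D_factor[OF j] j nz unfolding compactifies_def
    by (auto simp: \<beta>_True \<beta>_False y_def fun_apply cube_def finite_part_def r_def
        intro!: polyfun.intros polyfun_diff)
qed

text \<open>Sums and products share the denominator \<open>d * e\<close> and differ only in the
  numerator \<open>U\<close>, so that both follow from one argument.\<close>

lemma compactifies_combine:
  assumes "compactifies \<phi> d Q P" "compactifies \<psi> e R S" "polyfun UNIV U"
    and at_\<beta>: "\<And>\<alpha>. Q (\<beta> \<alpha>) * d \<alpha> = 1 \<Longrightarrow> P (\<beta> \<alpha>) * d \<alpha> = \<phi> \<alpha> \<Longrightarrow>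
      R (\<beta> \<alpha>) * e \<alpha> = 1 \<Longrightarrow> S (\<beta> \<alpha>) * e \<alpha> = \<psi> \<alpha> \<Longrightarrow> U (\<beta> \<alpha>) * (d \<alpha> * e \<alpha>) = \<omega> \<alpha>"
    and at_r: "\<And>t. Q t * \<phi> (r t) = P t \<Longrightarrow> R t * \<psi> (r t) = S t \<Longrightarrow> Q t * R t * \<omega> (r t) = U t"
  shows "compactifies \<omega> (d * e) (\<lambda>t. Q t * R t) U"
  unfolding compactifies_def
proof (intro conjI allI ballI)
  show "d * e \<in> ext.D" "polyfun UNIV (\<lambda>t. Q t * R t)"
    using assms(1,2) by (auto simp: compactifies_def intro: ext.D_mult polyfun.mult)
  show "polyfun UNIV U" by fact
  fix \<alpha>
  have h: "Q (\<beta> \<alpha>) * d \<alpha> = 1" "P (\<beta> \<alpha>) * d \<alpha> = \<phi> \<alpha>" "R (\<beta> \<alpha>) * e \<alpha> = 1" "S (\<beta> \<alpha>) * e \<alpha> = \<psi> \<alpha>"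
    using assms(1,2) by (auto simp: compactifies_def)
  have "Q (\<beta> \<alpha>) * R (\<beta> \<alpha>) * (d * e) \<alpha> = (Q (\<beta> \<alpha>) * d \<alpha>) * (R (\<beta> \<alpha>) * e \<alpha>)" by (simp add: fun_apply)
  then show "Q (\<beta> \<alpha>) * R (\<beta> \<alpha>) * (d * e) \<alpha> = 1" using h by simp
  show "U (\<beta> \<alpha>) * (d * e) \<alpha> = \<omega> \<alpha>" using at_\<beta>[OF h] by (simp add: fun_apply)
next
  fix t :: "'i \<times> bool \<Rightarrow> real" assume "t \<in> cube"
  then show "0 \<le> Q t * R t" "Q t * R t \<le> 1"
    using assms(1,2) by (auto simp: compactifies_def intro: mult_le_one)
next
  fix t assume "t \<in> finite_part"
  then show "0 < Q t * R t" "Q t * R t * \<omega> (r t) = U t"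
    using assms(1,2) at_r by (auto simp: compactifies_def)
qed

lemma compactifies_exists:
  assumes "polyfun \<Omega> \<phi>"
  shows "\<exists>d Q P. compactifies \<phi> d Q P"
  using assms
proof (induction rule: polyfun.induct)
  case (const c)
  have "compactifies (\<lambda>_. c) 1 (\<lambda>_. 1) (\<lambda>_. c)"
    unfolding compactifies_def by (auto simp: fun_apply ext.D_one intro: polyfun.intros)
  then show ?case by blast
next
  case (var i)
  show ?case
  proof (cases "i \<in> I")
    case True
    then show ?thesis using compactifies_factor by blast
  next
    case False
    then have i: "i \<in> \<Omega> - I" using var by simp
    have "compactifies (x i) 1 (\<lambda>_. 1) (\<lambda>t. \<kappa> i * (2 * t (i, False) - 1))"
      unfolding compactifies_def using i \<kappa>(1)[OF i]
      by (auto simp: fun_apply ext.D_one \<beta>_bounded r_def field_simps intro!: polyfun.intros polyfun_diff)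
    then show ?thesis by blast
  qed
next
  case (add \<phi> \<psi>)
  then obtain d Q P e R S where c: "compactifies \<phi> d Q P" "compactifies \<psi> e R S" by blast
  have "compactifies (\<lambda>\<alpha>. \<phi> \<alpha> + \<psi> \<alpha>) (d * e) (\<lambda>t. Q t * R t) (\<lambda>t. P t * R t + S t * Q t)"
  proof (rule compactifies_combine[OF c])
    show "polyfun UNIV (\<lambda>t. P t * R t + S t * Q t)"
      using c by (auto simp: compactifies_def intro!: polyfun.intros)
    fix \<alpha> assume "Q (\<beta> \<alpha>) * d \<alpha> = 1" "P (\<beta> \<alpha>) * d \<alpha> = \<phi> \<alpha>" "R (\<beta> \<alpha>) * e \<alpha> = 1" "S (\<beta> \<alpha>) * e \<alpha> = \<psi> \<alpha>"
    moreover have "(P (\<beta> \<alpha>) * R (\<beta> \<alpha>) + S (\<beta> \<alpha>) * Q (\<beta> \<alpha>)) * (d \<alpha> * e \<alpha>)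
      = (P (\<beta> \<alpha>) * d \<alpha>) * (R (\<beta> \<alpha>) * e \<alpha>) + (S (\<beta> \<alpha>) * e \<alpha>) * (Q (\<beta> \<alpha>) * d \<alpha>)"
      by (simp add: algebra_simps)
    ultimately show "(P (\<beta> \<alpha>) * R (\<beta> \<alpha>) + S (\<beta> \<alpha>) * Q (\<beta> \<alpha>)) * (d \<alpha> * e \<alpha>) = \<phi> \<alpha> + \<psi> \<alpha>" by simp
  next
    fix t assume "Q t * \<phi> (r t) = P t" "R t * \<psi> (r t) = S t"
    then show "Q t * R t * (\<phi> (r t) + \<psi> (r t)) = P t * R t + S t * Q t" by (auto simp: algebra_simps)
  qed
  then show ?case by blast
next
  case (mult \<phi> \<psi>)
  then obtain d Q P e R S where c: "compactifies \<phi> d Q P" "compactifies \<psi> e R S" by blast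
  have "compactifies (\<lambda>\<alpha>. \<phi> \<alpha> * \<psi> \<alpha>) (d * e) (\<lambda>t. Q t * R t) (\<lambda>t. P t * S t)"
  proof (rule compactifies_combine[OF c])
    show "polyfun UNIV (\<lambda>t. P t * S t)"
      using c by (auto simp: compactifies_def intro!: polyfun.intros)
    fix \<alpha> assume "P (\<beta> \<alpha>) * d \<alpha> = \<phi> \<alpha>" "S (\<beta> \<alpha>) * e \<alpha> = \<psi> \<alpha>"
    then show "P (\<beta> \<alpha>) * S (\<beta> \<alpha>) * (d \<alpha> * e \<alpha>) = \<phi> \<alpha> * \<psi> \<alpha>"
      by (metis mult.assoc mult.left_commute)
  next
    fix t assume "Q t * \<phi> (r t) = P t" "R t * \<psi> (r t) = S t"
    then show "Q t * R t * (\<phi> (r t) * \<psi> (r t)) = P t * S t"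
      by (metis mult.assoc mult.left_commute)
  qed
  then show ?case by blast
qed

lemma compactifies_eq: "compactifies \<phi> d Q P \<Longrightarrow> (\<lambda>\<alpha>. P (\<beta> \<alpha>)) = \<phi> * (\<lambda>\<alpha>. Q (\<beta> \<alpha>))"
proof (rule ext)
  fix \<alpha> assume "compactifies \<phi> d Q P"
  then have h: "Q (\<beta> \<alpha>) * d \<alpha> = 1" "P (\<beta> \<alpha>) * d \<alpha> = \<phi> \<alpha>" by (auto simp: compactifies_def)
  have "P (\<beta> \<alpha>) = P (\<beta> \<alpha>) * (Q (\<beta> \<alpha>) * d \<alpha>)" using h by simp
  also have "\<dots> = (P (\<beta> \<alpha>) * d \<alpha>) * Q (\<beta> \<alpha>)" by simp
  finally show "P (\<beta> \<alpha>) = (\<phi> * (\<lambda>\<alpha>. Q (\<beta> \<alpha>))) \<alpha>" using h by (simp add: fun_apply)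
qed

text \<open>On the cube \<open>1 / n - Q (1 - Q) ^ n\<close> is nonnegative by
  \<open>power_decay\<close>. Weighted with \<open>d * g\<close>, which is in \<open>M\<close>, it
  gives the claim, since \<open>Q\<close> at \<open>\<beta>\<close> cancels
  \<open>d\<close>.\<close>

lemma Lam_decay:
  assumes g: "g \<in> poly_eval ` M" and c: "compactifies \<phi> d Q P" and n: "n > 0"
  shows "ext.Lam (g * (1 - (\<lambda>\<alpha>. Q (\<beta> \<alpha>))) ^ n) \<le> ext.Lam (g * d) / real n"
proof -
  let ?q = "\<lambda>\<alpha>. Q (\<beta> \<alpha>)"
  have dD: "d \<in> ext.D" and Qp: "polyfun UNIV Q" and Qd: "\<And>\<alpha>. Q (\<beta> \<alpha>) * d \<alpha> = 1"
    and Q01: "\<And>t. t \<in> cube \<Longrightarrow> 0 \<le> Q t \<and> Q t \<le> 1"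
    using c by (auto simp: compactifies_def)
  have gd: "d * g \<in> poly_eval ` M" by (rule ext.D_sq_M[OF dD g])
  have q: "?q \<in> ext.B" by (rule polyfun_in_B[OF Qp])
  have gB: "g \<in> ext.B" using g ext.M_sub ext.A_sub_B by blast
  have dB: "d \<in> ext.B" using dD ext.D_sub ext.A_sub_B by blast
  have "0 \<le> ext.Lam ((d * g) * (\<lambda>\<alpha>. (\<lambda>t. 1 / real n - Q t * (1 - Q t) ^ n) (\<beta> \<alpha>)))"
  proof (rule weighted_nonneg[OF gd])
    show "polyfun UNIV (\<lambda>t. 1 / real n - Q t * (1 - Q t) ^ n)"
      by (intro polyfun_diff polyfun.intros polyfun_power Qp)
    show "0 \<le> 1 / real n - Q t * (1 - Q t) ^ n" if "t \<in> cube" for t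
      using power_decay[of "Q t" n] Q01[OF that] n by (simp add: field_simps)
  qed
  also have "(d * g) * (\<lambda>\<alpha>. (\<lambda>t. 1 / real n - Q t * (1 - Q t) ^ n) (\<beta> \<alpha>))
      = (\<lambda>_. 1 / real n) * (g * d) - g * (1 - ?q) ^ n"
  proof (rule ext)
    fix \<alpha>
    have "d \<alpha> * g \<alpha> * (1 / real n - Q (\<beta> \<alpha>) * (1 - Q (\<beta> \<alpha>)) ^ n)
      = 1 / real n * (g \<alpha> * d \<alpha>) - g \<alpha> * (Q (\<beta> \<alpha>) * d \<alpha>) * (1 - Q (\<beta> \<alpha>)) ^ n"
      by (simp add: algebra_simps)
    then show "(d * g * (\<lambda>\<alpha>. (\<lambda>t. 1 / real n - Q t * (1 - Q t) ^ n) (\<beta> \<alpha>))) \<alpha>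
       = ((\<lambda>_. 1 / real n) * (g * d) - g * (1 - ?q) ^ n) \<alpha>"
      by (simp add: fun_apply Qd)
  qed
  also have "ext.Lam \<dots> = 1 / real n * ext.Lam (g * d) - ext.Lam (g * (1 - ?q) ^ n)"
    using q gB dB by (simp add: Lam.diff Lam.scale)
  finally show ?thesis by simp
qed

lemma cube_functional_Lam: "cube_functional (\<lambda>P. ext.Lam (\<lambda>\<alpha>. P (\<beta> \<alpha>)))"
proof
  fix P Q :: "('i \<times> bool \<Rightarrow> real) \<Rightarrow> real" assume P: "polyfun UNIV P" and Q: "polyfun UNIV Q"
  have "(\<lambda>\<alpha>. P (\<beta> \<alpha>) + Q (\<beta> \<alpha>)) = (\<lambda>\<alpha>. P (\<beta> \<alpha>)) + (\<lambda>\<alpha>. Q (\<beta> \<alpha>))" by (rule ext) (simp add: fun_apply)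
  then show "ext.Lam (\<lambda>\<alpha>. P (\<beta> \<alpha>) + Q (\<beta> \<alpha>)) = ext.Lam (\<lambda>\<alpha>. P (\<beta> \<alpha>)) + ext.Lam (\<lambda>\<alpha>. Q (\<beta> \<alpha>))"
    using polyfun_in_B[OF P] polyfun_in_B[OF Q] by (simp add: Lam.add)
next
  fix P :: "('i \<times> bool \<Rightarrow> real) \<Rightarrow> real" and c assume P: "polyfun UNIV P"
  have "(\<lambda>\<alpha>. c * P (\<beta> \<alpha>)) = (\<lambda>_. c) * (\<lambda>\<alpha>. P (\<beta> \<alpha>))" by (rule ext) (simp add: fun_apply)
  then show "ext.Lam (\<lambda>\<alpha>. c * P (\<beta> \<alpha>)) = c * ext.Lam (\<lambda>\<alpha>. P (\<beta> \<alpha>))"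
    using polyfun_in_B[OF P] by (simp add: Lam.scale)
next
  fix P :: "('i \<times> bool \<Rightarrow> real) \<Rightarrow> real" assume "polyfun UNIV P" "\<And>t. t \<in> cube \<Longrightarrow> 0 \<le> P t"
  then show "0 \<le> ext.Lam (\<lambda>\<alpha>. P (\<beta> \<alpha>))"
    using weighted_nonneg[OF ext.one_M] by simp
qed

end

section \<open>Existence\<close>

lemma continuous_map_polyfun:
  "polyfun \<Omega> P \<Longrightarrow> continuous_map (powertop_real \<Omega>) euclideanreal P"
  by (induction rule: polyfun.induct) (auto intro!: continuous_intros)

lemma measurable_borel_ofI:
  assumes "f \<in> space N \<rightarrow> topspace T" "\<And>U. openin T U \<Longrightarrow> f -` U \<inter> space N \<in> sets N"
  shows "f \<in> measurable N (borel_of T)"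
  unfolding borel_of_def
  by (rule measurable_measure_of) (use assms in \<open>auto dest: openin_subset\<close>)

lemma Hausdorff_powertop_real: "Hausdorff_space (powertop_real \<Omega>)"
  by (simp add: Hausdorff_space_product_topology Hausdorff_space_euclidean)

lemma compactin_sets_borel_of: "Hausdorff_space T \<Longrightarrow> compactin T K \<Longrightarrow> K \<in> sets (borel_of T)"
  by (intro closedin_sets_borel_of compactin_imp_closedin)

context moment
begin

abbreviation T :: "('i \<Rightarrow> real) topology" where
  "T \<equiv> powertop_real \<Omega>"

theorem representing_radon_measure:
  "\<exists>\<nu>. radon_measure T \<nu> \<and> represents \<Omega> L \<nu>"
proof -
  interpret cf: cube_functional "\<lambda>P. ext.Lam (\<lambda>\<alpha>. P (\<beta> \<alpha>))" by (rule cube_functional_Lam)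
  obtain \<mu> where radon: "radon_measure (top_of_set cube) \<mu>" and "finite_measure \<mu>"
    and rep: "\<And>P. polyfun UNIV P \<Longrightarrow> integrable \<mu> P"
      "\<And>P. polyfun UNIV P \<Longrightarrow> (\<integral>t. P t \<partial>\<mu>) = ext.Lam (\<lambda>\<alpha>. P (\<beta> \<alpha>))"
    using cf.representing_measure by blast
  interpret finite_measure \<mu> by fact
  have sets_\<mu>: "sets \<mu> = sets (borel_of (top_of_set cube))" using radon by (simp add: radon_measure_def)
  have space_\<mu>: "space \<mu> = cube" using sets_eq_imp_space_eq[OF sets_\<mu>] by simp
  define N where "N j = {t \<in> cube. t (j, True) = 0}" for j :: 'i
  \<comment> \<open>On \<open>N j\<close> the function \<open>(1 - t (j, True)) ^ n\<close> equals
    1, while \<open>Lam_decay\<close> with weight 1 bounds its integral by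
    \<open>c / n\<close>.\<close>
  have N: "N j \<in> null_sets \<mu>" if j: "j \<in> I" for j
  proof -
    have "closedin (top_of_set cube) {t \<in> topspace (top_of_set cube). t (j, True) \<in> {0}}"
      using continuous_on_polyfun[OF polyfun.var, of "(j, True)" UNIV cube]
      by (intro closedin_continuous_map_preimage[where Y = euclideanreal]) auto
    then have Ns: "N j \<in> sets \<mu>" by (simp add: sets_\<mu> N_def closedin_sets_borel_of)
    define c where "c = ext.Lam (1 * (1 + (x j)\<^sup>2))"
    have "measure \<mu> (N j) \<le> c / real n" if n: "n \<ge> 1" for n
    proof -
      have P: "polyfun UNIV (\<lambda>t. (1 - t (j, True)) ^ n)"
        by (intro polyfun_power polyfun_diff polyfun.intros) auto
      have "measure \<mu> (N j) = (\<integral>t. indicator (N j) t \<partial>\<mu>)"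
        using Ns by (simp add: Int_absorb2 sets.sets_into_space)
      also have "\<dots> \<le> (\<integral>t. (1 - t (j, True)) ^ n \<partial>\<mu>)"
      proof (rule integral_mono)
        show "integrable \<mu> (indicator (N j) :: _ \<Rightarrow> real)"
          using Ns by (intro integrable_real_indicator) (auto simp: less_top[symmetric])
      qed (use rep(1)[OF P] in \<open>auto simp: indicator_def N_def space_\<mu> cube_def\<close>)
      also have "\<dots> = ext.Lam (1 * (1 - (\<lambda>\<alpha>. \<beta> \<alpha> (j, True))) ^ n)"
        unfolding rep(2)[OF P] by (rule arg_cong[of _ _ ext.Lam], rule ext) (simp add: fun_apply)
      also have "\<dots> \<le> c / real n"
        unfolding c_def using n by (intro Lam_decay[OF ext.one_M compactifies_factor[OF j]]) auto
      finally show ?thesis .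
    qed
    then have "measure \<mu> (N j) \<le> 0"
      by (intro LIMSEQ_le_const[OF lim_const_over_n[of c]]) auto
    then show ?thesis using Ns by (simp add: null_sets_def emeasure_eq_measure measure_le_0_iff)
  qed
  have diff: "cube - finite_part = (\<Union>j\<in>I. N j)"
  proof (rule set_eqI)
    fix t :: "'i \<times> bool \<Rightarrow> real"
    have "t \<in> cube \<Longrightarrow> 0 \<le> t (j, True)" for j by (simp add: cube_def)
    then show "t \<in> cube - finite_part \<longleftrightarrow> t \<in> (\<Union>j\<in>I. N j)"
      by (auto simp: finite_part_def N_def less_le)
  qed
  \<comment> \<open>Countability of \<open>I\<close> enters here.\<close>
  have null: "cube - finite_part \<in> null_sets \<mu>"
    unfolding diff by (rule null_sets_UN'[OF countable_I N])
  have fin_sub: "finite_part \<subseteq> cube" by (auto simp: finite_part_def)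
  have fin: "AE t in \<mu>. t \<in> finite_part"
    by (rule AE_I'[OF null]) (auto simp: space_\<mu>)
  have cont_r: "continuous_map (top_of_set finite_part) T r"
    unfolding continuous_map_componentwise
  proof (intro conjI ballI)
    show "r ` topspace (top_of_set finite_part) \<subseteq> extensional \<Omega>" by (auto simp: r_def)
    fix i assume i: "i \<in> \<Omega>"
    have coord: "continuous_on finite_part (\<lambda>t. t n)" for n :: "'i \<times> bool"
      by (rule continuous_on_polyfun[OF polyfun.var]) auto
    have "continuous_on finite_part (\<lambda>t. (t (i, False) - 1 / 2) / t (i, True))" if "i \<in> I"
      using that by (intro continuous_intros coord) (auto simp: finite_part_def)
    moreover have "continuous_on finite_part (\<lambda>t. \<kappa> i * (2 * t (i, False) - 1))"
      by (intro continuous_intros coord)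
    ultimately have "continuous_on finite_part (\<lambda>t. r t i)"
      using i by (cases "i \<in> I") (simp_all add: r_def)
    then show "continuous_map (top_of_set finite_part) euclideanreal (\<lambda>t. r t i)" by simp
  qed
  \<comment> \<open>An arbitrary point of the space, the value of \<open>r'\<close> on the null set
    where \<open>r\<close> may divide by 0.\<close>
  define c where "c = (\<lambda>i\<in>\<Omega>. 0 :: real)"
  define r' where "r' t = (if t \<in> finite_part then r t else c)" for t
  have r_top: "r t \<in> topspace T" for t by (auto simp: r_def)
  have c_top: "c \<in> topspace T" by (auto simp: c_def)
  have meas: "r' \<in> measurable \<mu> (borel_of T)"
  proof (rule measurable_borel_ofI)
    show "r' \<in> space \<mu> \<rightarrow> topspace T" using r_top c_top by (simp add: r'_def)
    fix U assume U: "openin T U"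
    have "openin (top_of_set finite_part) {t \<in> topspace (top_of_set finite_part). r t \<in> U}"
      by (rule openin_continuous_map_preimage[OF cont_r U])
    then obtain W where W: "open W" "{t \<in> finite_part. r t \<in> U} = W \<inter> finite_part"
      by (auto simp: openin_subtopology)
    have "W \<inter> cube \<in> sets \<mu>"
      unfolding sets_\<mu> using W by (intro openin_sets_borel_of) (auto simp: openin_subtopology)
    moreover have "r' -` U \<inter> space \<mu> = (W \<inter> cube - (cube - finite_part)) \<union> (if c \<in> U then cube - finite_part else {})"
    proof -
      have "r t \<in> U \<longleftrightarrow> t \<in> W" if "t \<in> finite_part" for t using W(2) that by blast
      then show ?thesis using fin_sub by (auto simp: r'_def space_\<mu> split: if_splits)
    qed
    moreover have "cube - finite_part \<in> sets \<mu>" using null by auto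
    ultimately show "r' -` U \<inter> space \<mu> \<in> sets \<mu>" by auto
  qed
  have poly_meas: "P \<in> borel_measurable (borel_of T)" if "polyfun \<Omega> P" for P
    by (rule continuous_map_measurable_borel_of[OF refl continuous_map_polyfun[OF that]])
  \<comment> \<open>Squares come first: they are pointwise nonnegative, as monotone convergence
    wants, and belong to \<open>M\<close>, as \<open>Lam_decay\<close> wants.\<close>
  have square: "integrable \<mu> (\<lambda>t. (\<phi>\<^sup>2) (r' t)) \<and> (\<integral>t. (\<phi>\<^sup>2) (r' t) \<partial>\<mu>) = ext.Lam (\<phi>\<^sup>2)"
    if \<phi>: "polyfun \<Omega> \<phi>" for \<phi>
  proof -
    define g where "g = \<phi>\<^sup>2"
    have gp: "polyfun \<Omega> g" using ext.power_in[of \<phi> 2] \<phi> by (simp add: g_def)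
    have gM: "g \<in> poly_eval ` M" unfolding g_def using \<phi> by (intro ext.sq_in_M) simp
    have g0: "0 \<le> g \<alpha>" for \<alpha> by (simp add: g_def fun_apply)
    have gB: "g \<in> ext.B" using gp by (intro ext.A_sub_B) simp
    obtain d Q P where cp: "compactifies g d Q P" using compactifies_exists[OF gp] by blast
    then have Q: "polyfun UNIV Q" and P: "polyfun UNIV P"
      and Q01: "\<And>t. t \<in> cube \<Longrightarrow> 0 \<le> Q t \<and> Q t \<le> 1"
      and QP: "\<And>t. t \<in> finite_part \<Longrightarrow> 0 < Q t \<and> Q t * g (r t) = P t"
      by (auto simp: compactifies_def)
    let ?q = "\<lambda>\<alpha>. Q (\<beta> \<alpha>)"
    have qB: "?q \<in> ext.B" by (rule polyfun_in_B[OF Q])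
    \<comment> \<open>Partial sums of the geometric series for \<open>P / Q\<close>. Each is a
      polynomial on the cube, so its integral is known; on \<open>finite_part\<close> they increase
      to \<open>g (r t)\<close>.\<close>
    define F where "F n t = P t * (\<Sum>k<n. (1 - Q t) ^ k)" for n t
    have Fp: "polyfun UNIV (F n)" for n
      unfolding F_def by (intro polyfun.intros polyfun_sum polyfun_power polyfun_diff P Q)
    have F_int: "(\<integral>t. F n t \<partial>\<mu>) = ext.Lam g - ext.Lam (g * (1 - ?q) ^ n)" for n
    proof -
      have "(\<lambda>\<alpha>. F n (\<beta> \<alpha>)) = g - g * (1 - ?q) ^ n"
      proof (rule ext)
        fix \<alpha>
        have "P (\<beta> \<alpha>) = g \<alpha> * Q (\<beta> \<alpha>)"
          using fun_cong[OF compactifies_eq[OF cp], of \<alpha>] by (simp add: fun_apply)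
        then have "F n (\<beta> \<alpha>) = g \<alpha> * ((1 - (1 - Q (\<beta> \<alpha>))) * (\<Sum>k<n. (1 - Q (\<beta> \<alpha>)) ^ k))"
          by (simp add: F_def)
        also have "\<dots> = g \<alpha> * (1 - (1 - Q (\<beta> \<alpha>)) ^ n)"
          by (simp only: one_diff_power_eq)
        finally show "F n (\<beta> \<alpha>) = (g - g * (1 - ?q) ^ n) \<alpha>"
          by (simp add: fun_apply algebra_simps)
      qed
      then show ?thesis unfolding rep(2)[OF Fp] using gB qB by (simp add: Lam.diff)
    qed
    have F_fin: "F n t = g (r t) * (1 - (1 - Q t) ^ n)" if "t \<in> finite_part" for n t
    proof -
      have "F n t = g (r t) * ((1 - (1 - Q t)) * (\<Sum>k<n. (1 - Q t) ^ k))"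
        using QP[OF that] by (simp add: F_def mult.assoc[symmetric] mult.commute)
      also have "\<dots> = g (r t) * (1 - (1 - Q t) ^ n)"
        by (simp only: one_diff_power_eq)
      finally show ?thesis .
    qed
    have decay: "(\<lambda>n. ext.Lam (g * (1 - ?q) ^ n)) \<longlonglongrightarrow> 0"
    proof (rule tendsto_sandwich[OF _ _ tendsto_const lim_const_over_n[of "ext.Lam (g * d)"]])
      show "\<forall>\<^sub>F n in sequentially. ext.Lam (g * (1 - ?q) ^ n) \<le> ext.Lam (g * d) / real n"
        using Lam_decay[OF gM cp] by (auto intro!: eventually_sequentiallyI[of 1])
      have "0 \<le> ext.Lam (g * (1 - ?q) ^ n)" for n
      proof -
        have "0 \<le> ext.Lam (g * (\<lambda>\<alpha>. (\<lambda>t. (1 - Q t) ^ n) (\<beta> \<alpha>)))"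
          by (rule weighted_nonneg[OF gM, of UNIV]) (use Q Q01 in \<open>auto intro!: polyfun_power polyfun_diff polyfun.intros\<close>)
        moreover have "(\<lambda>\<alpha>. (\<lambda>t. (1 - Q t) ^ n) (\<beta> \<alpha>)) = (1 - ?q) ^ n"
          by (rule ext) (simp add: fun_apply)
        ultimately show ?thesis by simp
      qed
      then show "\<forall>\<^sub>F n in sequentially. 0 \<le> ext.Lam (g * (1 - ?q) ^ n)" by simp
    qed
    have Q1: "0 \<le> 1 - Q t" "1 - Q t < 1" if "t \<in> finite_part" for t
      using QP[OF that] Q01[of t] that fin_sub by auto
    have c1: "integrable \<mu> (F n)" for n by (rule rep(1)[OF Fp])
    have c2: "AE t in \<mu>. mono (\<lambda>n. F n t)"
      using fin
    proof eventually_elim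
      case (elim t)
      have "(1 - Q t) ^ n \<le> (1 - Q t) ^ m" if "m \<le> n" for m n
        using Q1[OF elim] that by (intro power_decreasing) auto
      then show ?case
        using g0[of "r t"] by (auto simp: F_fin[OF elim] intro!: monoI mult_left_mono)
    qed
    have c3: "AE t in \<mu>. 0 \<le> F n t" for n
      using fin
    proof eventually_elim
      case (elim t)
      then show ?case
        using Q1[OF elim] g0[of "r t"] by (auto simp: F_fin power_le_one)
    qed
    have c4: "AE t in \<mu>. (\<lambda>n. F n t) \<longlonglongrightarrow> g (r' t)"
      using fin
    proof eventually_elim
      case (elim t)
      have "(\<lambda>n. g (r t) * (1 - (1 - Q t) ^ n)) \<longlonglongrightarrow> g (r t) * (1 - 0)"
        using Q1[OF elim] by (intro tendsto_intros LIMSEQ_realpow_zero) auto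
      then show ?case using elim by (simp add: F_fin r'_def)
    qed
    have c5: "(\<lambda>n. \<integral>t. F n t \<partial>\<mu>) \<longlonglongrightarrow> ext.Lam g"
      unfolding F_int using tendsto_diff[OF tendsto_const decay, of "ext.Lam g"] by simp
    have c6: "(\<lambda>t. g (r' t)) \<in> borel_measurable \<mu>"
      by (rule measurable_compose[OF meas poly_meas[OF gp]])
    note mct = integral_monotone_convergence_nonneg[OF c1 c2 c3 c4 c5 c6]
    have "integrable \<mu> (\<lambda>t. g (r' t))" "(\<integral>t. g (r' t) \<partial>\<mu>) = ext.Lam g"
      by (rule mct)+
    then show ?thesis by (simp add: g_def)
  qed
  \<comment> \<open>Every polynomial is a difference of two squares,
    \<open>f = ((f + 1) / 2)^2 - ((f - 1) / 2)^2\<close>.\<close>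
  have poly_int: "integrable \<mu> (\<lambda>t. f (r' t)) \<and> (\<integral>t. f (r' t) \<partial>\<mu>) = ext.Lam f"
    if f: "polyfun \<Omega> f" for f
  proof -
    define p where "p = (\<lambda>_. 1/2) * (f + 1)"
    define q where "q = (\<lambda>_. 1/2) * (f - 1)"
    have pq: "polyfun \<Omega> p" "polyfun \<Omega> q"
      using ext.mult_in[of "\<lambda>_. 1/2" "f + 1"] ext.mult_in[of "\<lambda>_. 1/2" "f - 1"] f
        ext.add_in[of f 1] ext.diff_in[of f 1] ext.one_in
      by (auto simp: p_def q_def intro: polyfun.const)
    have eq: "f = p\<^sup>2 - q\<^sup>2"
      by (rule ext) (simp add: p_def q_def fun_apply power2_eq_square algebra_simps)
    have "p\<^sup>2 \<in> ext.B" "q\<^sup>2 \<in> ext.B"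
      using pq ext.power_in[of p 2] ext.power_in[of q 2] by (auto intro!: ext.A_sub_B)
    then have "ext.Lam f = ext.Lam (p\<^sup>2) - ext.Lam (q\<^sup>2)" unfolding eq by (rule Lam.diff)
    moreover have "(\<lambda>t. f (r' t)) = (\<lambda>t. (p\<^sup>2) (r' t) - (q\<^sup>2) (r' t))"
      unfolding eq by (simp add: fun_apply)
    ultimately show ?thesis
      using square[OF pq(1)] square[OF pq(2)] by simp
  qed
  define \<nu> where "\<nu> = distr \<mu> (borel_of T) r'"
  interpret \<nu>: finite_measure \<nu> unfolding \<nu>_def by (rule finite_measure_distr[OF meas])
  have "represents \<Omega> L \<nu>"
    unfolding represents_def
  proof (intro ballI conjI)
    fix f :: "('i, real) mpoly" assume f: "f \<in> poly_ring \<Omega>"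
    have fp: "polyfun \<Omega> (poly_eval f)" by (rule polyfun_poly_eval[OF f])
    show "integrable \<nu> (poly_eval f)"
      unfolding \<nu>_def integrable_distr_eq[OF meas poly_meas[OF fp]] using poly_int[OF fp] by simp
    show "L f = (\<integral>\<alpha>. poly_eval f \<alpha> \<partial>\<nu>)"
      unfolding \<nu>_def integral_distr[OF meas poly_meas[OF fp]]
      using poly_int[OF fp] Lam_poly_eval[OF f] by simp
  qed
  moreover have "radon_measure T \<nu>"
    unfolding radon_measure_def
  proof (intro conjI ballI)
    show sets_\<nu>: "sets \<nu> = sets (borel_of T)" by (simp add: \<nu>_def)
    show "\<exists>U. openin T U \<and> \<alpha> \<in> U \<and> emeasure \<nu> U < \<infinity>" if "\<alpha> \<in> topspace T" for \<alpha>
      using that openin_topspace[of T] by (intro exI[of _ "topspace T"]) (simp add: less_top[symmetric])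
    fix B assume B: "B \<in> sets \<nu>"
    let ?S = "SUP K\<in>{K. compactin T K \<and> K \<subseteq> B}. emeasure \<nu> K"
    show "emeasure \<nu> B = ?S"
    proof (rule antisym)
      show "?S \<le> emeasure \<nu> B" using B by (intro SUP_least emeasure_mono) auto
      \<comment> \<open>With the null set removed, compact subsets of \<open>E\<close> lie in
        \<open>finite_part\<close>, where \<open>r'\<close> is the continuous map \<open>r\<close>;
        their images are compact subsets of \<open>B\<close>.\<close>
      define E where "E = (r' -` B \<inter> space \<mu>) - (cube - finite_part)"
      have Bs: "r' -` B \<inter> space \<mu> \<in> sets \<mu>" using B meas by (auto simp: \<nu>_def)
      have Es: "E \<in> sets \<mu>" using Bs null by (auto simp: E_def)
      have "emeasure \<nu> B = emeasure \<mu> (r' -` B \<inter> space \<mu>)"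
        using B meas by (simp add: \<nu>_def emeasure_distr)
      also have "\<dots> = emeasure \<mu> E"
        unfolding E_def using null Bs by (rule emeasure_Diff_null_set[symmetric])
      also have "\<dots> = (SUP K\<in>{K. compactin (top_of_set cube) K \<and> K \<subseteq> E}. emeasure \<mu> K)"
        using radon Es by (simp add: radon_measure_def)
      also have "\<dots> \<le> ?S"
      proof (rule SUP_least)
        fix K assume "K \<in> {K. compactin (top_of_set cube) K \<and> K \<subseteq> E}"
        then have K: "compact K" "K \<subseteq> E" by (auto simp: compactin_subtopology)
        have Kf: "K \<subseteq> finite_part" using K by (auto simp: E_def space_\<mu>)
        then have "compactin (top_of_set finite_part) K" using K by (simp add: compactin_subtopology)
        then have rK: "compactin T (r ` K)" by (rule image_compactin[OF _ cont_r])
        have r'K: "r' t = r t" if "t \<in> K" for t using that Kf by (auto simp: r'_def)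
        have rKs: "r ` K \<in> sets (borel_of T)"
          by (rule compactin_sets_borel_of[OF Hausdorff_powertop_real rK])
        have "r ` K \<subseteq> B" using K r'K by (auto simp: E_def)
        have "emeasure \<mu> K \<le> emeasure \<mu> (r' -` (r ` K) \<inter> space \<mu>)"
          using K r'K rKs meas by (intro emeasure_mono) (auto simp: E_def)
        also have "\<dots> = emeasure \<nu> (r ` K)"
          using rKs meas by (simp add: \<nu>_def emeasure_distr)
        also have "\<dots> \<le> ?S" using rK \<open>r ` K \<subseteq> B\<close> by (intro SUP_upper) auto
        finally show "emeasure \<mu> K \<le> ?S" .
      qed
      finally show "emeasure \<nu> B \<le> ?S" .
    qed
  qed
  ultimately show ?thesis by blast
qed

end

section \<open>Uniqueness and support\<close>

text \<open>Inner regularity makes a null set out of an arbitrary union of open null sets.\<close>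

lemma radon_measure_null_union:
  assumes radon: "radon_measure T \<nu>"
    and U: "\<And>U. U \<in> \<U> \<Longrightarrow> openin T U" "\<And>U. U \<in> \<U> \<Longrightarrow> emeasure \<nu> U = 0"
    and E: "E \<in> sets \<nu>" "E \<subseteq> \<Union>\<U>"
  shows "emeasure \<nu> E = 0"
proof -
  have sets: "sets \<nu> = sets (borel_of T)" using radon by (simp add: radon_measure_def)
  have null: "\<Union>F \<in> null_sets \<nu>" if fin: "finite F" and F: "F \<subseteq> \<U>" for F
  proof (rule null_sets.finite_Union[OF fin])
    show "F \<subseteq> null_sets \<nu>"
      using F U openin_sets_borel_of[of T] unfolding null_sets_def sets by blast
  qed
  have "emeasure \<nu> K = 0" if K: "compactin T K" "K \<subseteq> E" for K
  proof -
    obtain F where F: "finite F" "F \<subseteq> \<U>" "K \<subseteq> \<Union>F"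
      using compactinD[OF K(1) U(1)] K(2) E(2) by (metis order_trans)
    then have "emeasure \<nu> K \<le> emeasure \<nu> (\<Union>F)"
      using null[OF F(1,2)] by (intro emeasure_mono) auto
    then show ?thesis using null[OF F(1,2)] by (simp add: null_sets_def)
  qed
  then have "(SUP K\<in>{K. compactin T K \<and> K \<subseteq> E}. emeasure \<nu> K) \<le> 0"
    by (intro SUP_least) auto
  then show ?thesis using radon E(1) by (simp add: radon_measure_def)
qed

context moment
begin

text \<open>On this closed set \<open>\<beta>\<close> maps injectively into the cube, and it carries
  every representing measure, so measures can be compared on the cube.\<close>

definition bounded_part :: "('i \<Rightarrow> real) set" where
  "bounded_part = {\<alpha> \<in> topspace T. \<forall>i\<in>\<Omega> - I. \<bar>\<alpha> i\<bar> \<le> \<kappa> i}"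

lemma bounded_part_compl:
  "topspace T - bounded_part = (\<Union>i\<in>\<Omega> - I. {\<alpha> \<in> topspace T. \<bar>\<alpha> i\<bar> \<in> {\<kappa> i<..}})"
proof (rule set_eqI)
  fix \<alpha>
  have "\<alpha> \<in> topspace T - bounded_part \<longleftrightarrow> \<alpha> \<in> topspace T \<and> (\<exists>i\<in>\<Omega> - I. \<kappa> i < \<bar>\<alpha> i\<bar>)"
    unfolding bounded_part_def by (simp only: Diff_iff mem_Collect_eq not_le[symmetric]) blast
  then show "\<alpha> \<in> topspace T - bounded_part \<longleftrightarrow> \<alpha> \<in> (\<Union>i\<in>\<Omega> - I. {\<alpha> \<in> topspace T. \<bar>\<alpha> i\<bar> \<in> {\<kappa> i<..}})"
    by simp
qed

lemma openin_coordinate_gt: "i \<in> \<Omega> \<Longrightarrow> openin T {\<alpha> \<in> topspace T. \<bar>\<alpha> i\<bar> \<in> {c<..}}"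
  by (intro openin_continuous_map_preimage[where Y = euclideanreal] continuous_intros) auto

lemma openin_bounded_part_compl: "openin T (topspace T - bounded_part)"
  unfolding bounded_part_compl by (rule openin_Union) (use openin_coordinate_gt in blast)

lemma \<beta>_in_cube:
  assumes "\<alpha> \<in> bounded_part"
  shows "\<beta> \<alpha> \<in> cube"
proof -
  have "\<bar>b n \<alpha>\<bar> \<le> 1" for n
  proof (cases n rule: b_cases)
    case (1 j)
    have "0 \<le> y j \<alpha>" "y j \<alpha> \<le> 1" by (auto simp: y_def divide_simps add_pos_nonneg)
    then show ?thesis using 1 by (simp add: b_True fun_apply abs_le_iff)
  next
    case (2 j)
    have "0 \<le> (1 - \<bar>\<alpha> j\<bar>)\<^sup>2" by simp
    then have "2 * \<bar>\<alpha> j\<bar> \<le> 1 + (\<alpha> j)\<^sup>2" by (simp add: power2_eq_square algebra_simps)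
    moreover have "0 < 1 + (\<alpha> j)\<^sup>2" by (simp add: add_pos_nonneg)
    ultimately show ?thesis using 2 by (simp add: b_False y_def fun_apply abs_mult field_simps)
  next
    case (3 i)
    then show ?thesis using assms \<kappa>(1)[OF 3(1)] by (simp add: b_bounded fun_apply bounded_part_def abs_mult)
  qed (simp add: fun_apply)
  then show ?thesis by (auto simp: cube_def \<beta>_def u_def abs_le_iff field_simps)
     (smt (verit))+
qed

text \<open>Keeps disjoint compact sets disjoint in the cube, as Urysohn's lemma requires in
  \<open>representing_compact_le\<close>.\<close>

lemma \<beta>_inj: "inj_on \<beta> bounded_part"
proof (rule inj_onI)
  fix \<alpha> \<gamma> assume \<alpha>: "\<alpha> \<in> bounded_part" and \<gamma>: "\<gamma> \<in> bounded_part" and eq: "\<beta> \<alpha> = \<beta> \<gamma>"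
  show "\<alpha> = \<gamma>"
  proof (rule PiE_ext)
    show "\<alpha> \<in> \<Omega> \<rightarrow>\<^sub>E UNIV" "\<gamma> \<in> \<Omega> \<rightarrow>\<^sub>E UNIV" using \<alpha> \<gamma> by (auto simp: bounded_part_def)
    fix i assume i: "i \<in> \<Omega>"
    show "\<alpha> i = \<gamma> i"
    proof (cases "i \<in> I")
      case True
      then have "y i \<alpha> = y i \<gamma>" "\<alpha> i * y i \<alpha> = \<gamma> i * y i \<gamma>"
        using fun_cong[OF eq, of "(i, True)"] fun_cong[OF eq, of "(i, False)"] by (auto simp: \<beta>_True \<beta>_False)
      moreover have "y i \<alpha> > 0" by (auto simp: y_def divide_simps add_pos_nonneg)
      ultimately show ?thesis by auto
    next
      case False
      then have i: "i \<in> \<Omega> - I" using i by simp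
      then show ?thesis
        using fun_cong[OF eq, of "(i, False)"] \<kappa>(1)[OF i] by (simp add: \<beta>_bounded)
    qed
  qed
qed

lemma continuous_map_\<beta>: "continuous_map T euclidean \<beta>"
proof -
  have nz: "1 + a\<^sup>2 \<noteq> 0" for a :: real by (smt (verit) zero_le_power2)
  have "continuous_map T euclideanreal (b n)" for n
  proof (cases n rule: b_cases)
    case (1 j)
    then have "j \<in> \<Omega>" using I_sub by auto
    then have "continuous_map T euclideanreal (\<lambda>\<alpha>. 2 * (1 / (1 + (\<alpha> j)\<^sup>2)) - 1)"
      by (intro continuous_intros) (auto simp: nz)
    then show ?thesis using 1 by (simp add: b_def)
  next
    case (2 j)
    then have "j \<in> \<Omega>" using I_sub by auto
    then have "continuous_map T euclideanreal (\<lambda>\<alpha>. 2 * (\<alpha> j * (1 / (1 + (\<alpha> j)\<^sup>2))))"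
      by (intro continuous_intros) (auto simp: nz)
    then show ?thesis using 2 by (simp add: b_def)
  next
    case (3 i)
    then have "continuous_map T euclideanreal (\<lambda>\<alpha>. (1 / \<kappa> i) * \<alpha> i)"
      by (intro continuous_intros) auto
    then show ?thesis using 3 by (simp add: b_bounded times_fun_def)
  next
    case 4
    then show ?thesis by (simp add: zero_fun_def)
  qed
  then have "continuous_map T euclideanreal (\<lambda>\<alpha>. (1 / 2) * (1 + b n \<alpha>))" for n
    by (intro continuous_intros) auto
  then have "continuous_map T (product_topology (\<lambda>_. euclideanreal) UNIV) \<beta>"
    unfolding continuous_map_componentwise_UNIV by (simp add: \<beta>_def u_def)
  then show ?thesis by (simp add: euclidean_product_topology)
qed

section \<open>Properties of an arbitrary representing measure\<close>

definition representing :: "('i \<Rightarrow> real) measure \<Rightarrow> bool" where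
  "representing \<nu> \<longleftrightarrow> radon_measure T \<nu> \<and> represents \<Omega> L \<nu>"

lemma representing_sets: "representing \<nu> \<Longrightarrow> sets \<nu> = sets (borel_of T)"
  by (simp add: representing_def radon_measure_def)

lemma representing_space: "representing \<nu> \<Longrightarrow> space \<nu> = topspace T"
  using sets_eq_imp_space_eq[OF representing_sets] by simp

lemma representing_polyfun:
  assumes "representing \<nu>" "polyfun \<Omega> f"
  shows "integrable \<nu> f" "(\<integral>\<alpha>. f \<alpha> \<partial>\<nu>) = ext.Lam f" "f \<in> borel_measurable \<nu>"
proof -
  obtain p where p: "p \<in> poly_ring \<Omega>" "poly_eval p = f" using polyfun_imp_poly_eval[OF assms(2)] by blast
  then show "integrable \<nu> f" "(\<integral>\<alpha>. f \<alpha> \<partial>\<nu>) = ext.Lam f"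
    using assms(1) Lam_poly_eval[OF p(1)] by (auto simp: representing_def represents_def)
  then show "f \<in> borel_measurable \<nu>" by auto
qed

lemma representing_finite: "representing \<nu> \<Longrightarrow> finite_measure \<nu>"
proof -
  assume "representing \<nu>"
  then have "integrable \<nu> (\<lambda>_. 1 :: real)" by (rule representing_polyfun) (rule polyfun.const)
  then have "emeasure \<nu> (space \<nu>) < \<infinity>" by (simp add: integrable_iff_bounded)
  then show ?thesis by (intro finite_measureI) auto
qed

text \<open>A fraction is dominated by its polynomial numerator because \<open>d \<ge> 1\<close>,
  hence integrable; \<open>Lam_unique\<close> then identifies the integral.\<close>

lemma representing_B:
  assumes \<nu>: "representing \<nu>" and \<phi>: "\<phi> \<in> ext.B"
  shows "integrable \<nu> \<phi>" "(\<integral>\<alpha>. \<phi> \<alpha> \<partial>\<nu>) = ext.Lam \<phi>"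
proof -
  have int: "integrable \<nu> \<psi>" if \<psi>: "\<psi> \<in> ext.B" for \<psi>
  proof -
    obtain d where d: "d \<in> ext.D" "polyfun \<Omega> (d * \<psi>)" using \<psi> unfolding ext.B_def by blast
    have dp: "polyfun \<Omega> d" using ext.D_sub[OF d(1)] by simp
    have d1: "1 \<le> d \<alpha>" for \<alpha> by (rule ext.D_ge_1[OF d(1)])
    have nz: "d \<alpha> \<noteq> 0" for \<alpha> using d1[of \<alpha>] by linarith
    have eq: "\<psi> = (\<lambda>\<alpha>. (d * \<psi>) \<alpha> / d \<alpha>)"
      by (rule ext) (use nz in \<open>simp add: fun_apply\<close>)
    show ?thesis
    proof (rule Bochner_Integration.integrable_bound[OF representing_polyfun(1)[OF \<nu> d(2)]])
      show "\<psi> \<in> borel_measurable \<nu>"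
        by (subst eq) (intro borel_measurable_divide representing_polyfun(3)[OF \<nu>] d dp)
      have "\<bar>\<psi> \<alpha>\<bar> \<le> \<bar>d \<alpha>\<bar> * \<bar>\<psi> \<alpha>\<bar>" for \<alpha>
        using mult_right_mono[OF d1[of \<alpha>], of "\<bar>\<psi> \<alpha>\<bar>"] d1[of \<alpha>] by simp
      then show "AE \<alpha> in \<nu>. norm (\<psi> \<alpha>) \<le> norm ((d * \<psi>) \<alpha>)"
        by (simp add: fun_apply abs_mult)
    qed
  qed
  show "integrable \<nu> \<phi>" by (rule int[OF \<phi>])
  show "(\<integral>\<alpha>. \<phi> \<alpha> \<partial>\<nu>) = ext.Lam \<phi>"
  proof (rule ext.Lam_unique[OF _ _ _ \<phi>])
    show "functional ext.B (\<lambda>\<phi>. \<integral>\<alpha>. \<phi> \<alpha> \<partial>\<nu>)"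
      by unfold_locales (use int in \<open>auto simp: fun_apply\<close>)
    show "0 \<le> (\<integral>\<alpha>. \<psi> \<alpha> \<partial>\<nu>)" if "\<And>\<alpha>. 0 \<le> \<psi> \<alpha>" for \<psi> :: "('i \<Rightarrow> real) \<Rightarrow> real"
      using that by (intro integral_nonneg_AE) auto
    fix f assume "f \<in> Collect (polyfun \<Omega>)"
    then show "(\<integral>\<alpha>. f \<alpha> \<partial>\<nu>) = L (inv poly_eval f)"
      using representing_polyfun(2)[OF \<nu>, of f] ext.Lam_A[of f] by simp
  qed
qed

text \<open>Let \<open>h\<close> be the positive part of \<open>b^2 - 1\<close>. Bernoulli gives
  \<open>m h \<le> b^(2 m)\<close>, and the integral of the right side is at most
  \<open>Lam 1\<close> for every \<open>m\<close>, so \<open>h\<close> integrates to 0.\<close>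

lemma representing_b_le:
  assumes \<nu>: "representing \<nu>"
  shows "AE \<alpha> in \<nu>. (b n \<alpha>)\<^sup>2 \<le> 1"
proof -
  interpret finite_measure \<nu> by (rule representing_finite[OF \<nu>])
  define h where "h \<alpha> = max 0 ((b n \<alpha>)\<^sup>2 - 1)" for \<alpha>
  have b2: "(b n)\<^sup>2 \<in> ext.B" by simp
  have bi: "integrable \<nu> (\<lambda>\<alpha>. (b n \<alpha>)\<^sup>2)"
    using representing_B(1)[OF \<nu> b2] by (simp add: fun_apply[abs_def] power2_eq_square times_fun_def)
  have hi: "integrable \<nu> h" unfolding h_def using bi by (intro integrable_max) auto
  have le: "(\<integral>\<alpha>. h \<alpha> \<partial>\<nu>) \<le> ext.Lam 1 / real m" if m: "m \<ge> 1" for m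
  proof -
    have bm: "b n ^ (2 * m) \<in> ext.B" by simp
    have "real m * (\<integral>\<alpha>. h \<alpha> \<partial>\<nu>) = (\<integral>\<alpha>. real m * h \<alpha> \<partial>\<nu>)" by simp
    also have "\<dots> \<le> (\<integral>\<alpha>. (b n ^ (2 * m)) \<alpha> \<partial>\<nu>)"
    proof (rule integral_mono)
      show "integrable \<nu> (\<lambda>\<alpha>. real m * h \<alpha>)" using hi by simp
      show "integrable \<nu> (b n ^ (2 * m))" by (rule representing_B(1)[OF \<nu> bm])
      fix \<alpha>
      show "real m * h \<alpha> \<le> (b n ^ (2 * m)) \<alpha>"
      proof (cases "(b n \<alpha>)\<^sup>2 \<le> 1")
        case True
        then show ?thesis by (simp add: h_def fun_apply power_mult)
      next
        case False
        then have "real m * h \<alpha> = real m * ((b n \<alpha>)\<^sup>2 - 1)" by (simp add: h_def)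
        also have "\<dots> \<le> (1 + ((b n \<alpha>)\<^sup>2 - 1)) ^ m"
          using Bernoulli_inequality[of "(b n \<alpha>)\<^sup>2 - 1" m] by (smt (verit) zero_le_power2)
        finally show ?thesis by (simp add: fun_apply power_mult)
      qed
    qed
    also have "\<dots> = ext.Lam (1\<^sup>2 * b n ^ (2 * m))"
      using representing_B(2)[OF \<nu> bm] by simp
    also have "\<dots> \<le> ext.Lam (1\<^sup>2)" by (rule Lam_b_power) simp
    finally show ?thesis using m by (simp add: field_simps)
  qed
  have "(\<integral>\<alpha>. h \<alpha> \<partial>\<nu>) \<le> 0"
    by (rule LIMSEQ_le_const[OF lim_const_over_n[of "ext.Lam 1"]]) (use le in auto)
  moreover have "0 \<le> (\<integral>\<alpha>. h \<alpha> \<partial>\<nu>)" by (intro integral_nonneg_AE) (auto simp: h_def)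
  ultimately have "(\<integral>\<alpha>. h \<alpha> \<partial>\<nu>) = 0" by simp
  then have "AE \<alpha> in \<nu>. h \<alpha> = 0"
  proof -
    have "AE \<alpha> in \<nu>. 0 \<le> h \<alpha>" by (simp add: h_def)
    then show ?thesis using integral_nonneg_eq_0_iff_AE[OF hi] \<open>(\<integral>\<alpha>. h \<alpha> \<partial>\<nu>) = 0\<close> by blast
  qed
  then show ?thesis by eventually_elim (simp add: h_def max_def split: if_splits)
qed

text \<open>The null open sets \<open>U i\<close> may be uncountably many;
  \<open>radon_measure_null_union\<close> combines them.\<close>

lemma bounded_part_null:
  assumes \<nu>: "representing \<nu>"
  shows "topspace T - bounded_part \<in> null_sets \<nu>" "bounded_part \<in> sets \<nu>"
proof -
  define U where "U i = {\<alpha> \<in> topspace T. \<bar>\<alpha> i\<bar> \<in> {\<kappa> i<..}}" for i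
  have U: "openin T (U i)" if "i \<in> \<Omega>" for i
    unfolding U_def using that by (rule openin_coordinate_gt)
  have eq: "topspace T - bounded_part = \<Union>(U ` (\<Omega> - I))"
    unfolding bounded_part_compl U_def ..
  have op: "openin T (\<Union>(U ` (\<Omega> - I)))" using U by (intro openin_Union) auto
  have sets: "topspace T - bounded_part \<in> sets \<nu>"
    unfolding eq representing_sets[OF \<nu>] by (rule openin_sets_borel_of[OF op])
  have "emeasure \<nu> (U i) = 0" if i: "i \<in> \<Omega> - I" for i
  proof -
    have Us: "U i \<in> sets \<nu>" using U i by (simp add: representing_sets[OF \<nu>] openin_sets_borel_of)
    have "AE \<alpha> in \<nu>. \<alpha> \<notin> U i"
      using representing_b_le[OF \<nu>, of "(i, False)"]
    proof eventually_elim
      case (elim \<alpha>)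
      then have "\<bar>\<alpha> i / \<kappa> i\<bar> \<le> 1"
        using i by (simp add: b_bounded fun_apply abs_square_le_1)
      then show ?case using \<kappa>(1)[OF i] by (simp add: U_def divide_le_eq)
    qed
    then show ?thesis using Us by (simp add: AE_iff_null_sets[symmetric] null_setsD1)
  qed
  note null = this
  have "emeasure \<nu> (topspace T - bounded_part) = 0"
  proof (rule radon_measure_null_union[of T \<nu> "U ` (\<Omega> - I)"])
    show "radon_measure T \<nu>" using \<nu> by (simp add: representing_def)
    show "openin T V" "emeasure \<nu> V = 0" if "V \<in> U ` (\<Omega> - I)" for V
      using that U null by blast+
  qed (use sets eq in simp_all)
  then show "topspace T - bounded_part \<in> null_sets \<nu>" using sets by auto
  have "bounded_part = topspace T - (topspace T - bounded_part)" by (auto simp: bounded_part_def)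
  then show "bounded_part \<in> sets \<nu>"
    using sets.compl_sets[OF sets] representing_space[OF \<nu>] by simp
qed

lemma AE_bounded_part: "representing \<nu> \<Longrightarrow> AE \<alpha> in \<nu>. \<alpha> \<in> bounded_part"
  by (rule AE_I'[OF bounded_part_null(1)]) (auto simp: representing_space)

text \<open>\<open>p = g Q\<close> has the sign of \<open>g\<close> and is a polynomial in the cube
  coordinates. Testing it against polynomials close to its negative part \<open>h\<close> gives a
  nonnegative limit, while \<open>p h = - h^2\<close>; so \<open>h\<close> vanishes almost
  everywhere.\<close>

lemma representing_nonneg:
  assumes \<nu>: "representing \<nu>" and g: "g \<in> poly_eval ` M"
  shows "AE \<alpha> in \<nu>. 0 \<le> g \<alpha>"
proof -
  interpret finite_measure \<nu> by (rule representing_finite[OF \<nu>])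
  have gp: "polyfun \<Omega> g" using g ext.M_sub by blast
  obtain d Q P where c: "compactifies g d Q P" using compactifies_exists[OF gp] by blast
  have P: "polyfun UNIV P" and Q: "polyfun UNIV Q" and dD: "d \<in> ext.D"
    and Q0: "\<And>t. t \<in> cube \<Longrightarrow> 0 \<le> Q t" and Pd: "\<And>\<alpha>. P (\<beta> \<alpha>) * d \<alpha> = g \<alpha>"
    using c by (auto simp: compactifies_def)
  define p where "p = (\<lambda>\<alpha>. P (\<beta> \<alpha>))"
  have pB: "p \<in> ext.B" unfolding p_def by (rule polyfun_in_B[OF P])
  have pos: "0 \<le> (\<integral>\<alpha>. p \<alpha> * R (\<beta> \<alpha>) \<partial>\<nu>)"
    if R: "polyfun UNIV R" "\<And>t. t \<in> cube \<Longrightarrow> 0 \<le> R t" for R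
  proof -
    have "0 \<le> ext.Lam (g * (\<lambda>\<alpha>. (\<lambda>t. Q t * R t) (\<beta> \<alpha>)))"
      by (rule weighted_nonneg[OF g, of UNIV]) (use Q Q0 R in \<open>auto intro: polyfun.intros\<close>)
    also have "g * (\<lambda>\<alpha>. (\<lambda>t. Q t * R t) (\<beta> \<alpha>)) = (g * (\<lambda>\<alpha>. Q (\<beta> \<alpha>))) * (\<lambda>\<alpha>. R (\<beta> \<alpha>))"
      by (rule ext) (simp add: fun_apply)
    also have "\<dots> = p * (\<lambda>\<alpha>. R (\<beta> \<alpha>))"
      unfolding compactifies_eq[OF c, symmetric] p_def ..
    also have "ext.Lam (p * (\<lambda>\<alpha>. R (\<beta> \<alpha>))) = (\<integral>\<alpha>. (p * (\<lambda>\<alpha>. R (\<beta> \<alpha>))) \<alpha> \<partial>\<nu>)"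
      using representing_B(2)[OF \<nu>] pB polyfun_in_B[OF R(1)] by simp
    finally show ?thesis by (simp add: fun_apply)
  qed
  define h where "h \<alpha> = max 0 (- p \<alpha>)" for \<alpha>
  have pi: "integrable \<nu> p" by (rule representing_B(1)[OF \<nu> pB])
  have "p * p \<in> ext.B" using pB by simp
  then have p2i: "integrable \<nu> (\<lambda>\<alpha>. p \<alpha> * p \<alpha>)"
    using representing_B(1)[OF \<nu>] unfolding times_fun_def by blast
  have hi: "integrable \<nu> (\<lambda>\<alpha>. h \<alpha> * h \<alpha>)"
  proof (rule Bochner_Integration.integrable_bound[OF p2i])
    show "(\<lambda>\<alpha>. h \<alpha> * h \<alpha>) \<in> borel_measurable \<nu>"
      unfolding h_def using borel_measurable_integrable[OF pi] by simp
    show "AE \<alpha> in \<nu>. norm (h \<alpha> * h \<alpha>) \<le> norm (p \<alpha> * p \<alpha>)" by (auto simp: h_def max_def)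
  qed
  have ph: "p \<alpha> * h \<alpha> = - (h \<alpha> * h \<alpha>)" for \<alpha> by (auto simp: h_def max_def)
  define C where "C = (\<integral>\<alpha>. \<bar>p \<alpha>\<bar> \<partial>\<nu>)"
  have le: "(\<integral>\<alpha>. h \<alpha> * h \<alpha> \<partial>\<nu>) \<le> 2 * e * C" if e: "e > 0" for e
  proof -
    have "continuous_on cube (\<lambda>t. max 0 (- P t))"
      by (intro continuous_intros continuous_on_polyfun[OF P])
    then obtain R where R: "polyfun UNIV R" "\<And>t. t \<in> cube \<Longrightarrow> \<bar>max 0 (- P t) - R t\<bar> \<le> e"
      using polyfun_approx[OF _ e] by blast
    \<comment> \<open>The shift by \<open>e\<close> restores nonnegativity on the cube; it also
      turns the error \<open>e\<close> into the \<open>2 * e\<close> of the estimate.\<close>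
    have Re: "polyfun UNIV (\<lambda>t. R t + e)" by (intro polyfun.intros R)
    have "0 \<le> (\<integral>\<alpha>. p \<alpha> * (R (\<beta> \<alpha>) + e) \<partial>\<nu>)"
    proof (rule pos[OF Re])
      fix t :: "'i \<times> bool \<Rightarrow> real" assume "t \<in> cube"
      then have "\<bar>max 0 (- P t) - R t\<bar> \<le> e" "0 \<le> max 0 (- P t)" using R(2) by auto
      then show "0 \<le> R t + e" by linarith
    qed
    also have "\<dots> \<le> (\<integral>\<alpha>. - (h \<alpha> * h \<alpha>) + 2 * e * \<bar>p \<alpha>\<bar> \<partial>\<nu>)"
    proof (rule integral_mono_AE)
      have "p * (\<lambda>\<alpha>. R (\<beta> \<alpha>) + e) \<in> ext.B" using polyfun_in_B[OF Re] pB by simp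
      then show "integrable \<nu> (\<lambda>\<alpha>. p \<alpha> * (R (\<beta> \<alpha>) + e))"
        using representing_B(1)[OF \<nu>] by (fastforce simp: times_fun_def)
      show "integrable \<nu> (\<lambda>\<alpha>. - (h \<alpha> * h \<alpha>) + 2 * e * \<bar>p \<alpha>\<bar>)"
        using hi pi by auto
      show "AE \<alpha> in \<nu>. p \<alpha> * (R (\<beta> \<alpha>) + e) \<le> - (h \<alpha> * h \<alpha>) + 2 * e * \<bar>p \<alpha>\<bar>"
        using AE_bounded_part[OF \<nu>]
      proof eventually_elim
        case (elim \<alpha>)
        have "\<bar>h \<alpha> - R (\<beta> \<alpha>)\<bar> \<le> e" using R(2)[OF \<beta>_in_cube[OF elim]] by (simp add: h_def p_def)
        then have "\<bar>R (\<beta> \<alpha>) + e - h \<alpha>\<bar> \<le> 2 * e" by linarith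
        then have "p \<alpha> * (R (\<beta> \<alpha>) + e - h \<alpha>) \<le> \<bar>p \<alpha>\<bar> * (2 * e)"
          using abs_ge_self[of "p \<alpha> * (R (\<beta> \<alpha>) + e - h \<alpha>)"]
            mult_left_mono[of "\<bar>R (\<beta> \<alpha>) + e - h \<alpha>\<bar>" "2 * e" "\<bar>p \<alpha>\<bar>"] by (simp add: abs_mult)
        then show ?case using ph[of \<alpha>] by (simp add: algebra_simps)
      qed
    qed
    also have "\<dots> = - (\<integral>\<alpha>. h \<alpha> * h \<alpha> \<partial>\<nu>) + 2 * e * C"
      unfolding C_def using hi pi by simp
    finally show ?thesis by simp
  qed
  have "(\<integral>\<alpha>. h \<alpha> * h \<alpha> \<partial>\<nu>) \<le> 0"
  proof (rule field_le_epsilon)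
    fix \<epsilon> :: real assume \<epsilon>: "0 < \<epsilon>"
    have C0: "0 \<le> C" unfolding C_def by simp
    define e where "e = \<epsilon> / (2 * (C + 1))"
    have "e > 0" using \<epsilon> C0 by (simp add: e_def)
    moreover have "2 * e * C \<le> \<epsilon>" using \<epsilon> C0 by (simp add: e_def field_simps)
    ultimately show "(\<integral>\<alpha>. h \<alpha> * h \<alpha> \<partial>\<nu>) \<le> 0 + \<epsilon>" using le[of e] by linarith
  qed
  moreover have "0 \<le> (\<integral>\<alpha>. h \<alpha> * h \<alpha> \<partial>\<nu>)" by (intro integral_nonneg_AE) auto
  ultimately have "(\<integral>\<alpha>. h \<alpha> * h \<alpha> \<partial>\<nu>) = 0" by simp
  then have "AE \<alpha> in \<nu>. h \<alpha> * h \<alpha> = 0"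
    using integral_nonneg_eq_0_iff_AE[OF hi] by simp
  then show ?thesis
  proof eventually_elim
    case (elim \<alpha>)
    then have "0 \<le> p \<alpha>" by (simp add: h_def max_def split: if_splits)
    then have "0 \<le> p \<alpha> * d \<alpha>" using ext.D_ge_1[OF dD, of \<alpha>] by simp
    then show ?case using Pd by (simp add: p_def)
  qed
qed

text \<open>Each \<open>g \<in> M\<close> contributes the null open set \<open>U g\<close> where it
  is negative. A set disjoint from \<open>nonneg_set\<close> is covered by these, possibly
  uncountably many, sets.\<close>

theorem representing_supported:
  assumes \<nu>: "representing \<nu>"
  shows "supported_by \<nu> (nonneg_set \<Omega> M)"
  unfolding supported_by_def
proof (intro ballI impI)
  fix E assume E: "E \<in> sets \<nu>" "E \<inter> nonneg_set \<Omega> M = {}"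
  define U where "U g = {\<alpha> \<in> topspace T. poly_eval g \<alpha> \<in> {..<0}}" for g
  have gp: "polyfun \<Omega> (poly_eval g)" if "g \<in> M" for g
    using that ext.M_sub by auto
  have U: "openin T (U g)" if "g \<in> M" for g
    unfolding U_def
    by (rule openin_continuous_map_preimage[OF continuous_map_polyfun[OF gp[OF that]]]) auto
  have null: "emeasure \<nu> (U g) = 0" if g: "g \<in> M" for g
  proof -
    have Us: "U g \<in> sets \<nu>" using U g by (simp add: representing_sets[OF \<nu>] openin_sets_borel_of)
    have "AE \<alpha> in \<nu>. \<alpha> \<notin> U g"
      using representing_nonneg[OF \<nu>, of "poly_eval g"] g by (auto simp: U_def)
    then show ?thesis using Us by (simp add: AE_iff_null_sets[symmetric] null_setsD1)
  qed
  have "E \<subseteq> topspace T" using sets.sets_into_space[OF E(1)] representing_space[OF \<nu>] by simp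
  have "E \<subseteq> \<Union>(U ` M)"
  proof
    fix \<alpha> assume \<alpha>: "\<alpha> \<in> E"
    then have "\<alpha> \<in> topspace T" "\<alpha> \<notin> nonneg_set \<Omega> M"
      using E(2) \<open>E \<subseteq> topspace T\<close> by blast+
    then obtain g where "g \<in> M" "poly_eval g \<alpha> < 0"
      unfolding nonneg_set_def not_le[symmetric] by blast
    then show "\<alpha> \<in> \<Union>(U ` M)" using \<open>\<alpha> \<in> topspace T\<close> by (auto simp: U_def)
  qed
  note E' = this
  show "emeasure \<nu> E = 0"
  proof (rule radon_measure_null_union[of T \<nu> "U ` M"])
    show "radon_measure T \<nu>" using \<nu> by (simp add: representing_def)
    show "openin T V" "emeasure \<nu> V = 0" if "V \<in> U ` M" for V
      using that U null by blast+
  qed (use E E' in simp_all)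
qed

text \<open>Inner regularity of \<open>\<nu>\<close> gives a compact \<open>D\<close> filling most
  of \<open>bounded_part - C\<close>. A polynomial \<open>P\<close> close to a function that is 1 on
  \<open>\<beta>\<close> C\<open>and 0 on\<close>\<beta> \<open>D\<close> has the same integral
  under both measures; it dominates \<open>C\<close> for \<open>\<nu>'\<close> and costs little off
  \<open>C\<close> for \<open>\<nu>\<close>.\<close>

lemma representing_compact_le:
  assumes \<nu>: "representing \<nu>" and \<nu>': "representing \<nu>'" and C: "compactin T C" "C \<subseteq> bounded_part"
  shows "measure \<nu>' C \<le> measure \<nu> C"
proof (rule field_le_epsilon)
  fix \<epsilon> :: real assume \<epsilon>: "0 < \<epsilon>"
  interpret n: finite_measure \<nu> by (rule representing_finite[OF \<nu>])
  interpret n': finite_measure \<nu>' by (rule representing_finite[OF \<nu>'])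
  have Cs: "C \<in> sets (borel_of T)" by (rule compactin_sets_borel_of[OF Hausdorff_powertop_real C(1)])
  then have C\<nu>: "C \<in> sets \<nu>" and C\<nu>': "C \<in> sets \<nu>'" using representing_sets \<nu> \<nu>' by auto
  define V where "V = bounded_part - C"
  have V: "V \<in> sets \<nu>" unfolding V_def using bounded_part_null(2)[OF \<nu>] C\<nu> by auto
  have "\<exists>D. compactin T D \<and> D \<subseteq> V \<and> measure \<nu> V < measure \<nu> D + \<epsilon> / 2"
  \<comment> \<open>The case split keeps \<open>measure \<nu> V - \<epsilon> / 2\<close> nonnegative
    before it is cast by \<open>ennreal\<close>, which truncates negative numbers.\<close>
  proof (cases "measure \<nu> V < \<epsilon> / 2")
    case True
    then show ?thesis by (intro exI[of _ "{}"]) simp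
  next
    case False
    have "ennreal (measure \<nu> V - \<epsilon> / 2) < emeasure \<nu> V"
      using False \<epsilon> by (simp add: n.emeasure_eq_measure ennreal_less_iff)
    also have "emeasure \<nu> V = (SUP K\<in>{K. compactin T K \<and> K \<subseteq> V}. emeasure \<nu> K)"
      using \<nu> V by (simp add: representing_def radon_measure_def)
    finally obtain D where D: "compactin T D" "D \<subseteq> V" "ennreal (measure \<nu> V - \<epsilon> / 2) < emeasure \<nu> D"
      unfolding less_SUP_iff by auto
    then have "measure \<nu> V - \<epsilon> / 2 < measure \<nu> D"
      using False by (simp add: n.emeasure_eq_measure ennreal_less_iff)
    then show ?thesis using D by (intro exI[of _ D]) simp
  qed
  then obtain D where D: "compactin T D" "D \<subseteq> V" "measure \<nu> V < measure \<nu> D + \<epsilon> / 2" by blast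
  have Ds: "D \<in> sets \<nu>"
    using compactin_sets_borel_of[OF Hausdorff_powertop_real D(1)] representing_sets[OF \<nu>] by simp
  have Z: "measure \<nu> (V - D) < \<epsilon> / 2"
    using n.finite_measure_Diff[OF V Ds D(2)] D(3) by simp
  have comp: "closedin (top_of_set cube) (\<beta> ` S)" if S: "compactin T S" "S \<subseteq> bounded_part" for S
  proof -
    have "compactin euclidean (\<beta> ` S)" by (rule image_compactin[OF S(1) continuous_map_\<beta>])
    moreover have "\<beta> ` S \<subseteq> cube" using S \<beta>_in_cube by auto
    ultimately have "compactin (top_of_set cube) (\<beta> ` S)" by (simp add: compactin_subtopology)
    then show ?thesis by (rule compactin_imp_closedin[OF Hausdorff_space_cube])
  qed
  have "closedin (top_of_set cube) (\<beta> ` C)" by (rule comp[OF C])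
  moreover have "closedin (top_of_set cube) (\<beta> ` D)" by (rule comp[OF D(1)]) (use D(2) in \<open>auto simp: V_def\<close>)
  moreover have "\<beta> ` D \<inter> \<beta> ` C = {}"
    using \<beta>_inj C(2) D(2) by (auto simp: V_def inj_on_def)
  ultimately obtain f where f: "continuous_map (top_of_set cube) euclideanreal f"
    "\<And>t. t \<in> topspace (top_of_set cube) \<Longrightarrow> 0 \<le> f t \<and> f t \<le> 1"
    "\<And>t. t \<in> \<beta> ` D \<Longrightarrow> f t = 0" "\<And>t. t \<in> \<beta> ` C \<Longrightarrow> f t = 1"
    using Urysohn_compact_Hausdorff[OF compact_space_cube Hausdorff_space_cube, of "\<beta> ` D" "\<beta> ` C"] by blast
  \<comment> \<open>Makes the total cost \<open>2 e\<close> of the approximation integrate to at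
    most \<open>\<epsilon> / 2\<close>; the set \<open>V - D\<close> accounts for the other
    half.\<close>
  define e where "e = \<epsilon> / (4 * (measure \<nu> (space \<nu>) + 1))"
  have e: "e > 0" using \<epsilon> by (simp add: e_def add_nonneg_pos)
  have em: "2 * e * measure \<nu> (space \<nu>) \<le> \<epsilon> / 2"
  proof -
    have "0 < 4 * (measure \<nu> (space \<nu>) + 1)"
      by (intro mult_pos_pos add_nonneg_pos) auto
    then have "4 * (measure \<nu> (space \<nu>) + 1) \<noteq> 0" by (rule less_imp_neq[symmetric])
    then have "e * (4 * (measure \<nu> (space \<nu>) + 1)) = \<epsilon>"
      unfolding e_def by (metis nonzero_eq_divide_eq)
    then show ?thesis using e by (simp add: algebra_simps)
  qed
  obtain P where P: "polyfun UNIV P" "\<And>t. t \<in> cube \<Longrightarrow> \<bar>f t - P t\<bar> \<le> e"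
    using polyfun_approx[OF _ e, of f] f(1) by auto
  have Pe: "polyfun UNIV (\<lambda>t. P t + e)" by (intro polyfun.intros P)
  note int = representing_B[OF _ polyfun_in_B[OF Pe]]
  have "measure \<nu>' C = (\<integral>\<alpha>. indicator C \<alpha> \<partial>\<nu>')"
    using C\<nu>' by (simp add: Int_absorb2 sets.sets_into_space)
  also have "\<dots> \<le> (\<integral>\<alpha>. P (\<beta> \<alpha>) + e \<partial>\<nu>')"
  proof (rule integral_mono_AE)
    show "integrable \<nu>' (indicator C :: _ \<Rightarrow> real)"
      using C\<nu>' by (intro integrable_real_indicator) (auto simp: less_top[symmetric])
    show "integrable \<nu>' (\<lambda>\<alpha>. P (\<beta> \<alpha>) + e)" by (rule int(1)[OF \<nu>'])
    show "AE \<alpha> in \<nu>'. indicator C \<alpha> \<le> P (\<beta> \<alpha>) + e"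
      using AE_bounded_part[OF \<nu>']
    proof eventually_elim
      case (elim \<alpha>)
      then have t: "\<beta> \<alpha> \<in> cube" by (rule \<beta>_in_cube)
      have "f (\<beta> \<alpha>) \<le> P (\<beta> \<alpha>) + e" using P(2)[OF t] by linarith
      moreover have "indicator C \<alpha> \<le> f (\<beta> \<alpha>)" using f(2)[of "\<beta> \<alpha>"] f(4) t by (auto simp: indicator_def)
      ultimately show ?case by linarith
    qed
  qed
  also have "\<dots> = (\<integral>\<alpha>. P (\<beta> \<alpha>) + e \<partial>\<nu>)" using int(2)[OF \<nu>] int(2)[OF \<nu>'] by simp
  also have "\<dots> \<le> (\<integral>\<alpha>. indicator C \<alpha> + indicator (V - D) \<alpha> + 2 * e \<partial>\<nu>)"
  proof (rule integral_mono_AE)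
    show "integrable \<nu> (\<lambda>\<alpha>. P (\<beta> \<alpha>) + e)" by (rule int(1)[OF \<nu>])
    show "integrable \<nu> (\<lambda>\<alpha>. indicator C \<alpha> + indicator (V - D) \<alpha> + 2 * e :: real)"
      using C\<nu> V Ds by (intro Bochner_Integration.integrable_add integrable_real_indicator) (auto simp: less_top[symmetric])
    show "AE \<alpha> in \<nu>. P (\<beta> \<alpha>) + e \<le> indicator C \<alpha> + indicator (V - D) \<alpha> + 2 * e"
      using AE_bounded_part[OF \<nu>]
    proof eventually_elim
      case (elim \<alpha>)
      then have t: "\<beta> \<alpha> \<in> cube" by (rule \<beta>_in_cube)
      have "P (\<beta> \<alpha>) + e \<le> f (\<beta> \<alpha>) + 2 * e" using P(2)[OF t] by linarith
      moreover have "f (\<beta> \<alpha>) \<le> indicator C \<alpha> + indicator (V - D) \<alpha>"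
        using f(2)[of "\<beta> \<alpha>"] f(3) t elim by (auto simp: indicator_def V_def)
      ultimately show ?case by linarith
    qed
  qed
  also have "\<dots> = measure \<nu> C + measure \<nu> (V - D) + 2 * e * measure \<nu> (space \<nu>)"
  proof -
    have "integrable \<nu> (indicator C :: _ \<Rightarrow> real)" "integrable \<nu> (indicator (V - D) :: _ \<Rightarrow> real)"
      using C\<nu> V Ds by (auto intro!: integrable_real_indicator simp: less_top[symmetric])
    moreover have "C \<inter> space \<nu> = C" "(V - D) \<inter> space \<nu> = V - D"
      using sets.sets_into_space[OF C\<nu>] sets.sets_into_space[OF V] by auto
    ultimately show ?thesis by simp
  qed
  also have "\<dots> \<le> measure \<nu> C + \<epsilon>" using Z em by linarith
  finally show "measure \<nu>' C \<le> measure \<nu> C + \<epsilon>" .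
qed

text \<open>Using \<open>representing_compact_le\<close> in both directions settles compact subsets
  of the closed set \<open>bounded_part\<close>; its complement is null for both measures, and inner
  regularity extends equality to all Borel sets.\<close>

theorem representing_unique:
  assumes \<nu>: "representing \<nu>" and \<nu>': "representing \<nu>'"
  shows "\<nu> = \<nu>'"
proof (rule measure_eqI)
  show sets: "sets \<nu> = sets \<nu>'" using representing_sets \<nu> \<nu>' by simp
  interpret n: finite_measure \<nu> by (rule representing_finite[OF \<nu>])
  interpret n': finite_measure \<nu>' by (rule representing_finite[OF \<nu>'])
  have restrict: "emeasure \<mu> K = emeasure \<mu> (K \<inter> bounded_part)"
    if \<mu>: "representing \<mu>" and K: "K \<in> sets \<mu>" for \<mu> K
  proof -
    have "K \<inter> bounded_part = K - (topspace T - bounded_part)"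
      using sets.sets_into_space[OF K] representing_space[OF \<mu>] by (auto simp: bounded_part_def)
    then show ?thesis
      using emeasure_Diff_null_set[OF bounded_part_null(1)[OF \<mu>] K] by simp
  qed
  have "closedin T bounded_part"
    using openin_bounded_part_compl unfolding closedin_def by (auto simp: bounded_part_def)
  then have eqK: "emeasure \<nu> K = emeasure \<nu>' K" if K: "compactin T K" for K
  proof -
    have Ks: "K \<in> sets \<nu>" "K \<in> sets \<nu>'"
      using compactin_sets_borel_of[OF Hausdorff_powertop_real K] representing_sets \<nu> \<nu>' by auto
    have "compactin T (K \<inter> bounded_part)"
      using K \<open>closedin T bounded_part\<close> by (rule compact_Int_closedin)
    then have "measure \<nu> (K \<inter> bounded_part) = measure \<nu>' (K \<inter> bounded_part)"
      by (intro antisym representing_compact_le \<nu> \<nu>') auto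
    then show ?thesis
      using restrict[OF \<nu> Ks(1)] restrict[OF \<nu>' Ks(2)]
      by (simp add: n.emeasure_eq_measure n'.emeasure_eq_measure)
  qed
  fix B assume "B \<in> sets \<nu>"
  then have "emeasure \<nu> B = (SUP K\<in>{K. compactin T K \<and> K \<subseteq> B}. emeasure \<nu> K)"
    "emeasure \<nu>' B = (SUP K\<in>{K. compactin T K \<and> K \<subseteq> B}. emeasure \<nu>' K)"
    using \<nu> \<nu>' sets by (auto simp: representing_def radon_measure_def)
  moreover have "(SUP K\<in>{K. compactin T K \<and> K \<subseteq> B}. emeasure \<nu> K) = (SUP K\<in>{K. compactin T K \<and> K \<subseteq> B}. emeasure \<nu>' K)"
    by (rule SUP_cong) (auto simp: eqK)
  ultimately show "emeasure \<nu> B = emeasure \<nu>' B" by simp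
qed

end

theorem proposition5p4:
  fixes \<Omega> I :: "'i set"
    and M :: "('i, real) mpoly set"
    and L :: "('i, real) mpoly \<Rightarrow> real"
  assumes "quadratic_module (poly_ring \<Omega>) M"
    and "I \<subseteq> \<Omega>" and "countable I"
    and "archimedean_module (poly_ring (\<Omega> - I)) (M \<inter> poly_ring (\<Omega> - I))"
    and "linear_functional_on (poly_ring \<Omega>) L"
    and "\<forall>f\<in>M. 0 \<le> L f"
    and "\<forall>j\<in>I. \<exists>q :: nat \<Rightarrow> ('i, complex) mpoly. (\<forall>k. q k \<in> poly_ring \<Omega>) \<and>
           (\<lambda>k. L (norm_sq (1 - (1 + (Var j)\<^sup>2) * q k * cnj_poly (q k)))) \<longlonglongrightarrow> 0"
  shows "(\<exists>!\<nu>. radon_measure (powertop_real \<Omega>) \<nu> \<and> represents \<Omega> L \<nu>) \<and>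
         (\<forall>\<nu>. radon_measure (powertop_real \<Omega>) \<nu> \<and> represents \<Omega> L \<nu> \<longrightarrow>
              supported_by \<nu> (nonneg_set \<Omega> M))"
proof -
  interpret moment \<Omega> I M L by (rule moment.intro) (fact assms)+
  show ?thesis
    using representing_radon_measure representing_unique representing_supported
    unfolding representing_def by blast
qed

end
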